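(* Let $n,k\in\mathbb{N}$, $\Omega\subseteq\mathbb{R}^n$ open and $R:\Omega\to SO(n)$ measurable. Assume that $\operatorname{Curl}R=f$ in the sense of distributions for some $f\in C^k(\Omega;\mathbb{R}^{n\times n\times n})$. Then $R\in C^{k+1}(\Omega;\mathbb{R}^{n\times n})$ (after modification on a null set).
   Context: $(\operatorname{Curl}R)_{mjk}=\partial_jR_{mk}-\partial_kR_{mj}$ (row-wise Curl). $\operatorname{Curl}R=f$ distributionally means $\int_\Omega(R_{mk}\partial_j\varphi-R_{mj}\partial_k\varphi)\,dx=-\int_\Omega\varphi f_{mjk}\,dx$ for all $\varphi\in C^\infty_c(\Omega)$ and all $m,j,k$. *)

theory Defs
  imports "HOL-Analysis.Analysis"
begin

definition has_partial :: "(real^'n \<Rightarrow> real) \<Rightarrow> 'n \<Rightarrow> real \<Rightarrow> real^'n \<Rightarrow> bool" where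
  "has_partial g j D x \<longleftrightarrow> ((\<lambda>t. g (x + t *\<^sub>R axis j 1)) has_real_derivative D) (at 0)"

definition pderiv :: "(real^'n \<Rightarrow> real) \<Rightarrow> 'n \<Rightarrow> real^'n \<Rightarrow> real" where
  "pderiv g j x = deriv (\<lambda>t. g (x + t *\<^sub>R axis j 1)) 0"

fun Ck_on :: "nat \<Rightarrow> (real^'n \<Rightarrow> real) \<Rightarrow> (real^'n) set \<Rightarrow> bool" where
  "Ck_on 0 g U \<longleftrightarrow> continuous_on U g"
| "Ck_on (Suc k) g U \<longleftrightarrow> continuous_on U g \<and>
     (\<forall>j. \<exists>dg. (\<forall>x\<in>U. has_partial g j (dg x) x) \<and> Ck_on k dg U)"

definition test_fun :: "(real^'n) set \<Rightarrow> (real^'n \<Rightarrow> real) \<Rightarrow> bool" where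
  "test_fun \<Omega> \<phi> \<longleftrightarrow> (\<forall>k. Ck_on k \<phi> UNIV) \<and>
     compact (closure {x. \<phi> x \<noteq> 0}) \<and> closure {x. \<phi> x \<noteq> 0} \<subseteq> \<Omega>"

definition SO :: "(real^'n^'n) set" where
  "SO = {Q. orthogonal_matrix Q \<and> det Q = 1}"

end

theory Submission
  imports Defs
begin

text \<open>
  Write \<open>R\<^sub>e\<close> for mollifications of \<open>R\<close>. Since a rotation is its own cofactor matrix and the
  divergence of cofactor rows is controlled by the Curl, passing to the limit in the cofactor
  identity for \<open>R\<^sub>e\<close> shows that the rows of \<open>R\<close> also have locally bounded distributional divergence.
  Curl and divergence bounds give a local \<open>L\<^sup>2\<close> bound on the gradient of \<open>R\<^sub>e\<close>, uniformly in \<open>e\<close>.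
  This is enough to pass to the limit in \<open>R R\<^sup>T = I\<close> differentiated: weakly, the derivative of
  \<open>R\<close> times \<open>R\<^sup>T\<close> is skew-symmetric, so that Koszul's formula expresses the distributional gradient
  of \<open>R\<close> as a polynomial in \<open>R\<close> and \<open>f\<close>. Hence \<open>R\<close> is locally Lipschitz, the gradient is continuous,
  and the gradient formula bootstraps to \<open>C\<^sup>k\<^sup>+\<^sup>1\<close>.
\<close>

section \<open>Bounded Borel functions, partial derivatives and integration by parts\<close>

text \<open>Two obstacles shape the argument. \<open>R\<close> has no derivatives, so
  \<open>R R^T = I\<close> cannot be differentiated by a product rule; and its mollifications are
  not rotations, so the pointwise algebra of rotations fails for them. Koszul's formula is therefore
  set up as algebra for a rotation and an arbitrary family \<open>D\<close>, which may then combine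
  the exact \<open>R\<close> with derivatives of mollifications. Each limit uses only what is
  available at its stage. The cofactor divergence is a polynomial in values and Curl, so dominated
  convergence suffices before any gradient bound exists. The gradient bound is a div-curl identity:
  for \<open>a j k\<close> the j-th derivative of component k,
  \<open>a j k * a k j - a k k * a j j\<close> is a sum of exact derivatives, so the cut-off energy
  is controlled by Curl and divergence. The antisymmetry limit then pairs gradients bounded in L2
  with values converging strongly in L2. The weak equation is only ever tested with mollifier
  kernels, so every distributional statement reads as a pointwise identity between
  mollifications.\<close>

definition bounded_borel :: "('a::euclidean_space \<Rightarrow> real) \<Rightarrow> bool" where
  "bounded_borel u \<longleftrightarrow> u \<in> borel_measurable borel \<and> (\<exists>B. \<forall>x. \<bar>u x\<bar> \<le> B)"

text \<open>Pairing a factor of this kind with bounded Borel factors reduces all integrability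
  questions to closure rules. Measuring the support by a radius keeps sums, shifts and reflections
  elementary.\<close>

definition bounded_supp :: "('a::euclidean_space \<Rightarrow> real) \<Rightarrow> bool" where
  "bounded_supp u \<longleftrightarrow> bounded_borel u \<and> (\<exists>r. \<forall>x. r < norm x \<longrightarrow> u x = 0)"

lemma bounded_borelI:
  "u \<in> borel_measurable borel \<Longrightarrow> (\<And>x. \<bar>u x\<bar> \<le> B) \<Longrightarrow> bounded_borel u"
  by (auto simp: bounded_borel_def)

lemma bounded_borel_measurable [measurable_dest]: "bounded_borel u \<Longrightarrow> u \<in> borel_measurable borel"
  by (simp add: bounded_borel_def)

lemma bounded_borel_const [intro!, simp]: "bounded_borel (\<lambda>x. c)"
  by (auto simp: bounded_borel_def)

lemma bounded_borel_uminus [intro!]: "bounded_borel u \<Longrightarrow> bounded_borel (\<lambda>x. - u x)"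
  by (auto simp: bounded_borel_def)

lemma bounded_borel_abs [intro!]: "bounded_borel u \<Longrightarrow> bounded_borel (\<lambda>x. \<bar>u x\<bar>)"
  by (auto simp: bounded_borel_def)

lemma bounded_borel_add [intro!]:
  assumes "bounded_borel u" "bounded_borel v"
  shows "bounded_borel (\<lambda>x. u x + v x)"
proof -
  obtain A B where "\<And>x. \<bar>u x\<bar> \<le> A" "\<And>x. \<bar>v x\<bar> \<le> B"
    using assms by (auto simp: bounded_borel_def)
  then have "\<bar>u x + v x\<bar> \<le> A + B" for x
    by (meson abs_triangle_ineq add_mono order_trans)
  then show ?thesis
    using assms by (intro bounded_borelI) (auto simp: bounded_borel_def)
qed

lemma bounded_borel_diff [intro!]:
  "bounded_borel u \<Longrightarrow> bounded_borel v \<Longrightarrow> bounded_borel (\<lambda>x. u x - v x)"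
  using bounded_borel_add[of u "\<lambda>x. - v x"] by auto

lemma bounded_borel_mult [intro!]:
  assumes "bounded_borel u" "bounded_borel v"
  shows "bounded_borel (\<lambda>x. u x * v x)"
proof -
  obtain A B where "\<And>x. \<bar>u x\<bar> \<le> A" "\<And>x. \<bar>v x\<bar> \<le> B"
    using assms by (auto simp: bounded_borel_def)
  then have "\<bar>u x * v x\<bar> \<le> A * B" for x
    unfolding abs_mult by (meson abs_ge_zero mult_mono order_trans)
  then show ?thesis
    using assms by (intro bounded_borelI) (auto simp: bounded_borel_def)
qed

lemma bounded_borel_power [intro!]: "bounded_borel u \<Longrightarrow> bounded_borel (\<lambda>x. u x ^ n)"
  by (induction n) auto

lemma bounded_borel_sum [intro!]:
  "(\<And>i. i \<in> I \<Longrightarrow> bounded_borel (u i)) \<Longrightarrow> bounded_borel (\<lambda>x. \<Sum>i\<in>I. u i x)"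
  by (induction I rule: infinite_finite_induct) auto

lemma bounded_borel_prod [intro!]:
  "(\<And>i. i \<in> I \<Longrightarrow> bounded_borel (u i)) \<Longrightarrow> bounded_borel (\<lambda>x. \<Prod>i\<in>I. u i x)"
  by (induction I rule: infinite_finite_induct) auto

lemma bounded_borel_indicator [intro]: "S \<in> sets borel \<Longrightarrow> bounded_borel (indicator S)"
  by (intro bounded_borelI[where B = 1]) (auto simp: indicator_def)

lemma bounded_borel_shift: "bounded_borel u \<Longrightarrow> bounded_borel (\<lambda>x. u (x + a))"
  unfolding bounded_borel_def by auto

lemma bounded_borel_det [intro!]:
  fixes A :: "'a::euclidean_space \<Rightarrow> real^'n^'n"
  assumes "\<And>i j. bounded_borel (\<lambda>x. A x $ i $ j)"
  shows "bounded_borel (\<lambda>x. det (A x))"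
  unfolding det_def by (intro bounded_borel_sum bounded_borel_mult bounded_borel_prod bounded_borel_const assms)

lemma bounded_supp_borel: "bounded_supp u \<Longrightarrow> bounded_borel u"
  by (simp add: bounded_supp_def)

lemma bounded_supp_mult [intro]:
  "bounded_supp u \<Longrightarrow> bounded_borel v \<Longrightarrow> bounded_supp (\<lambda>x. u x * v x)"
  "bounded_borel v \<Longrightarrow> bounded_supp u \<Longrightarrow> bounded_supp (\<lambda>x. v x * u x)"
  unfolding bounded_supp_def by auto

lemma bounded_supp_shift:
  assumes "bounded_supp u"
  shows "bounded_supp (\<lambda>x. u (x + a))"
proof -
  obtain r where r: "\<And>x. r < norm x \<Longrightarrow> u x = 0"
    using assms by (auto simp: bounded_supp_def)
  have "u (x + a) = 0" if "r + norm a < norm x" for x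
    using r[of "x + a"] that norm_triangle_ineq4[of "x + a" a] by simp
  then show ?thesis
    using assms bounded_borel_shift unfolding bounded_supp_def by blast
qed

lemma bounded_supp_reflect:
  assumes "bounded_supp u"
  shows "bounded_supp (\<lambda>y. u (x - y))"
proof -
  obtain r where r: "\<And>x. r < norm x \<Longrightarrow> u x = 0"
    using assms by (auto simp: bounded_supp_def)
  have "u (x - y) = 0" if "r + norm x < norm y" for y
    using r[of "x - y"] that norm_triangle_ineq4[of x "x - y"] by simp
  then have "\<exists>r. \<forall>y. r < norm y \<longrightarrow> u (x - y) = 0" by blast
  moreover have "(\<lambda>y. u (x - y)) \<in> borel_measurable borel"
    using assms by (auto simp: bounded_supp_def bounded_borel_def)
  ultimately show ?thesis
    using assms unfolding bounded_supp_def bounded_borel_def by blast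
qed

lemma bounded_supp_add [intro!]:
  assumes "bounded_supp u" "bounded_supp v"
  shows "bounded_supp (\<lambda>x. u x + v x)"
proof -
  obtain r s where "\<And>x. r < norm x \<Longrightarrow> u x = 0" "\<And>x. s < norm x \<Longrightarrow> v x = 0"
    using assms by (auto simp: bounded_supp_def)
  then have "\<forall>x. max r s < norm x \<longrightarrow> u x + v x = 0" by auto
  then show ?thesis
    using assms unfolding bounded_supp_def by blast
qed

lemma bounded_supp_0 [intro!, simp]: "bounded_supp (\<lambda>x. 0)"
  by (auto simp: bounded_supp_def)

lemma bounded_supp_uminus [intro!]: "bounded_supp u \<Longrightarrow> bounded_supp (\<lambda>x. - u x)"
  unfolding bounded_supp_def by auto

lemma bounded_supp_diff [intro!]:
  "bounded_supp u \<Longrightarrow> bounded_supp v \<Longrightarrow> bounded_supp (\<lambda>x. u x - v x)"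
  using bounded_supp_add[of u "\<lambda>x. - v x"] by auto

lemma bounded_supp_sum [intro!]:
  "(\<And>i. i \<in> I \<Longrightarrow> bounded_supp (u i)) \<Longrightarrow> bounded_supp (\<lambda>x. \<Sum>i\<in>I. u i x)"
  by (induction I rule: infinite_finite_induct) auto

lemma bounded_supp_indicator [intro]:
  assumes "S \<in> sets borel" "bounded S"
  shows "bounded_supp (indicator S)"
proof -
  obtain r where "\<And>x. x \<in> S \<Longrightarrow> norm x \<le> r"
    using assms(2) by (auto simp: bounded_iff)
  then have "\<forall>x. r < norm x \<longrightarrow> indicator S x = (0::real)"
    by (auto simp: indicator_def) (meson not_le)
  then show ?thesis
    using assms by (auto simp: bounded_supp_def)
qed

lemma bounded_supp_integrable [intro]:
  fixes u :: "'a::euclidean_space \<Rightarrow> real"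
  assumes "bounded_supp u"
  shows "integrable lborel u"
proof -
  obtain B r where B: "\<And>x. \<bar>u x\<bar> \<le> B" and r: "\<And>x. r < norm x \<Longrightarrow> u x = 0"
    using assms by (auto simp: bounded_supp_def bounded_borel_def)
  have "integrable lborel (\<lambda>x. indicator (cball 0 r) x *\<^sub>R B)"
    by (intro integrable_scaleR_left integrable_real_indicator)
       (use emeasure_lborel_cball_finite[of 0 r] in auto)
  then show ?thesis
  proof (rule Bochner_Integration.integrable_bound)
    show "u \<in> borel_measurable lborel"
      using assms by (auto simp: bounded_supp_def bounded_borel_def)
    have "norm (u x) \<le> norm (indicator (cball 0 r) x *\<^sub>R B)" for x
      using B[of x] r[of x] by (cases "norm x \<le> r") auto
    then show "AE x in lborel. norm (u x) \<le> norm (indicator (cball 0 r) x *\<^sub>R B)" by simp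
  qed
qed

text \<open>Bound and convergence are demanded only where \<open>\<phi>\<close> is nonzero, so the
  weight localises facts that hold on its support alone.\<close>

lemma dominated_convergence_supp:
  fixes \<phi> :: "'a::euclidean_space \<Rightarrow> real"
  assumes \<phi>: "bounded_supp \<phi>" and w: "\<And>i. bounded_borel (w i)" and v: "bounded_borel v"
    and B: "\<And>i x. \<phi> x \<noteq> 0 \<Longrightarrow> \<bar>w i x\<bar> \<le> B"
    and lim: "AE x in lborel. \<phi> x \<noteq> 0 \<longrightarrow> (\<lambda>i. w i x) \<longlonglongrightarrow> v x"
  shows "(\<lambda>i. LBINT x. \<phi> x * w i x) \<longlonglongrightarrow> (LBINT x. \<phi> x * v x)"
proof (rule integral_dominated_convergence[where w = "\<lambda>x. \<bar>\<phi> x\<bar> * B"])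
  show "integrable lborel (\<lambda>x. \<bar>\<phi> x\<bar> * B)"
    using \<phi> by (auto simp: bounded_supp_integrable)
  show "(\<lambda>x. \<phi> x * v x) \<in> borel_measurable lborel"
    using \<phi> v by (auto simp: bounded_supp_def bounded_borel_def)
  show "(\<lambda>x. \<phi> x * w i x) \<in> borel_measurable lborel" for i
    using \<phi> w[of i] by (auto simp: bounded_supp_def bounded_borel_def)
  show "AE x in lborel. (\<lambda>i. \<phi> x * w i x) \<longlonglongrightarrow> \<phi> x * v x"
    using lim
  proof eventually_elim
    case (elim x)
    then show ?case by (cases "\<phi> x = 0") (auto intro: tendsto_mult)
  qed
  have "norm (\<phi> x * w i x) \<le> \<bar>\<phi> x\<bar> * B" for i x
    using B[of x i] by (cases "\<phi> x = 0") (auto simp: abs_mult intro: mult_left_mono)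
  then show "AE x in lborel. norm (\<phi> x * w i x) \<le> \<bar>\<phi> x\<bar> * B" for i by simp
qed

lemma cauchy_schwarz_supp:
  fixes u v :: "'a::euclidean_space \<Rightarrow> real"
  assumes "bounded_supp u" "bounded_supp v"
  shows "\<bar>\<integral>x. u x * v x \<partial>lborel\<bar> \<le> sqrt (LBINT x. (u x)\<^sup>2) * sqrt (LBINT x. (v x)\<^sup>2)"
proof -
  let ?I = "\<lambda>g. \<integral>x. g x \<partial>(lborel :: 'a measure)"
  have b: "bounded_borel u" "bounded_borel v"
    using assms by (auto simp: bounded_supp_def)
  have i: "integrable lborel (\<lambda>x. \<bar>u x\<bar> * \<bar>v x\<bar>)" "integrable lborel (\<lambda>x. \<bar>u x\<bar> ^ 2)"
    "integrable lborel (\<lambda>x. \<bar>v x\<bar> ^ 2)"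
    using bounded_supp_integrable[OF bounded_supp_mult(1)[OF assms(1) b(1)]]
      bounded_supp_integrable[OF bounded_supp_mult(1)[OF assms(2) b(2)]]
      integrable_abs[OF bounded_supp_integrable[OF bounded_supp_mult(1)[OF assms(1) b(2)]]]
    by (simp_all add: power2_eq_square abs_mult)
  have m: "u \<in> borel_measurable lborel" "v \<in> borel_measurable lborel"
    using b by (auto simp: bounded_borel_def)
  have "(\<integral>\<^sup>+x. ennreal \<bar>u x\<bar> * ennreal \<bar>v x\<bar> \<partial>lborel)\<^sup>2 \<le>
      (\<integral>\<^sup>+x. ennreal \<bar>u x\<bar> ^ 2 \<partial>lborel) * (\<integral>\<^sup>+x. ennreal \<bar>v x\<bar> ^ 2 \<partial>lborel)"
    using m by (intro Cauchy_Schwarz_nn_integral) auto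
  then have "(ennreal (?I (\<lambda>x. \<bar>u x\<bar> * \<bar>v x\<bar>)))\<^sup>2 \<le>
      ennreal (?I (\<lambda>x. \<bar>u x\<bar> ^ 2)) * ennreal (?I (\<lambda>x. \<bar>v x\<bar> ^ 2))"
    using i by (simp add: ennreal_mult'[symmetric] ennreal_power nn_integral_eq_integral del: power2_abs)
  then have "(?I (\<lambda>x. \<bar>u x\<bar> * \<bar>v x\<bar>))\<^sup>2 \<le> ?I (\<lambda>x. \<bar>u x\<bar> ^ 2) * ?I (\<lambda>x. \<bar>v x\<bar> ^ 2)"
    by (simp add: ennreal_power ennreal_mult'[symmetric] ennreal_le_iff)
  then have "\<bar>?I (\<lambda>x. \<bar>u x\<bar> * \<bar>v x\<bar>)\<bar> \<le> sqrt (?I (\<lambda>x. \<bar>u x\<bar> ^ 2) * ?I (\<lambda>x. \<bar>v x\<bar> ^ 2))"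
    by (metis real_le_rsqrt power2_abs)
  moreover have "\<bar>?I (\<lambda>x. u x * v x)\<bar> \<le> ?I (\<lambda>x. \<bar>u x\<bar> * \<bar>v x\<bar>)"
    using integral_abs_bound[of lborel "\<lambda>x. u x * v x"] by (simp add: abs_mult)
  ultimately show ?thesis
    by (simp add: real_sqrt_mult)
qed

section \<open>Partial derivatives of products and determinants\<close>

lemma has_partial_const [intro, simp]: "has_partial (\<lambda>x. c) j 0 x"
  by (auto simp: has_partial_def)

lemma has_partial_add [intro]:
  "has_partial u j a x \<Longrightarrow> has_partial v j b x \<Longrightarrow> has_partial (\<lambda>x. u x + v x) j (a + b) x"
  unfolding has_partial_def by (rule DERIV_add)

lemma has_partial_mult [intro]:
  assumes "has_partial u j a x" "has_partial v j b x"
  shows "has_partial (\<lambda>x. u x * v x) j (a * v x + u x * b) x"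
  using DERIV_mult[OF assms[unfolded has_partial_def]]
  by (simp add: has_partial_def algebra_simps)

lemma has_partial_cmult [intro]:
  assumes "has_partial u j a x"
  shows "has_partial (\<lambda>x. c * u x) j (c * a) x"
  using has_partial_mult[OF has_partial_const assms, of c] by simp

lemma has_partial_sum [intro]:
  "(\<And>i. i \<in> I \<Longrightarrow> has_partial (u i) j (a i) x) \<Longrightarrow>
    has_partial (\<lambda>x. \<Sum>i\<in>I. u i x) j (\<Sum>i\<in>I. a i) x"
  by (induction I rule: infinite_finite_induct) auto

lemma has_partial_prod:
  fixes u :: "'i \<Rightarrow> real^'n \<Rightarrow> real"
  assumes "\<And>i. i \<in> I \<Longrightarrow> has_partial (u i) j (a i) x"
  shows "has_partial (\<lambda>x. \<Prod>i\<in>I. u i x) j (\<Sum>i\<in>I. a i * (\<Prod>i'\<in>I - {i}. u i' x)) x"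
  using has_field_derivative_prod[of I "\<lambda>i t. u i (x + t *\<^sub>R axis j 1)" a 0] assms
  by (simp add: has_partial_def)

text \<open>The Leibniz sum with the factor of row \<open>i\<close> split off, which is the form in
  which the product rule delivers the derivative of a determinant.\<close>

lemma det_row_replace:
  fixes A :: "real^'n^'n"
  shows "det (\<chi> i'. if i' = i then r else A $ i') =
    (\<Sum>p | p permutes UNIV. of_int (sign p) * (r $ p i * (\<Prod>i'\<in>UNIV - {i}. A $ i' $ p i')))"
  unfolding det_def
proof (intro sum.cong refl, goal_cases)
  case (1 p)
  have "(\<Prod>i'\<in>UNIV. (\<chi> i'. if i' = i then r else A $ i') $ i' $ p i') =
      r $ p i * (\<Prod>i'\<in>UNIV - {i}. A $ i' $ p i')"
    by (subst prod.remove[of _ i]) (auto intro!: prod.cong)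
  then show ?case by simp
qed

lemma has_partial_det:
  fixes A :: "real^'n \<Rightarrow> real^'m^'m"
  assumes "\<And>i k. has_partial (\<lambda>x. A x $ i $ k) j (D $ i $ k) x"
  shows "has_partial (\<lambda>x. det (A x)) j (\<Sum>i\<in>UNIV. det (\<chi> i'. if i' = i then D $ i else A x $ i')) x"
proof -
  let ?P = "{p. p permutes (UNIV :: 'm set)}"
  have "has_partial (\<lambda>x. det (A x)) j
     (\<Sum>p\<in>?P. of_int (sign p) * (\<Sum>i\<in>UNIV. D $ i $ p i * (\<Prod>i'\<in>UNIV - {i}. A x $ i' $ p i'))) x"
    unfolding det_def using assms by (intro has_partial_sum has_partial_cmult has_partial_prod) auto
  also have "(\<Sum>p\<in>?P. of_int (sign p) * (\<Sum>i\<in>UNIV. D $ i $ p i * (\<Prod>i'\<in>UNIV - {i}. A x $ i' $ p i'))) =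
     (\<Sum>i\<in>UNIV. det (\<chi> i'. if i' = i then D $ i else A x $ i'))"
    unfolding det_row_replace sum_distrib_left by (rule sum.swap)
  finally show ?thesis .
qed

lemma has_partial_shift:
  "has_partial w j d (x + s *\<^sub>R axis j 1) \<longleftrightarrow>
    ((\<lambda>t. w (x + t *\<^sub>R axis j 1)) has_real_derivative d) (at s)"
  unfolding has_partial_def
  using DERIV_shift[of "\<lambda>t. w (x + t *\<^sub>R axis j 1)" d 0 s]
  by (simp add: scaleR_add_left add_ac)

section \<open>Differentiation under the integral and integration by parts\<close>

lemma integral_translate:
  fixes u :: "'a::euclidean_space \<Rightarrow> real"
  assumes "u \<in> borel_measurable borel"
  shows "(LBINT x. u (x + a)) = (LBINT x. u x)"
proof -
  have "(LBINT x. u x) = (\<integral>x. u x \<partial>distr lborel borel ((+) a))"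
    by (simp add: lborel_distr_plus)
  also have "\<dots> = (LBINT x. u (a + x))"
    using assms by (intro integral_distr) auto
  finally show ?thesis by (simp add: add.commute)
qed

lemma DERIV_integral:
  fixes k k' :: "real \<Rightarrow> 'a::euclidean_space \<Rightarrow> real"
  assumes k: "\<And>t. integrable lborel (k t)" and k': "k' 0 \<in> borel_measurable borel"
    and D: "\<And>t y. ((\<lambda>t. k t y) has_real_derivative k' t y) (at t)"
    and B: "\<And>t y. \<bar>t\<bar> \<le> 1 \<Longrightarrow> \<bar>k' t y\<bar> \<le> g y" and g: "integrable lborel g"
  shows "((\<lambda>t. LBINT y. k t y) has_real_derivative (LBINT y. k' 0 y)) (at 0)"
proof -
  let ?q = "\<lambda>t y. (k t y - k 0 y) / t"
  have "((\<lambda>t. LBINT y. ?q t y) \<longlongrightarrow> (LBINT y. k' 0 y)) (at 0)"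
  proof (rule tendsto_at_iff_sequentially[THEN iffD2], intro allI impI)
    fix X :: "nat \<Rightarrow> real"
    assume X: "\<forall>i. X i \<in> UNIV - {0}" "X \<longlonglongrightarrow> 0"
    \<comment> \<open>The dominating function is available only for
      \<open>\<bar>t\<bar> \<le> 1\<close>, while dominated convergence asks for a bound at every
      index. The finitely many terms outside that range are replaced by 1.\<close>
    define Y where "Y i = (if \<bar>X i\<bar> \<le> 1 then X i else 1)" for i
    have ev: "eventually (\<lambda>i. \<bar>X i\<bar> \<le> 1) sequentially"
      using tendsto_rabs_zero[OF X(2)] by (auto elim: eventually_mono dest!: order_tendstoD(2)[of _ _ _ 1])
    have Y0: "Y i \<noteq> 0" "\<bar>Y i\<bar> \<le> 1" for i
      using X(1) by (auto simp: Y_def)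
    have XY: "eventually (\<lambda>i. Y i = X i) sequentially"
      using ev by eventually_elim (auto simp: Y_def)
    have Y: "Y \<longlonglongrightarrow> 0"
      using X(2) by (rule Lim_transform_eventually) (use XY in \<open>auto elim: eventually_mono\<close>)
    have "(\<lambda>i. LBINT y. ?q (Y i) y) \<longlonglongrightarrow> (LBINT y. k' 0 y)"
    proof (rule integral_dominated_convergence[where w = g])
      show "k' 0 \<in> borel_measurable lborel" using k' by simp
      show "?q (Y i) \<in> borel_measurable lborel" for i
        using k by (intro borel_measurable_divide borel_measurable_diff) auto
      have "(\<lambda>i. ?q (Y i) y) \<longlonglongrightarrow> k' 0 y" for y
      proof -
        have "((\<lambda>t. ?q t y) \<longlongrightarrow> k' 0 y) (at 0)"
          using D[of y 0] by (simp add: has_field_derivative_iff)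
        moreover have "filterlim Y (at 0) sequentially"
          using Y Y0(1) by (auto simp: filterlim_at)
        ultimately show ?thesis by (rule filterlim_compose)
      qed
      then show "AE y in lborel. (\<lambda>i. ?q (Y i) y) \<longlonglongrightarrow> k' 0 y" by simp
      have "norm (?q t y) \<le> g y" if t: "t \<noteq> 0" "\<bar>t\<bar> \<le> 1" for t y
      proof -
        have "\<bar>k t y - k 0 y\<bar> \<le> g y * \<bar>t - 0\<bar>"
          using field_differentiable_bound[of "{-1..1}" "\<lambda>t. k t y" "\<lambda>t. k' t y" "g y" t 0] D B t
          by (auto simp: has_field_derivative_at_within abs_le_iff)
        then show ?thesis
          using t by (simp add: abs_divide divide_le_eq)
      qed
      then show "AE y in lborel. norm (?q (Y i) y) \<le> g y" for i
        using Y0 by simp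
    qed (use g in auto)
    then show "((\<lambda>t. LBINT y. ?q t y) \<circ> X) \<longlonglongrightarrow> (LBINT y. k' 0 y)"
      unfolding o_def by (rule Lim_transform_eventually) (use XY in \<open>auto elim: eventually_mono\<close>)
  qed
  moreover have "(LBINT y. k t y - k 0 y) = (LBINT y. k t y) - (LBINT y. k 0 y)" for t
    using k by simp
  ultimately show ?thesis
    by (simp add: has_field_derivative_iff)
qed

text \<open>By translation invariance \<open>t \<mapsto> \<integral> w (x + t e\<^sub>j) dx\<close> is constant; differentiate at \<open>t = 0\<close>.\<close>
lemma integral_partial_eq_0:
  fixes w :: "real^'n \<Rightarrow> real"
  assumes w: "bounded_supp w" and w': "bounded_supp w'" and D: "\<And>x. has_partial w j (w' x) x"
  shows "(LBINT x. w' x) = 0"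
proof -
  obtain B r where B: "\<And>x. \<bar>w' x\<bar> \<le> B" and r: "\<And>x. r < norm x \<Longrightarrow> w' x = 0"
    using w' by (auto simp: bounded_supp_def bounded_borel_def)
  let ?a = "axis j 1 :: real^'n"
  have mw: "w \<in> borel_measurable borel" "w' \<in> borel_measurable borel"
    using w w' by (auto simp: bounded_supp_def bounded_borel_def)
  have iw: "integrable lborel (\<lambda>x. w (x + a))" for a
    by (rule bounded_supp_integrable[OF bounded_supp_shift[OF w]])
  have "((\<lambda>t. LBINT x. w (x + t *\<^sub>R ?a)) has_real_derivative (LBINT x. w' (x + 0 *\<^sub>R ?a))) (at 0)"
  \<comment> \<open>The radius grows by 1 because a shift with \<open>\<bar>t\<bar> \<le> 1\<close>
    moves points by at most 1.\<close>
  proof (rule DERIV_integral[where g = "\<lambda>x. indicator (cball 0 (r + 1)) x * B"])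
    show "integrable lborel (\<lambda>x. w (x + t *\<^sub>R ?a))" for t by (rule iw)
    show "(\<lambda>x. w' (x + 0 *\<^sub>R ?a)) \<in> borel_measurable borel" using mw by simp
    show "((\<lambda>t. w (x + t *\<^sub>R ?a)) has_real_derivative w' (x + t *\<^sub>R ?a)) (at t)" for t x
      using D by (simp flip: has_partial_shift)
    show "integrable lborel (\<lambda>x. indicator (cball 0 (r + 1)) x * B)"
      by (intro bounded_supp_integrable bounded_supp_mult bounded_supp_indicator) auto
    show "\<bar>w' (x + t *\<^sub>R ?a)\<bar> \<le> indicator (cball 0 (r + 1)) x * B" if "\<bar>t\<bar> \<le> 1" for t x
    proof (cases "norm x \<le> r + 1")
      case False
      have "norm x \<le> norm (x + t *\<^sub>R ?a) + norm (t *\<^sub>R ?a)"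
        by (metis add_diff_cancel_right' norm_triangle_ineq4)
      then have "r < norm (x + t *\<^sub>R ?a)"
        using False that by simp
      then show ?thesis using r False by simp
    qed (use B in auto)
  qed
  moreover have "(\<lambda>t. LBINT x. w (x + t *\<^sub>R ?a)) = (\<lambda>t. LBINT x. w x)"
    using mw by (simp add: integral_translate)
  ultimately show ?thesis
    using DERIV_unique[OF _ DERIV_const] by fastforce
qed

lemma integral_by_parts:
  fixes \<phi> w :: "real^'n \<Rightarrow> real"
  assumes "bounded_supp \<phi>" "bounded_supp \<phi>'" "\<And>x. has_partial \<phi> j (\<phi>' x) x"
    and "bounded_borel w" "bounded_borel w'" "\<And>x. has_partial w j (w' x) x"
  shows "(LBINT x. \<phi> x * w' x) = - (LBINT x. \<phi>' x * w x)"
proof -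
  have "(LBINT x. \<phi>' x * w x + \<phi> x * w' x) = 0"
    using assms by (intro integral_partial_eq_0[where w = "\<lambda>x. \<phi> x * w x" and j = j]) auto
  moreover have "(LBINT x. \<phi>' x * w x + \<phi> x * w' x) =
      (LBINT x. \<phi>' x * w x) + (LBINT x. \<phi> x * w' x)"
    using assms by (intro Bochner_Integration.integral_add) auto
  ultimately show ?thesis by simp
qed

section \<open>A smooth mollifier\<close>

text \<open>The polynomial in \<open>1 / t\<close> makes the class closed under differentiation, so
  derivatives of all orders are handled at once.\<close>

definition flat_exp :: "real poly \<Rightarrow> real \<Rightarrow> real" where
  "flat_exp p t = (if t > 0 then poly p (1 / t) * exp (- (1 / t)) else 0)"

lemma tendsto_poly_mult_exp_minus: "((\<lambda>x::real. poly p x * exp (- x)) \<longlongrightarrow> 0) at_top"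
proof -
  have "((\<lambda>x. \<Sum>i\<le>degree p. coeff p i * (x ^ i / exp x)) \<longlongrightarrow> (\<Sum>i\<le>degree p. coeff p i * 0)) at_top"
    by (intro tendsto_intros tendsto_power_div_exp_0)
  then show ?thesis
    by (simp add: poly_altdef exp_minus sum_divide_distrib divide_inverse[symmetric])
qed

lemma flat_exp_tendsto_0: "((\<lambda>t. poly p (1 / t) * exp (- (1 / t))) \<longlongrightarrow> 0) (at_right (0::real))"
  using filterlim_compose[OF tendsto_poly_mult_exp_minus filterlim_inverse_at_top_right, of p]
  by (simp add: inverse_eq_divide)

lemma flat_exp_uminus: "- flat_exp p t = flat_exp (- p) t"
  by (simp add: flat_exp_def)

lemma DERIV_flat_exp: "\<exists>q. \<forall>t. (flat_exp p has_real_derivative flat_exp q t) (at t)"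
proof (intro exI allI)
  fix t :: real
  \<comment> \<open>With \<open>s = 1 / t\<close>, the derivative of \<open>p(s) exp(-s)\<close> in
    \<open>t\<close> is \<open>s^2 (p(s) - p'(s)) exp(-s)\<close>.\<close>
  let ?q = "[:0, 0, 1:] * (p - Polynomial.pderiv p)"
  consider "t > 0" | "t < 0" | "t = 0" by linarith
  then show "(flat_exp p has_real_derivative flat_exp ?q t) (at t)"
  proof cases
    case 1
    have "((\<lambda>t. poly p (1 / t) * exp (- (1 / t))) has_real_derivative flat_exp ?q t) (at t)"
      using 1 by (auto intro!: derivative_eq_intros DERIV_chain2[OF poly_DERIV] simp: flat_exp_def field_simps power2_eq_square)
    then show ?thesis
      by (rule has_field_derivative_transform_within_open[of _ _ _ "{0<..}"]) (use 1 in \<open>auto simp: flat_exp_def\<close>)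
  next
    case 2
    have "((\<lambda>t. 0) has_real_derivative flat_exp ?q t) (at t)"
      using 2 by (simp add: flat_exp_def)
    then show ?thesis
      by (rule has_field_derivative_transform_within_open[of _ _ _ "{..<0}"]) (use 2 in \<open>auto simp: flat_exp_def\<close>)
  next
    case 3
    \<comment> \<open>From the right the difference quotient at 0 is again of the flat form, with
      \<open>p\<close> multiplied by the variable; from the left it vanishes.\<close>
    have "((\<lambda>h. flat_exp p h / h) \<longlongrightarrow> 0) (at_right 0)"
      by (rule Lim_transform_eventually[OF flat_exp_tendsto_0[of "[:0, 1:] * p"]])
         (auto simp: flat_exp_def eventually_at_right_less eventually_at_filter)
    moreover have "((\<lambda>h. flat_exp p h / h) \<longlongrightarrow> 0) (at_left 0)"
      by (rule Lim_transform_eventually[OF tendsto_const])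
         (auto simp: flat_exp_def eventually_at_filter)
    ultimately have "((\<lambda>h. flat_exp p h / h) \<longlongrightarrow> 0) (at 0)"
      by (simp add: filterlim_at_split)
    then show ?thesis
      using 3 by (simp add: has_field_derivative_iff flat_exp_def)
  qed
qed

inductive bump :: "(real \<Rightarrow> real) \<Rightarrow> bool" where
  bump_flat_exp: "bump (\<lambda>t. flat_exp p (1 + t) * flat_exp q (1 - t))"
| bump_add: "bump f \<Longrightarrow> bump g \<Longrightarrow> bump (\<lambda>t. f t + g t)"

lemma bump_DERIV: "bump f \<Longrightarrow> \<exists>g. bump g \<and> (\<forall>t. (f has_real_derivative g t) (at t))"
proof (induction rule: bump.induct)
  case (bump_flat_exp p q)
  obtain p' where p': "\<And>t. (flat_exp p has_real_derivative flat_exp p' t) (at t)"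
    using DERIV_flat_exp by blast
  obtain q' where q': "\<And>t. (flat_exp q has_real_derivative flat_exp q' t) (at t)"
    using DERIV_flat_exp by blast
  have "bump (\<lambda>t. flat_exp p' (1 + t) * flat_exp q (1 - t) + flat_exp p (1 + t) * flat_exp (- q') (1 - t))"
    by (intro bump.intros)
  moreover have "((\<lambda>t. flat_exp p (1 + t) * flat_exp q (1 - t)) has_real_derivative
      flat_exp p' (1 + t) * flat_exp q (1 - t) + flat_exp p (1 + t) * flat_exp (- q') (1 - t)) (at t)" for t
    by (auto intro!: derivative_eq_intros DERIV_chain2[OF p'] DERIV_chain2[OF q']
        simp: flat_exp_uminus[symmetric])
  ultimately show ?case by blast
next
  case (bump_add f g)
  then obtain f' g' where "bump f'" "\<And>t. (f has_real_derivative f' t) (at t)"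
    "bump g'" "\<And>t. (g has_real_derivative g' t) (at t)" by blast
  then show ?case
    by (intro exI[of _ "\<lambda>t. f' t + g' t"]) (auto intro: bump.bump_add DERIV_add)
qed

lemma bump_eq_0: "bump f \<Longrightarrow> 1 \<le> \<bar>t\<bar> \<Longrightarrow> f t = 0"
  by (induction rule: bump.induct) (auto simp: flat_exp_def)

lemma bump_deriv:
  assumes "bump f"
  shows "bump (deriv f)" "(f has_real_derivative deriv f t) (at t)"
proof -
  obtain g where g: "bump g" "\<And>t. (f has_real_derivative g t) (at t)"
    using bump_DERIV[OF assms] by blast
  then have "deriv f = g"
    by (auto simp: DERIV_imp_deriv)
  then show "bump (deriv f)" "(f has_real_derivative deriv f t) (at t)"
    using g by auto
qed

lemma bump_continuous: "bump f \<Longrightarrow> continuous_on S f"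
  by (meson DERIV_isCont bump_deriv(2) continuous_at_imp_continuous_on)

lemma bump_bounded:
  assumes "bump f"
  shows "\<exists>B. \<forall>t. \<bar>f t\<bar> \<le> B"
proof -
  have "compact (f ` {-1..1})"
    using bump_continuous[OF assms] by (intro compact_continuous_image) auto
  then obtain B where B: "\<And>t. t \<in> {-1..1} \<Longrightarrow> \<bar>f t\<bar> \<le> B"
    by (force dest!: compact_imp_bounded simp: bounded_iff)
  have "\<bar>f t\<bar> \<le> B" for t
    using B[of t] B[of 0] bump_eq_0[OF assms, of t] by (cases "\<bar>t\<bar> \<le> 1") (auto simp: abs_le_iff)
  then show ?thesis by blast
qed

text \<open>With the polynomial 1 the underlying function is the classical
  \<open>exp(-2 / (1 - t^2))\<close> on (-1, 1), since
  \<open>1/(1+t) + 1/(1-t) = 2/(1-t^2)\<close>.\<close>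

definition bump_fun :: "nat \<Rightarrow> real \<Rightarrow> real" where
  "bump_fun n = (deriv ^^ n) (\<lambda>t. flat_exp 1 (1 + t) * flat_exp 1 (1 - t))"

lemma bump_bump_fun: "bump (bump_fun n)"
  by (induction n) (auto simp: bump_fun_def intro: bump.intros bump_deriv)

lemma DERIV_bump_fun: "(bump_fun n has_real_derivative bump_fun (Suc n) t) (at t)"
  using bump_deriv(2)[OF bump_bump_fun[of n]] by (simp add: bump_fun_def)

lemma bump_fun_nonneg: "0 \<le> bump_fun 0 t"
  by (auto simp: bump_fun_def flat_exp_def)

lemma bump_fun_pos: "0 < bump_fun 0 0"
  by (auto simp: bump_fun_def flat_exp_def)

text \<open>A multi-index is a function \<open>'n \<Rightarrow> nat\<close>; \<open>mollifier e a\<close> is the partial derivative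
  of multi-index \<open>a\<close> of a mollifier supported in the cube of half-width \<open>e\<close>.\<close>

definition raise :: "('n \<Rightarrow> nat) \<Rightarrow> 'n \<Rightarrow> 'n \<Rightarrow> nat" where
  "raise a j = a(j := Suc (a j))"

lemma raise_commute: "raise (raise a j) k = raise (raise a k) j"
  by (auto simp: raise_def fun_eq_iff)

text \<open>A product of one-variable bumps, so that every partial derivative is again such a
  product. The powers of \<open>e\<close> come from the chain rule in
  \<open>x $ i / e\<close>.\<close>

definition mollifier0 :: "real \<Rightarrow> ('n \<Rightarrow> nat) \<Rightarrow> real^'n \<Rightarrow> real" where
  "mollifier0 e a x = (\<Prod>i\<in>UNIV. bump_fun (a i) (x $ i / e) / e ^ a i)"

definition mollifier :: "real \<Rightarrow> ('n \<Rightarrow> nat) \<Rightarrow> real^'n \<Rightarrow> real" where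
  "mollifier e a x = mollifier0 e a x / (LBINT x. mollifier0 e (\<lambda>_::'n. 0) x)"

text \<open>The closed sup-norm ball, the natural support of a product kernel. Comparing it with
  Euclidean balls costs the factor \<open>CARD('n)\<close> seen in many radii below.\<close>

definition cube :: "real^'n \<Rightarrow> real \<Rightarrow> (real^'n) set" where
  "cube x e = {y. \<forall>i. \<bar>x $ i - y $ i\<bar> \<le> e}"

lemma cube_eq_cbox: "cube x e = cbox (x - (\<chi> i. e)) (x + (\<chi> i. e))"
proof -
  have "\<bar>x $ i - y $ i\<bar> \<le> e \<longleftrightarrow> x $ i - e \<le> y $ i \<and> y $ i \<le> x $ i + e" for y i
    by (auto simp: abs_le_iff)
  then show ?thesis
    unfolding cube_def mem_box_cart(2)[symmetric] by (auto simp: mem_box_cart)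
qed

lemma compact_cube: "compact (cube x e)"
  by (simp add: cube_eq_cbox compact_cbox)

lemma cube_borel [measurable]: "cube x e \<in> sets borel"
  by (simp add: cube_eq_cbox)

lemma cube_subset_cball: "cube (x::real^'n) e \<subseteq> cball x (real CARD('n) * e)"
proof
  fix y assume y: "y \<in> cube x e"
  have "norm (x - y) \<le> (\<Sum>i\<in>UNIV. \<bar>(x - y) $ i\<bar>)" by (rule norm_le_l1_cart)
  also have "\<dots> \<le> (\<Sum>i\<in>(UNIV::'n set). e)"
    using y by (intro sum_mono) (auto simp: cube_def)
  finally show "y \<in> cball x (real CARD('n) * e)" by (simp add: dist_norm)
qed

lemma mollifier0_eq_0:
  assumes "e > 0" "y \<notin> cube x e"
  shows "mollifier0 e a (x - y) = 0"
proof -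
  obtain i where i: "e < \<bar>x $ i - y $ i\<bar>"
    using assms by (auto simp: cube_def not_le)
  then have "1 \<le> \<bar>(x - y) $ i / e\<bar>"
    using assms(1) by (simp add: abs_divide)
  then have "bump_fun (a i) ((x - y) $ i / e) = 0"
    by (rule bump_eq_0[OF bump_bump_fun])
  then show ?thesis
    unfolding mollifier0_def by (intro prod_zero) auto
qed

lemma mollifier_eq_0: "e > 0 \<Longrightarrow> y \<notin> cube x e \<Longrightarrow> mollifier e a (x - y) = 0"
  by (simp add: mollifier_def mollifier0_eq_0)

lemma continuous_on_mollifier0:
  fixes a :: "'n::finite \<Rightarrow> nat"
  assumes "e > 0"
  shows "continuous_on S (mollifier0 e a)"
proof -
  have "continuous_on S (\<lambda>x::real^'n. bump_fun (a i) (x $ i / e))" for i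
    by (rule continuous_on_compose2[OF bump_continuous[OF bump_bump_fun, of UNIV]])
       (use assms in \<open>auto intro!: continuous_intros\<close>)
  then show ?thesis
    unfolding mollifier0_def[abs_def] using assms by (intro continuous_intros) auto
qed

lemma continuous_on_mollifier: "e > 0 \<Longrightarrow> continuous_on S (mollifier e a)"
  unfolding mollifier_def[abs_def] divide_inverse by (intro continuous_intros continuous_on_mollifier0)

lemma bounded_supp_mollifier0:
  fixes a :: "'n::finite \<Rightarrow> nat"
  assumes "e > 0"
  shows "bounded_supp (mollifier0 e a)"
proof -
  have "bounded_borel (\<lambda>x::real^'n. bump_fun (a i) (x $ i * inverse e))" for i
  proof -
    obtain B where "\<And>t. \<bar>bump_fun (a i) t\<bar> \<le> B"
      using bump_bounded[OF bump_bump_fun] by blast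
    moreover have "continuous_on UNIV (\<lambda>x::real^'n. bump_fun (a i) (x $ i * inverse e))"
      by (rule continuous_on_compose2[OF bump_continuous[OF bump_bump_fun, of UNIV]])
         (use assms in \<open>auto intro!: continuous_intros\<close>)
    ultimately show ?thesis
      by (intro bounded_borelI) (auto intro: borel_measurable_continuous_onI)
  qed
  then have "bounded_borel (mollifier0 e a)"
    unfolding mollifier0_def[abs_def] divide_inverse
    by (intro bounded_borel_prod bounded_borel_mult bounded_borel_const)
  moreover have "mollifier0 e a x = 0" if "real CARD('n) * e < norm x" for x
  proof -
    have "- x \<notin> cube 0 e"
      using that cube_subset_cball[of 0 e] by auto
    from mollifier0_eq_0[OF assms this] show ?thesis by simp
  qed
  ultimately show ?thesis
    unfolding bounded_supp_def by blast
qed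

lemma bounded_supp_mollifier: "e > 0 \<Longrightarrow> bounded_supp (mollifier e a)"
  unfolding mollifier_def[abs_def] divide_inverse by (intro bounded_supp_mult bounded_supp_mollifier0) auto

lemma mollifier0_nonneg: "e > 0 \<Longrightarrow> 0 \<le> mollifier0 e (\<lambda>_. 0) x"
  unfolding mollifier0_def by (intro prod_nonneg) (auto intro: bump_fun_nonneg)

text \<open>If the integral of this nonnegative function vanished, the open set where it is nonzero
  would be negligible; but that set contains 0.\<close>

lemma integral_mollifier0_pos:
  assumes "e > 0"
  shows "0 < (LBINT x. mollifier0 e (\<lambda>_::'n::finite. 0) x)"
proof -
  let ?k = "mollifier0 e (\<lambda>_::'n. 0)"
  have i: "integrable lborel ?k"
    using bounded_supp_mollifier0[OF assms] by auto
  have "(LBINT x. ?k x) \<noteq> 0"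
  proof
    assume "(LBINT x. ?k x) = 0"
    then have ae: "AE x in lborel. ?k x = 0"
      using integral_nonneg_eq_0_iff_AE[OF i] mollifier0_nonneg[OF assms] by auto
    have "open {x. ?k x \<noteq> 0}"
      using continuous_on_mollifier0[OF assms, of UNIV "\<lambda>_. 0"] by (intro open_Collect_neq continuous_on_const)
    moreover have "negligible {x. ?k x \<noteq> 0}"
      using ae by (simp add: negligible_iff_null_sets AE_completion flip: completion.AE_iff_null_sets)
         (auto simp: eventually_ae_filter null_sets_completion_iff2)
    moreover have "0 \<in> {x. ?k x \<noteq> 0}"
      using bump_fun_pos by (auto simp: mollifier0_def)
    ultimately show False
      using open_not_negligible by blast
  qed
  moreover have "0 \<le> (LBINT x. ?k x)"
    using mollifier0_nonneg[OF assms] by (intro Bochner_Integration.integral_nonneg) auto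
  ultimately show ?thesis by simp
qed

lemma mollifier_nonneg: "e > 0 \<Longrightarrow> 0 \<le> mollifier e (\<lambda>_. 0) x"
  unfolding mollifier_def by (intro divide_nonneg_nonneg mollifier0_nonneg less_imp_le integral_mollifier0_pos)

lemma integral_mollifier:
  assumes "e > 0"
  shows "(LBINT x. mollifier e (\<lambda>_::'n::finite. 0) x) = 1"
  using integral_mollifier0_pos[OF assms, where 'n = 'n] by (simp add: mollifier_def)

text \<open>A general direction \<open>v\<close> serves two purposes: \<open>- axis j 1\<close>
  gives the derivative of the reflected kernel, and \<open>y - x\<close> gives Lipschitz bounds
  along segments.\<close>

lemma DERIV_mollifier:
  fixes x v :: "real^'n"
  assumes "e > 0"
  shows "((\<lambda>t. mollifier e a (x + t *\<^sub>R v)) has_real_derivative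
    (\<Sum>j\<in>UNIV. v $ j * mollifier e (raise a j) (x + t *\<^sub>R v))) (at t)"
proof -
  let ?f = "\<lambda>i t. bump_fun (a i) ((x $ i + t * v $ i) / e) / e ^ a i"
  let ?f' = "\<lambda>i t. v $ i * (bump_fun (Suc (a i)) ((x $ i + t * v $ i) / e) / e ^ Suc (a i))"
  have "(?f i has_real_derivative ?f' i t) (at t)" for i
    using assms by (auto intro!: derivative_eq_intros DERIV_chain2[OF DERIV_bump_fun])
  then have "((\<lambda>t. \<Prod>i\<in>UNIV. ?f i t) has_real_derivative
      (\<Sum>j\<in>UNIV. ?f' j t * (\<Prod>i\<in>UNIV - {j}. ?f i t))) (at t)"
    by (intro has_field_derivative_prod)
  moreover have "?f' j t * (\<Prod>i\<in>UNIV - {j}. ?f i t) = v $ j * mollifier0 e (raise a j) (x + t *\<^sub>R v)" for j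
    unfolding mollifier0_def
    by (subst prod.remove[of UNIV j "\<lambda>i. bump_fun (raise a j i) ((x + t *\<^sub>R v) $ i / e) / e ^ raise a j i"])
       (auto simp: raise_def intro!: prod.cong)
  ultimately have "((\<lambda>t. mollifier0 e a (x + t *\<^sub>R v)) has_real_derivative
      (\<Sum>j\<in>UNIV. v $ j * mollifier0 e (raise a j) (x + t *\<^sub>R v))) (at t)"
    by (simp add: mollifier0_def)
  from DERIV_cdivide[OF this] show ?thesis
    by (simp add: mollifier_def sum_divide_distrib)
qed

lemma has_partial_mollifier_reflect:
  assumes "e > 0"
  shows "has_partial (\<lambda>y. mollifier e a (x - y)) j (- mollifier e (raise a j) (x - y)) y"
proof -
  have "(\<Sum>i\<in>UNIV. (- axis j 1) $ i * mollifier e (raise a i) (x - y + 0 *\<^sub>R - axis j 1)) =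
      - mollifier e (raise a j) (x - y)"
    by (simp add: axis_def if_distrib[of "\<lambda>c. c * _"] sum_negf cong: if_cong)
  then show ?thesis
    using DERIV_mollifier[OF assms, of a "x - y" "- axis j 1" 0]
    by (simp add: has_partial_def algebra_simps)
qed

text \<open>The scalar \<open>c\<close> is there for the induction: each derivative in
  \<open>y\<close> of a function of \<open>x - y\<close> produces a sign.\<close>

lemma Ck_on_mollifier_reflect: "e > 0 \<Longrightarrow> Ck_on k (\<lambda>y. c * mollifier e a (x - y)) UNIV"
proof (induction k arbitrary: a c)
  case (Suc k)
  have "continuous_on UNIV (\<lambda>y. c * mollifier e a (x - y))"
    by (intro continuous_intros continuous_on_compose2[OF continuous_on_mollifier[OF Suc.prems, of UNIV]]) auto
  moreover have "has_partial (\<lambda>y. c * mollifier e a (x - y)) j (- c * mollifier e (raise a j) (x - y)) y" for j y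
    using has_partial_cmult[OF has_partial_mollifier_reflect[OF Suc.prems], of c a x j y] by simp
  moreover have "Ck_on k (\<lambda>y. - c * mollifier e (raise a j) (x - y)) UNIV" for j
    by (rule Suc.IH[OF Suc.prems])
  ultimately show ?case by (auto intro!: exI)
qed (auto intro!: continuous_intros continuous_on_compose2[OF continuous_on_mollifier, of _ UNIV])

text \<open>These kernels are the only test functions with which the distributional Curl equation is
  ever used.\<close>

lemma test_fun_mollifier:
  assumes "e > 0" "cube x e \<subseteq> U"
  shows "test_fun U (\<lambda>y. mollifier e a (x - y))"
proof -
  have "closure {y. mollifier e a (x - y) \<noteq> 0} \<subseteq> cube x e"
    by (rule closure_minimal) (use mollifier_eq_0[OF assms(1)] compact_imp_closed[OF compact_cube] in auto)
  moreover from this have "compact (closure {y. mollifier e a (x - y) \<noteq> 0})"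
    by (meson compact_cube bounded_subset closed_closure compact_eq_bounded_closed)
  ultimately show ?thesis
    using Ck_on_mollifier_reflect[OF assms(1), of _ 1 a x] assms(2) by (auto simp: test_fun_def)
qed

section \<open>Mollification\<close>

lemma lborel_reflect: "distr lborel borel (\<lambda>x. a - x) = (lborel :: 'a::euclidean_space measure)"
  using lborel_affine[of "-1" a] by (simp add: density_1)

lemma integral_reflect_lborel:
  fixes u :: "'a::euclidean_space \<Rightarrow> real"
  assumes "u \<in> borel_measurable borel"
  shows "(LBINT x. u (a - x)) = (LBINT x. u x)"
proof -
  have "(LBINT x. u x) = (\<integral>x. u x \<partial>distr lborel borel (\<lambda>x. a - x))"
    by (simp add: lborel_reflect)
  also have "\<dots> = (LBINT x. u (a - x))"
    using assms by (intro integral_distr) auto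
  finally show ?thesis by simp
qed

text \<open>The multi-index acts on the kernel, so \<open>mollify e a u\<close> is a derivative of
  \<open>mollify e (\<lambda>_. 0) u\<close> even when \<open>u\<close> itself has none.\<close>

definition mollify :: "real \<Rightarrow> ('n \<Rightarrow> nat) \<Rightarrow> (real^'n \<Rightarrow> real) \<Rightarrow> real^'n \<Rightarrow> real" where
  "mollify e a u x = (LBINT y. mollifier e a (x - y) * u y)"

lemma bounded_supp_mollifier_reflect [intro]: "e > 0 \<Longrightarrow> bounded_supp (\<lambda>y. mollifier e a (x - y))"
  by (rule bounded_supp_reflect[OF bounded_supp_mollifier])

lemma mollify_integrable [intro]:
  "e > 0 \<Longrightarrow> bounded_borel u \<Longrightarrow> integrable lborel (\<lambda>y. mollifier e a (x - y) * u y)"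
  by (intro bounded_supp_integrable bounded_supp_mult(1) bounded_supp_mollifier_reflect)

lemma mollify_cong_AE:
  fixes u v :: "real^'n \<Rightarrow> real"
  assumes "e > 0" "bounded_borel u" "bounded_borel v"
    and "AE y in lborel. y \<in> cube x e \<longrightarrow> u y = v y"
  shows "mollify e a u x = mollify e a v x"
  unfolding mollify_def
proof (rule integral_cong_AE)
  have [measurable]: "u \<in> borel_measurable borel" "v \<in> borel_measurable borel"
    "(\<lambda>y. mollifier e a (x - y)) \<in> borel_measurable borel"
    using assms bounded_supp_mollifier_reflect[OF assms(1), of a x]
    by (auto simp: bounded_borel_def bounded_supp_def)
  show "(\<lambda>y. mollifier e a (x - y) * u y) \<in> borel_measurable lborel"
    "(\<lambda>y. mollifier e a (x - y) * v y) \<in> borel_measurable lborel" by measurable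
  show "AE y in lborel. mollifier e a (x - y) * u y = mollifier e a (x - y) * v y"
    using assms(4)
  proof eventually_elim
    case (elim y)
    then show ?case
      using mollifier_eq_0[OF assms(1), of y x a] by (cases "y \<in> cube x e") auto
  qed
qed

text \<open>The kernel is nonnegative with integral 1, so mollification averages over the cube. This
  yields convergence at continuity points, preservation of sup bounds (with \<open>c = 0\<close>),
  and the local control of mollified gradients.\<close>

lemma mollify_near:
  fixes u :: "real^'n \<Rightarrow> real"
  assumes "e > 0" "bounded_borel u" "\<And>y. y \<in> cube x e \<Longrightarrow> \<bar>u y - c\<bar> \<le> d"
  shows "\<bar>mollify e (\<lambda>_. 0) u x - c\<bar> \<le> d"
proof -
  let ?m = "\<lambda>y. mollifier e (\<lambda>_::'n. 0) (x - y)"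
  have i: "integrable lborel ?m" "integrable lborel (\<lambda>y. ?m y * u y)"
    using assms by auto
  have 1: "(LBINT y. ?m y) = 1"
    using integral_mollifier[OF assms(1), where 'n = 'n] bounded_supp_mollifier[OF assms(1), of "\<lambda>_::'n. 0"]
    by (subst integral_reflect_lborel) (auto simp: bounded_supp_def bounded_borel_def)
  have "mollify e (\<lambda>_. 0) u x - c = (LBINT y. ?m y * u y - ?m y * c)"
    using i 1 by (subst Bochner_Integration.integral_diff) (auto simp: mollify_def)
  also have "\<bar>\<dots>\<bar> \<le> (LBINT y. \<bar>?m y * u y - ?m y * c\<bar>)"
    by (rule integral_abs_bound)
  also have "\<dots> \<le> (LBINT y. ?m y * d)"
  proof (rule integral_mono)
    show "integrable lborel (\<lambda>y. \<bar>?m y * u y - ?m y * c\<bar>)" "integrable lborel (\<lambda>y. ?m y * d)"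
      using i by auto
    show "\<bar>?m y * u y - ?m y * c\<bar> \<le> ?m y * d" for y
      using mollifier_eq_0[OF assms(1), of y x] assms(3)[of y] mollifier_nonneg[OF assms(1), of "x - y"]
      by (cases "y \<in> cube x e") (auto simp: abs_mult mult_left_mono simp flip: right_diff_distrib)
  qed
  finally show ?thesis using 1 by simp
qed

lemma mollify_tendsto:
  fixes u :: "real^'n \<Rightarrow> real"
  assumes "bounded_borel u" "isCont u x" "\<And>i. e i > 0" "e \<longlonglongrightarrow> 0"
  shows "(\<lambda>i. mollify (e i) (\<lambda>_. 0) u x) \<longlonglongrightarrow> u x"
proof (rule LIMSEQ_I)
  fix r :: real assume "r > 0"
  then obtain d where d: "d > 0" "\<And>y. dist y x < d \<Longrightarrow> \<bar>u y - u x\<bar> < r / 2"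
    using assms(2) unfolding continuous_at_eps_delta by (metis dist_real_def half_gt_zero)
  have "(\<lambda>i. real CARD('n) * e i) \<longlonglongrightarrow> real CARD('n) * 0"
    using assms(4) by (intro tendsto_intros)
  from order_tendstoD(2)[OF this, of d] have "eventually (\<lambda>i. real CARD('n) * e i < d) sequentially"
    using d(1) by simp
  then obtain N where N: "\<And>i. i \<ge> N \<Longrightarrow> real CARD('n) * e i < d"
    by (auto simp: eventually_sequentially)
  have "\<bar>mollify (e i) (\<lambda>_. 0) u x - u x\<bar> \<le> r / 2" if "i \<ge> N" for i
  proof (rule mollify_near[OF assms(3,1)])
    fix y assume "y \<in> cube x (e i)"
    then have "dist x y \<le> real CARD('n) * e i"
      using cube_subset_cball by fastforce
    then show "\<bar>u y - u x\<bar> \<le> r / 2"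
      using N[OF that] d(2)[of y] by (simp add: dist_commute)
  qed
  then show "\<exists>N. \<forall>i\<ge>N. norm (mollify (e i) (\<lambda>_. 0) u x - u x) < r"
    using \<open>r > 0\<close> by (intro exI[of _ N]) force
qed

text \<open>For derivatives of the kernel the L1 norm depends on \<open>e\<close>, so this bound is
  qualitative only; the bounds uniform in \<open>e\<close> come from the equation.\<close>

lemma mollify_bounded:
  fixes u :: "real^'n \<Rightarrow> real"
  assumes "e > 0" "bounded_borel u" "\<And>y. \<bar>u y\<bar> \<le> B"
  shows "\<bar>mollify e a u x\<bar> \<le> (LBINT y. \<bar>mollifier e a y\<bar>) * B"
proof -
  have m: "(\<lambda>y. \<bar>mollifier e a y\<bar>) \<in> borel_measurable borel"
    using bounded_supp_mollifier[OF assms(1), of a] by (auto simp: bounded_supp_def bounded_borel_def)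
  have i: "integrable lborel (\<lambda>y. mollifier e a (x - y))" "integrable lborel (\<lambda>y. mollifier e a (x - y) * u y)"
    using assms by auto
  have "\<bar>mollify e a u x\<bar> \<le> (LBINT y. \<bar>mollifier e a (x - y) * u y\<bar>)"
    unfolding mollify_def by (rule integral_abs_bound)
  also have "\<dots> \<le> (LBINT y. \<bar>mollifier e a (x - y)\<bar> * B)"
    using integrable_abs[OF i(1)] integrable_abs[OF i(2)] assms(3) by (intro integral_mono) (auto simp: abs_mult mult_left_mono)
  also have "\<dots> = (LBINT y. \<bar>mollifier e a y\<bar>) * B"
    using integral_reflect_lborel[OF m, of x] by simp
  finally show ?thesis .
qed

lemma DERIV_mollify:
  fixes u :: "real^'n \<Rightarrow> real"
  assumes e: "e > 0" and u: "bounded_borel u"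
  shows "((\<lambda>t. mollify e a u (x + t *\<^sub>R v)) has_real_derivative
    (\<Sum>j\<in>UNIV. v $ j * mollify e (raise a j) u (x + s *\<^sub>R v))) (at s)"
proof -
  define h where "h z = (\<Sum>j\<in>UNIV. v $ j * mollifier e (raise a j) z)" for z
  have h: "bounded_supp h"
    unfolding h_def[abs_def]
    by (intro bounded_supp_sum bounded_supp_mult(2) bounded_borel_const bounded_supp_mollifier[OF e])
  obtain B r where B: "\<And>x. \<bar>h x\<bar> \<le> B" and r: "\<And>x. r < norm x \<Longrightarrow> h x = 0"
    using h by (auto simp: bounded_supp_def bounded_borel_def)
  obtain U where U: "\<And>y. \<bar>u y\<bar> \<le> U"
    using u by (auto simp: bounded_borel_def)
  define w where "w = x + s *\<^sub>R v"
  have sub: "integrable lborel (\<lambda>y. mollifier e a (z - y) * u y)" for a z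
    using e u by (rule mollify_integrable)
  have "((\<lambda>t. LBINT y. mollifier e a (w + t *\<^sub>R v - y) * u y) has_real_derivative
      (LBINT y. h (w + 0 *\<^sub>R v - y) * u y)) (at 0)"
  \<comment> \<open>\<open>h\<close> vanishes outside radius \<open>r\<close>, and
    \<open>norm (w + t *\<^sub>R v - y) \<le> r\<close> forces
    \<open>norm y \<le> r + norm w + norm v\<close> once
    \<open>\<bar>t\<bar> \<le> 1\<close>.\<close>
  proof (rule DERIV_integral[where k' = "\<lambda>t y. h (w + t *\<^sub>R v - y) * u y" and
        g = "\<lambda>y. indicator (cball 0 (r + norm w + norm v)) y * (B * U)"])
    show "integrable lborel (\<lambda>y. mollifier e a (w + t *\<^sub>R v - y) * u y)" for t by (rule sub)
    show "(\<lambda>y. h (w + 0 *\<^sub>R v - y) * u y) \<in> borel_measurable borel"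
      using u bounded_supp_reflect[OF h, of w] by (auto simp: bounded_supp_def bounded_borel_def)
    show "((\<lambda>t. mollifier e a (w + t *\<^sub>R v - y) * u y) has_real_derivative h (w + t *\<^sub>R v - y) * u y) (at t)" for t y
      using DERIV_cmult_right[OF DERIV_mollifier[OF e, of a "w - y" v t], of "u y"]
      by (simp add: h_def algebra_simps)
    show "integrable lborel (\<lambda>y. indicator (cball 0 (r + norm w + norm v)) y * (B * U))"
      by (intro bounded_supp_integrable bounded_supp_mult bounded_supp_indicator) auto
    show "\<bar>h (w + t *\<^sub>R v - y) * u y\<bar> \<le> indicator (cball 0 (r + norm w + norm v)) y * (B * U)"
      if "\<bar>t\<bar> \<le> 1" for t y
    proof (cases "norm y \<le> r + norm w + norm v")
      case False
      have "norm y \<le> norm (w + t *\<^sub>R v - y) + norm (w + t *\<^sub>R v)"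
        by (metis norm_minus_commute add.commute diff_add_cancel norm_triangle_ineq)
      moreover have "norm (w + t *\<^sub>R v) \<le> norm w + norm v"
        using norm_triangle_ineq[of w "t *\<^sub>R v"] mult_right_mono[OF that norm_ge_zero[of v]] by simp
      ultimately have "r < norm (w + t *\<^sub>R v - y)"
        using False by simp
      then show ?thesis using r False by simp
    next
      case True
      have "\<bar>h (w + t *\<^sub>R v - y) * u y\<bar> \<le> B * U"
        unfolding abs_mult using B U by (meson abs_ge_zero mult_mono order_trans)
      then show ?thesis using True by simp
    qed
  qed
  moreover have "(LBINT y. h (w + 0 *\<^sub>R v - y) * u y) = (\<Sum>j\<in>UNIV. v $ j * mollify e (raise a j) u w)"
    using sub by (simp add: h_def mollify_def sum_distrib_right mult.assoc)
  ultimately have "((\<lambda>t. mollify e a u (w + t *\<^sub>R v)) has_real_derivative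
      (\<Sum>j\<in>UNIV. v $ j * mollify e (raise a j) u w)) (at 0)"
    by (simp add: mollify_def)
  then show ?thesis
    using DERIV_shift[of "\<lambda>t. mollify e a u (x + t *\<^sub>R v)" _ 0 s]
    by (simp add: w_def scaleR_add_left add_ac)
qed

lemma has_partial_mollify:
  fixes u :: "real^'n \<Rightarrow> real"
  assumes "e > 0" "bounded_borel u"
  shows "has_partial (mollify e a u) j (mollify e (raise a j) u x) x"
proof -
  have "(\<Sum>i\<in>UNIV. axis j 1 $ i * mollify e (raise a i) u x) = mollify e (raise a j) u x"
    by (simp add: axis_def if_distrib[of "\<lambda>c. c * _"] cong: if_cong)
  then show ?thesis
    using DERIV_mollify[OF assms, of a x "axis j 1" 0] by (simp add: has_partial_def)
qed

text \<open>The mean value inequality along the segment. The constant involves \<open>e\<close> only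
  through \<open>C\<close>, so a gradient bound uniform in \<open>e\<close> gives equi-Lipschitz
  mollifications.\<close>

lemma mollify_lipschitz:
  fixes u :: "real^'n \<Rightarrow> real"
  assumes "e > 0" "bounded_borel u"
    and C: "\<And>z j. z \<in> closed_segment x y \<Longrightarrow> \<bar>mollify e (raise a j) u z\<bar> \<le> C"
  shows "\<bar>mollify e a u y - mollify e a u x\<bar> \<le> real CARD('n) * C * norm (y - x)"
proof -
  let ?g = "\<lambda>t. mollify e a u (x + t *\<^sub>R (y - x))"
  have "\<bar>?g 1 - ?g 0\<bar> \<le> real CARD('n) * C * norm (y - x) * \<bar>1 - 0\<bar>"
  proof (rule field_differentiable_bound[of "{0..1::real}" ?g
      "\<lambda>t. \<Sum>j\<in>UNIV. (y - x) $ j * mollify e (raise a j) u (x + t *\<^sub>R (y - x))", unfolded real_norm_def])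
    fix t :: real assume t: "t \<in> {0..1}"
    show "(?g has_field_derivative (\<Sum>j\<in>UNIV. (y - x) $ j * mollify e (raise a j) u (x + t *\<^sub>R (y - x))))
        (at t within {0..1})"
      by (rule has_field_derivative_at_within[OF DERIV_mollify[OF assms(1,2)]])
    have seg: "x + t *\<^sub>R (y - x) \<in> closed_segment x y"
      using t by (auto simp: closed_segment_def algebra_simps intro!: exI[of _ t])
    have "\<bar>\<Sum>j\<in>UNIV. (y - x) $ j * mollify e (raise a j) u (x + t *\<^sub>R (y - x))\<bar> \<le>
        (\<Sum>j\<in>(UNIV :: 'n set). norm (y - x) * C)"
      unfolding abs_mult using C[OF seg] component_le_norm_cart[of "y - x"]
      by (intro order_trans[OF sum_abs] sum_mono) (simp only: abs_mult, intro mult_mono, auto)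
    then show "\<bar>\<Sum>j\<in>UNIV. (y - x) $ j * mollify e (raise a j) u (x + t *\<^sub>R (y - x))\<bar> \<le>
        real CARD('n) * C * norm (y - x)"
      by (simp add: mult_ac)
  qed auto
  then show ?thesis by simp
qed

text \<open>Measurability is obtained through continuity: the first derivatives are bounded, with a
  constant depending on \<open>e\<close>, so the mollification is Lipschitz.\<close>

lemma bounded_borel_mollify [intro]:
  fixes u :: "real^'n \<Rightarrow> real"
  assumes "e > 0" "bounded_borel u"
  shows "bounded_borel (mollify e a u)"
proof -
  obtain B where B: "\<And>y. \<bar>u y\<bar> \<le> B"
    using assms by (auto simp: bounded_borel_def)
  define C where "C = (\<Sum>j\<in>UNIV. (LBINT y. \<bar>mollifier e (raise a j) y\<bar>) * B)"
  have B0: "0 \<le> B" using B[of 0] by linarith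
  have "\<bar>mollify e (raise a j) u z\<bar> \<le> C" for j z
  proof -
    have "(LBINT y. \<bar>mollifier e (raise a j) y\<bar>) * B \<le> C"
      unfolding C_def using B0 by (intro member_le_sum) auto
    then show ?thesis
      using mollify_bounded[OF assms B, of "raise a j" z] by linarith
  qed
  then have "\<bar>mollify e a u y - mollify e a u x\<bar> \<le> real CARD('n) * C * norm (y - x)" for x y
    by (intro mollify_lipschitz[OF assms]) auto
  moreover have "0 \<le> C"
    unfolding C_def using B0 by (intro sum_nonneg mult_nonneg_nonneg) auto
  ultimately have "(real CARD('n) * C)-lipschitz_on UNIV (mollify e a u)"
    by (intro lipschitz_onI) (auto simp: dist_norm norm_minus_commute)
  then have "continuous_on UNIV (mollify e a u)"
    by (rule lipschitz_on_continuous_on)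
  then show ?thesis
    using mollify_bounded[OF assms B] by (intro bounded_borelI) (auto intro: borel_measurable_continuous_onI)
qed

section \<open>L1 convergence of mollifications and almost everywhere convergent
  subsequences\<close>

lemma L1_approx_continuous:
  fixes u :: "'a::euclidean_space \<Rightarrow> real"
  assumes u: "bounded_borel u" and \<phi>: "bounded_supp \<phi>" and "\<eta> > 0"
  shows "\<exists>g. continuous_on UNIV g \<and> bounded_borel g \<and> (LBINT x. \<phi> x * \<bar>u x - g x\<bar>) < \<eta>"
proof -
  obtain B where B: "\<And>x. \<bar>u x\<bar> \<le> B"
    using u by (auto simp: bounded_borel_def)
  have B0: "0 \<le> B" using B[of 0] by linarith
  have "u \<in> borel_measurable lebesgue"
    using u by (auto simp: bounded_borel_def intro: borel_measurable_if_lebesgue_on measurable_completion)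
  then have "u measurable_on UNIV"
    by (intro lebesgue_measurable_imp_measurable_on) auto
  then obtain N g where N: "negligible N" and g: "\<And>n. continuous_on UNIV (g n)"
    and lim: "\<And>x. x \<notin> N \<Longrightarrow> (\<lambda>n. g n x) \<longlonglongrightarrow> u x"
    unfolding measurable_on_def by auto
  \<comment> \<open>Clipping to the range of \<open>u\<close> keeps continuity and the pointwise
    limit, and supplies the uniform bound for dominated convergence.\<close>
  define h where "h n x = max (- B) (min B (g n x))" for n :: nat and x
  have h: "continuous_on UNIV (h n)" for n
    unfolding h_def[abs_def] by (intro continuous_intros g)
  have hB: "\<bar>h n x\<bar> \<le> B" for n x
    using B0 by (auto simp: h_def)
  have hb: "bounded_borel (h n)" for n
    using h hB by (intro bounded_borelI) (auto intro: borel_measurable_continuous_onI)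
  have hlim: "(\<lambda>n. h n x) \<longlonglongrightarrow> u x" if "x \<notin> N" for x
  proof -
    have "(\<lambda>n. h n x) \<longlonglongrightarrow> max (- B) (min B (u x))"
      unfolding h_def by (intro tendsto_intros lim that)
    then show ?thesis using B[of x] by (simp add: max_def min_def abs_le_iff split: if_splits) 
  qed
  have "AE x in lebesgue. x \<notin> N"
    using N by (intro AE_not_in) (simp add: negligible_iff_null_sets)
  then have "AE x in lborel. x \<notin> N"
    by (simp add: AE_completion_iff)
  then have ae: "AE x in lborel. \<phi> x \<noteq> 0 \<longrightarrow> (\<lambda>n. \<bar>u x - h n x\<bar>) \<longlonglongrightarrow> 0"
  proof eventually_elim
    case (elim x)
    then have "(\<lambda>n. \<bar>u x - h n x\<bar>) \<longlonglongrightarrow> \<bar>u x - u x\<bar>"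
      by (intro tendsto_intros hlim)
    then show ?case by simp
  qed
  have "\<bar>\<bar>u x - h n x\<bar>\<bar> \<le> 2 * B" for n x
    using B[of x] hB[of n x] by linarith
  then have "(\<lambda>n. LBINT x. \<phi> x * \<bar>u x - h n x\<bar>) \<longlonglongrightarrow> (LBINT x. \<phi> x * 0)"
    using u hb by (intro dominated_convergence_supp[OF \<phi> _ _ _ ae, of "2 * B"]) auto
  then have "eventually (\<lambda>n. (LBINT x. \<phi> x * \<bar>u x - h n x\<bar>) < \<eta>) sequentially"
    using \<open>\<eta> > 0\<close> by (auto dest: order_tendstoD)
  then obtain n where "(LBINT x. \<phi> x * \<bar>u x - h n x\<bar>) < \<eta>"
    by (auto simp: eventually_sequentially)
  then show ?thesis using h hb by blast
qed

lemma L1_continuous_translation: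
  fixes u :: "'a::euclidean_space \<Rightarrow> real"
  assumes u: "bounded_borel u" and "\<eta> > 0"
  shows "\<exists>d>0. \<forall>z. norm z \<le> d \<longrightarrow> (LBINT x. indicator (cball 0 r) x * \<bar>u (x - z) - u x\<bar>) \<le> \<eta>"
proof -
  let ?I = "\<lambda>r. indicator (cball (0::'a) r) :: 'a \<Rightarrow> real"
  have Is: "bounded_supp (?I s)" for s by auto
  have Ib: "bounded_borel (?I s)" for s by auto
  obtain g where g: "continuous_on UNIV g" "bounded_borel g"
    and ug: "(LBINT x. ?I (r + 1) x * \<bar>u x - g x\<bar>) < \<eta> / 3"
    using L1_approx_continuous[OF u Is[of "r + 1"], of "\<eta> / 3"] \<open>\<eta> > 0\<close> by auto
  define V where "V = (LBINT x. ?I r x)"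
  have V: "0 \<le> V" unfolding V_def by simp
  \<comment> \<open>The middle of three error terms is at most the volume \<open>V\<close> times
    \<open>\<theta>\<close>; \<open>V + 1\<close> avoids division by zero.\<close>
  define \<theta> where "\<theta> = \<eta> / (3 * (V + 1))"
  have \<theta>: "\<theta> > 0" "V * \<theta> \<le> \<eta> / 3"
    using V \<open>\<eta> > 0\<close> by (auto simp: \<theta>_def field_simps)
  have "uniformly_continuous_on (cball 0 (r + 1)) g"
    using g(1) by (intro compact_uniformly_continuous) (auto intro: continuous_on_subset)
  then obtain d where d: "d > 0"
    "\<And>x y. x \<in> cball 0 (r + 1) \<Longrightarrow> y \<in> cball 0 (r + 1) \<Longrightarrow> dist y x < d \<Longrightarrow> \<bar>g y - g x\<bar> < \<theta>"
    unfolding uniformly_continuous_on_def using \<theta>(1) by (metis dist_real_def)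
  \<comment> \<open>\<open>d / 2\<close> leaves room for the strict inequality of uniform
    continuity, and the bound 1 keeps \<open>x - z\<close> in the ball of radius
    \<open>r + 1\<close>.\<close>
  have "(LBINT x. ?I r x * \<bar>u (x - z) - u x\<bar>) \<le> \<eta>" if z: "norm z \<le> min (d / 2) 1" for z
  proof -
    have uz: "bounded_borel (\<lambda>x. u (x - z))" "bounded_borel (\<lambda>x. g (x - z))"
      using bounded_borel_shift[OF u, of "- z"] bounded_borel_shift[OF g(2), of "- z"] by auto
    have s1: "bounded_supp (\<lambda>x. ?I (r + 1) x * \<bar>u x - g x\<bar>)"
      using u g by (intro bounded_supp_mult Is) auto
    note s2 = bounded_supp_shift[OF s1, of "- z"]
    have pw: "?I r x * \<bar>u (x - z) - u x\<bar> \<le> ?I (r + 1) (x - z) * \<bar>u (x - z) - g (x - z)\<bar> +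
        ?I r x * \<theta> + ?I (r + 1) x * \<bar>u x - g x\<bar>" for x
    proof (cases "norm x \<le> r")
      case True
      then have "norm (x - z) \<le> r + 1"
        using z norm_triangle_ineq4[of x z] by simp
      moreover have "\<bar>g (x - z) - g x\<bar> < \<theta>"
        using z True d(1) \<open>norm (x - z) \<le> r + 1\<close> by (intro d(2)) (auto simp: dist_norm norm_minus_commute)
      ultimately show ?thesis using True by simp
    next
      case False
      then show ?thesis using \<theta>(1) by (auto simp: indicator_def)
    qed
    have "(LBINT x. ?I r x * \<bar>u (x - z) - u x\<bar>) \<le>
       (LBINT x. ?I (r + 1) (x - z) * \<bar>u (x - z) - g (x - z)\<bar> + ?I r x * \<theta> + ?I (r + 1) x * \<bar>u x - g x\<bar>)"
    proof (rule integral_mono)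
      show "integrable lborel (\<lambda>x. ?I r x * \<bar>u (x - z) - u x\<bar>)"
        using u uz by (intro bounded_supp_integrable bounded_supp_mult Is) auto
      show "integrable lborel (\<lambda>x. ?I (r + 1) (x - z) * \<bar>u (x - z) - g (x - z)\<bar> + ?I r x * \<theta> +
          ?I (r + 1) x * \<bar>u x - g x\<bar>)"
        using s1 s2 Is[of r] by (intro bounded_supp_integrable bounded_supp_add) auto
    qed (use pw in auto)
    also have "\<dots> = (LBINT x. ?I (r + 1) (x - z) * \<bar>u (x - z) - g (x - z)\<bar>) + V * \<theta> +
        (LBINT x. ?I (r + 1) x * \<bar>u x - g x\<bar>)"
    proof -
      have "integrable lborel (\<lambda>x. ?I (r + 1) (x - z) * \<bar>u (x - z) - g (x - z)\<bar>)"
        using bounded_supp_integrable[OF s2] by simp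
      moreover have "integrable lborel (\<lambda>x. ?I r x * \<theta>)"
        using Is[of r] by (intro bounded_supp_integrable bounded_supp_mult) auto
      moreover have "integrable lborel (\<lambda>x. ?I (r + 1) x * \<bar>u x - g x\<bar>)"
        using s1 by auto
      ultimately show ?thesis
        by (simp add: V_def del: integrable_mult_left_iff)
    qed
    also have "(LBINT x. ?I (r + 1) (x - z) * \<bar>u (x - z) - g (x - z)\<bar>) =
        (LBINT x. ?I (r + 1) x * \<bar>u x - g x\<bar>)"
      using integral_translate[of "\<lambda>x. ?I (r + 1) x * \<bar>u x - g x\<bar>" "- z"] s1
      by (auto simp: bounded_supp_def bounded_borel_def)
    finally show ?thesis using ug \<theta>(2) by linarith
  qed
  then show ?thesis
    using d(1) by (intro exI[of _ "min (d / 2) 1"]) auto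
qed

lemma nn_integral_translate_swap:
  fixes m J u :: "'a::euclidean_space \<Rightarrow> real"
  assumes [measurable]: "m \<in> borel_measurable borel" "J \<in> borel_measurable borel" "u \<in> borel_measurable borel"
  shows "(\<integral>\<^sup>+x. \<integral>\<^sup>+z. ennreal (J x * (m z * \<bar>u (x - z) - u x\<bar>)) \<partial>lborel \<partial>lborel) =
    (\<integral>\<^sup>+z. \<integral>\<^sup>+x. ennreal (J x * (m z * \<bar>u (x - z) - u x\<bar>)) \<partial>lborel \<partial>lborel)"
  by (intro lborel_pair.Fubini'[symmetric]) measurable

text \<open>The mollification error is an average of the differences \<open>u (x - z) - u x\<close>
  over small \<open>z\<close>. Interchanging the integrals bounds its L1 norm by the average of the
  translation errors, each small by \<open>L1_continuous_translation\<close>.\<close>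

lemma mollify_L1:
  fixes u :: "real^'n \<Rightarrow> real"
  assumes u: "bounded_borel u" and e: "\<And>i. e i > 0" "e \<longlonglongrightarrow> 0"
  shows "(\<lambda>i. LBINT x. indicator (cball 0 r) x * \<bar>mollify (e i) (\<lambda>_. 0) u x - u x\<bar>) \<longlonglongrightarrow> 0"
proof (rule LIMSEQ_I)
  fix \<eta> :: real assume \<eta>: "\<eta> > 0"
  let ?I = "indicator (cball (0::real^'n) r) :: real^'n \<Rightarrow> real"
  obtain d where d: "d > 0" "\<And>z. norm z \<le> d \<Longrightarrow> (LBINT x. ?I x * \<bar>u (x - z) - u x\<bar>) \<le> \<eta> / 2"
    using L1_continuous_translation[OF u, of "\<eta> / 2" r] \<eta> by auto
  have "(\<lambda>i. real CARD('n) * e i) \<longlonglongrightarrow> real CARD('n) * 0"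
    using e(2) by (intro tendsto_intros)
  from order_tendstoD(2)[OF this, of d] have "eventually (\<lambda>i. real CARD('n) * e i < d) sequentially"
    using d(1) by simp
  then obtain N where N: "\<And>i. i \<ge> N \<Longrightarrow> real CARD('n) * e i < d"
    by (auto simp: eventually_sequentially)
  have bd: "(LBINT x. ?I x * \<bar>mollify (e i) (\<lambda>_. 0) u x - u x\<bar>) \<le> \<eta> / 2" if "i \<ge> N" for i
  proof -
    let ?m = "mollifier (e i) (\<lambda>_::'n. 0)"
    let ?g = "\<lambda>x. ?I x * \<bar>mollify (e i) (\<lambda>_. 0) u x - u x\<bar>"
    have [measurable]: "u \<in> borel_measurable borel" using u by (auto simp: bounded_borel_def)
    have mb: "bounded_supp ?m" by (rule bounded_supp_mollifier[OF e(1)])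
    have [measurable]: "?m \<in> borel_measurable borel" using mb by (auto simp: bounded_supp_def bounded_borel_def)
    have ui: "bounded_borel (\<lambda>z. u (x - z))" for x
      using u by (auto simp: bounded_borel_def)
    have uz: "bounded_borel (\<lambda>x. u (x - z))" for z
      using u by (auto simp: bounded_borel_def)
    have mnn: "0 \<le> ?m z" for z by (rule mollifier_nonneg[OF e(1)])
    have m0: "?m z = 0" if "\<not> norm z \<le> d" for z
    proof -
      have "- z \<notin> cube 0 (e i)"
        using that cube_subset_cball[of 0 "e i"] N[OF \<open>i \<ge> N\<close>] by force
      from mollifier_eq_0[OF e(1) this] show ?thesis by simp
    qed
    have "?g x \<le> (LBINT z. ?I x * (?m z * \<bar>u (x - z) - u x\<bar>))" for x
    proof -
      have i1: "integrable lborel (\<lambda>z. ?m z * u (x - z))" "integrable lborel ?m"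
        using bounded_supp_integrable[OF bounded_supp_mult(1)[OF mb ui]] mb by auto
      have "mollify (e i) (\<lambda>_. 0) u x = (LBINT z. ?m z * u (x - z))"
        unfolding mollify_def using integral_reflect_lborel[of "\<lambda>z. ?m z * u (x - z)" x] by simp
      then have "mollify (e i) (\<lambda>_. 0) u x - u x = (LBINT z. ?m z * u (x - z) - ?m z * u x)"
        using i1 integral_mollifier[OF e(1), of i, where 'n = 'n]
        by (subst Bochner_Integration.integral_diff) auto
      also have "\<bar>\<dots>\<bar> \<le> (LBINT z. \<bar>?m z * u (x - z) - ?m z * u x\<bar>)"
        by (rule integral_abs_bound)
      also have "\<dots> = (LBINT z. ?m z * \<bar>u (x - z) - u x\<bar>)"
        by (subst right_diff_distrib[symmetric]) (simp add: abs_mult abs_of_nonneg[OF mollifier_nonneg[OF e(1)]])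
      finally show ?thesis by (simp add: mult_left_mono)
    qed
    then have "(\<integral>\<^sup>+x. ennreal (?g x) \<partial>lborel) \<le>
        (\<integral>\<^sup>+x. ennreal (LBINT z. ?I x * (?m z * \<bar>u (x - z) - u x\<bar>)) \<partial>lborel)"
      by (intro nn_integral_mono ennreal_leI) auto
    also have "\<dots> = (\<integral>\<^sup>+x. \<integral>\<^sup>+z. ennreal (?I x * (?m z * \<bar>u (x - z) - u x\<bar>)) \<partial>lborel \<partial>lborel)"
    proof (intro nn_integral_cong nn_integral_eq_integral[symmetric] AE_I2)
      show "integrable lborel (\<lambda>z. ?I x * (?m z * \<bar>u (x - z) - u x\<bar>))" for x
        using mb ui by (intro bounded_supp_integrable bounded_supp_mult(2)[OF bounded_borel_const] bounded_supp_mult(1)[OF mb]) auto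
      show "0 \<le> ?I x * (?m z * \<bar>u (x - z) - u x\<bar>)" for x z
        by (intro mult_nonneg_nonneg mollifier_nonneg[OF e(1)]) auto
    qed
    also have "\<dots> = (\<integral>\<^sup>+z. \<integral>\<^sup>+x. ennreal (?I x * (?m z * \<bar>u (x - z) - u x\<bar>)) \<partial>lborel \<partial>lborel)"
      by (intro nn_integral_translate_swap borel_measurable_indicator) auto
    also have "\<dots> \<le> (\<integral>\<^sup>+z. ennreal (?m z * (\<eta> / 2)) \<partial>lborel)"
    proof (rule nn_integral_mono)
      fix z :: "real^'n"
      have "(\<integral>\<^sup>+x. ennreal (?I x * (?m z * \<bar>u (x - z) - u x\<bar>)) \<partial>lborel) =
          ennreal (LBINT x. ?m z * (?I x * \<bar>u (x - z) - u x\<bar>))"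
        unfolding mult.left_commute[of "?I _"]
      proof (intro nn_integral_eq_integral AE_I2)
        show "integrable lborel (\<lambda>x. ?m z * (?I x * \<bar>u (x - z) - u x\<bar>))"
          using u uz bounded_supp_indicator[of "cball 0 r"]
          by (intro bounded_supp_integrable bounded_supp_mult(2)[OF bounded_borel_const] bounded_supp_mult(1)) auto
        show "0 \<le> ?m z * (?I x * \<bar>u (x - z) - u x\<bar>)" for x
          by (intro mult_nonneg_nonneg mollifier_nonneg[OF e(1)]) auto
      qed
      also have "\<dots> \<le> ennreal (?m z * (\<eta> / 2))"
      proof (rule ennreal_leI, cases "norm z \<le> d")
        case True
        then show "(LBINT x. ?m z * (?I x * \<bar>u (x - z) - u x\<bar>)) \<le> ?m z * (\<eta> / 2)"
          using d(2) mollifier_nonneg[OF e(1), of i z] by (simp add: mult_left_mono del: times_divide_eq_right)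
      qed (simp add: m0)
      finally show "(\<integral>\<^sup>+x. ennreal (?I x * (?m z * \<bar>u (x - z) - u x\<bar>)) \<partial>lborel) \<le> ennreal (?m z * (\<eta> / 2))" .
    qed
    also have "\<dots> = ennreal (LBINT z. ?m z * (\<eta> / 2))"
      using mb \<eta> mnn
      by (intro nn_integral_eq_integral AE_I2 bounded_supp_integrable bounded_supp_mult(1)[OF mb]) auto
    also have "(LBINT z. ?m z * (\<eta> / 2)) = \<eta> / 2"
      using integral_mollifier[OF e(1), of i, where 'n = 'n] by simp
    finally have "(\<integral>\<^sup>+x. ennreal (?g x) \<partial>lborel) \<le> ennreal (\<eta> / 2)" .
    moreover have "integrable lborel ?g"
      using u e by (intro bounded_supp_integrable bounded_supp_mult(1)[OF bounded_supp_indicator]) auto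
    ultimately show ?thesis
      using \<eta> by (subst (asm) nn_integral_eq_integral) auto
  qed
  have nn: "0 \<le> (LBINT x. ?I x * \<bar>mollify (e i) (\<lambda>_. 0) u x - u x\<bar>)" for i
    by (intro Bochner_Integration.integral_nonneg) auto
  have "norm ((LBINT x. ?I x * \<bar>mollify (e i) (\<lambda>_. 0) u x - u x\<bar>) - 0) < \<eta>"
    if "i \<ge> N" for i
    unfolding real_norm_def diff_0_right abs_of_nonneg[OF nn] using \<eta> bd[OF that] by linarith
  then show "\<exists>N. \<forall>i\<ge>N. norm ((LBINT x. ?I x * \<bar>mollify (e i) (\<lambda>_. 0) u x - u x\<bar>) - 0) < \<eta>"
    by blast
qed

text \<open>The errors of all members of the finite family are summed before the subsequence is
  chosen, so one subsequence serves every matrix entry.\<close>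

lemma mollify_AE_subseq:
  fixes u :: "'k \<Rightarrow> real^'n \<Rightarrow> real"
  assumes I: "finite I" and u: "\<And>k. k \<in> I \<Longrightarrow> bounded_borel (u k)"
    and e: "\<And>i. e i > 0" "e \<longlonglongrightarrow> 0"
  shows "\<exists>s. strict_mono s \<and>
    (AE x in lborel. norm x \<le> r \<longrightarrow> (\<forall>k\<in>I. (\<lambda>i. mollify (e (s i)) (\<lambda>_. 0) (u k) x) \<longlonglongrightarrow> u k x))"
proof -
  define w where "w i x = (\<Sum>k\<in>I. indicator (cball 0 r) x * \<bar>mollify (e i) (\<lambda>_. 0) (u k) x - u k x\<bar>)" for i x
  have ws: "bounded_supp (\<lambda>x. indicator (cball 0 r) x * \<bar>mollify (e i) (\<lambda>_. 0) (u k) x - u k x\<bar>)"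
    if "k \<in> I" for i k
    by (intro bounded_supp_mult(1) bounded_supp_indicator bounded_borel_abs bounded_borel_diff
        bounded_borel_mollify e(1) u that) auto
  have w0: "0 \<le> w i x" for i x
    unfolding w_def by (intro sum_nonneg) auto
  have "(\<lambda>i. \<Sum>k\<in>I. LBINT x. indicator (cball 0 r) x * \<bar>mollify (e i) (\<lambda>_. 0) (u k) x - u k x\<bar>) \<longlonglongrightarrow> (\<Sum>k\<in>I. 0)"
    by (intro tendsto_sum mollify_L1[OF u e])
  moreover have "(LBINT x. norm (w i x)) =
      (\<Sum>k\<in>I. LBINT x. indicator (cball 0 r) x * \<bar>mollify (e i) (\<lambda>_. 0) (u k) x - u k x\<bar>)" for i
  proof -
    have "norm (w i x) = w i x" for x
      using w0 by simp
    then have "(LBINT x. norm (w i x)) = (LBINT x. w i x)" by presburger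
    then show ?thesis
      unfolding w_def using ws by (subst Bochner_Integration.integral_sum[symmetric]) (simp_all add: bounded_supp_integrable)
  qed
  ultimately have "(\<lambda>i. LBINT x. norm (w i x)) \<longlonglongrightarrow> 0"
    by simp
  moreover have "integrable lborel (w i)" for i
    unfolding w_def[abs_def] by (intro bounded_supp_integrable bounded_supp_sum ws)
  ultimately have "\<exists>s. strict_mono s \<and> (AE x in lborel. (\<lambda>i. w (s i) x) \<longlonglongrightarrow> 0)"
    by (intro tendsto_L1_AE_subseq)
  then obtain s where s: "strict_mono s" "AE x in lborel. (\<lambda>i. w (s i) x) \<longlonglongrightarrow> 0"
    by auto
  from s(2) have "AE x in lborel. norm x \<le> r \<longrightarrow>
      (\<forall>k\<in>I. (\<lambda>i. mollify (e (s i)) (\<lambda>_. 0) (u k) x) \<longlonglongrightarrow> u k x)"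
  proof eventually_elim
    case (elim x)
    show ?case
    proof (intro impI ballI)
      fix k assume r: "norm x \<le> r" and k: "k \<in> I"
      have "norm (mollify (e (s i)) (\<lambda>_. 0) (u k) x - u k x) \<le> w (s i) x" for i
        using member_le_sum[OF k, of "\<lambda>k. \<bar>mollify (e (s i)) (\<lambda>_. 0) (u k) x - u k x\<bar>"] I r
        by (simp add: w_def)
      then show "(\<lambda>i. mollify (e (s i)) (\<lambda>_. 0) (u k) x) \<longlonglongrightarrow> u k x"
        by (intro LIM_zero_cancel[OF Lim_null_comparison[OF _ elim]] always_eventually allI)
    qed
  qed
  with s(1) show ?thesis by blast
qed

section \<open>Cofactors and Koszul's formula for rotations\<close>

definition replace_row :: "'a^'n^'m \<Rightarrow> 'm \<Rightarrow> 'a^'n \<Rightarrow> 'a^'n^'m" where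
  "replace_row A m r = (\<chi> i. if i = m then r else A $ i)"

lemma replace_row_nth: "replace_row A m r $ i = (if i = m then r else A $ i)"
  by (simp add: replace_row_def)

lemma SO_gram:
  fixes A :: "real^'n^'n"
  assumes "A \<in> SO"
  shows "(\<Sum>l\<in>UNIV. A $ l $ k * A $ l $ j) = (if k = j then 1 else 0)"
    and "(\<Sum>l\<in>UNIV. A $ k $ l * A $ j $ l) = (if k = j then 1 else 0)"
proof -
  have "transpose A ** A = mat 1" "A ** transpose A = mat 1"
    using assms by (auto simp: SO_def orthogonal_matrix_def)
  then have "(transpose A ** A) $ k $ j = (mat 1 :: real^'n^'n) $ k $ j"
    "(A ** transpose A) $ k $ j = (mat 1 :: real^'n^'n) $ k $ j" by simp_all
  then show "(\<Sum>l\<in>UNIV. A $ l $ k * A $ l $ j) = (if k = j then 1 else 0)"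
    "(\<Sum>l\<in>UNIV. A $ k $ l * A $ j $ l) = (if k = j then 1 else 0)"
    by (simp_all add: matrix_matrix_mult_def transpose_def mat_def)
qed

lemma SO_entry_le_1:
  fixes A :: "real^'n^'n"
  assumes "A \<in> SO"
  shows "\<bar>A $ m $ k\<bar> \<le> 1"
proof -
  have "A $ m $ k * A $ m $ k \<le> (\<Sum>l\<in>UNIV. A $ m $ l * A $ m $ l)"
    by (intro member_le_sum) auto
  then have "(A $ m $ k)\<^sup>2 \<le> 1"
    using SO_gram(2)[OF assms, of m m] by (simp add: power2_eq_square)
  then show ?thesis by (simp add: abs_square_le_1)
qed

text \<open>By orthogonality \<open>axis k 1\<close> is the combination of the rows of
  \<open>A\<close> with coefficients \<open>A $ i $ k\<close>, and Cramer's rule reads off the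
  coefficient of row \<open>m\<close>.\<close>

lemma SO_cofactor:
  fixes A :: "real^'n^'n"
  assumes "A \<in> SO"
  shows "det (replace_row A m (axis k 1)) = A $ m $ k"
proof -
  have *: "(\<Sum>i\<in>UNIV. A $ i $ k *s row i A) = axis k 1"
    using SO_gram(1)[OF assms] by (simp add: vec_eq_iff row_def axis_def mult.commute eq_commute)
  have "det (\<chi> i. if i = m then \<Sum>i\<in>UNIV. (\<chi> i. A $ i $ k) $ i *s row i A else row i A) =
      (\<chi> i. A $ i $ k) $ m * det A"
    by (rule cramer_lemma_transpose)
  moreover have "det A = 1" using assms by (simp add: SO_def)
  moreover have "row i A = A $ i" for i by (simp add: row_def vec_eq_iff)
  ultimately show ?thesis
    using * by (simp add: replace_row_def cong: if_cong)
qed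

lemma det_replace_row_expand:
  fixes A :: "real^'n^'n"
  shows "det (replace_row A i r) = (\<Sum>l\<in>UNIV. r $ l * det (replace_row A i (axis l 1)))"
proof -
  have "r = (\<Sum>l\<in>UNIV. r $ l *s axis l 1)"
    by (simp add: vec_eq_iff axis_def if_distrib[of "\<lambda>x. _ * x"] cong: if_cong)
  then have "det (replace_row A i r) = det (\<chi> i'. if i' = i then \<Sum>l\<in>UNIV. r $ l *s axis l 1 else A $ i')"
    by (simp add: replace_row_def cong: if_cong)
  also have "\<dots> = (\<Sum>l\<in>UNIV. det (\<chi> i'. if i' = i then r $ l *s axis l 1 else A $ i'))"
    by (rule det_linear_row_sum) simp
  also have "\<dots> = (\<Sum>l\<in>UNIV. r $ l * det (replace_row A i (axis l 1)))"
    by (simp add: det_row_mul replace_row_def)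
  finally show ?thesis .
qed

text \<open>The two matrices differ by exchanging rows \<open>i\<close> and \<open>m\<close>. This
  sign is what makes the Curl appear in \<open>divergence_cofactor\<close>.\<close>

lemma det_replace_rows_swap:
  fixes A :: "real^'n^'n"
  assumes "i \<noteq> m"
  shows "det (replace_row (replace_row A m r) i s) = - det (replace_row (replace_row A m s) i r)"
proof -
  have p: "Transposition.transpose i m permutes UNIV" by (simp add: permutes_def) (metis transpose_involutory transpose_eq_imp_eq)
  have "(\<chi> i'. replace_row (replace_row A m s) i r $ Transposition.transpose i m i') =
      replace_row (replace_row A m r) i s"
    using assms by (auto simp: vec_eq_iff replace_row_def Transposition.transpose_def)
  then show ?thesis
    using det_permute_rows[OF p, of "replace_row (replace_row A m s) i r"] assms
    by (simp add: sign_swap_id)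
qed

text \<open>Pure algebra with \<open>D k\<close> in place of the k-th partial derivative of
  \<open>F\<close>. The coefficient of \<open>D k $ i $ l\<close> is antisymmetric in
  \<open>k\<close> and \<open>l\<close>, so only the antisymmetric part survives, half the Curl of
  row \<open>i\<close>. For vanishing Curl this is Piola's identity.\<close>

lemma divergence_cofactor:
  fixes F :: "real^'n^'n" and D :: "'n \<Rightarrow> real^'n^'n"
  shows "(\<Sum>k\<in>UNIV. \<Sum>i\<in>UNIV. det (replace_row (replace_row F m (axis k 1)) i (replace_row (D k) m 0 $ i))) =
    (\<Sum>i\<in>UNIV - {m}. \<Sum>k\<in>UNIV. \<Sum>l\<in>UNIV. (D k $ i $ l - D l $ i $ k) / 2 *
       det (replace_row (replace_row F m (axis k 1)) i (axis l 1)))" (is "?L = ?R")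
proof -
  let ?d = "\<lambda>k i l. det (replace_row (replace_row F m (axis k 1)) i (axis l 1))"
  have "det (replace_row (replace_row F m (axis k 1)) m (replace_row (D k) m 0 $ m)) = 0" for k
    by (rule det_zero_row(1)[of m]) (simp add: replace_row_def row_def vec_eq_iff)
  then have "?L = (\<Sum>k\<in>UNIV. \<Sum>i\<in>UNIV - {m}. det (replace_row (replace_row F m (axis k 1)) i (replace_row (D k) m 0 $ i)))"
    by (intro sum.cong refl sum.mono_neutral_right) auto
  also have "\<dots> = (\<Sum>i\<in>UNIV - {m}. \<Sum>k\<in>UNIV. \<Sum>l\<in>UNIV. D k $ i $ l * ?d k i l)"
    by (subst sum.swap) (auto intro!: sum.cong simp: replace_row_nth[of _ m 0] simp flip: det_replace_row_expand)
  also have "\<dots> = ?R"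
  proof (rule sum.cong[OF refl])
    fix i assume "i \<in> UNIV - {m}"
    then have sw: "?d k i l = - ?d l i k" for k l
      by (intro det_replace_rows_swap) auto
    have "(\<Sum>k\<in>UNIV. \<Sum>l\<in>UNIV. D k $ i $ l * ?d k i l) = (\<Sum>l\<in>UNIV. \<Sum>k\<in>UNIV. D k $ i $ l * ?d k i l)"
      by (rule sum.swap)
    also have "\<dots> = (\<Sum>k\<in>UNIV. \<Sum>l\<in>UNIV. - D l $ i $ k * ?d k i l)"
      by (subst sw) simp
    finally have "2 * (\<Sum>k\<in>UNIV. \<Sum>l\<in>UNIV. D k $ i $ l * ?d k i l) =
        (\<Sum>k\<in>UNIV. \<Sum>l\<in>UNIV. D k $ i $ l * ?d k i l) + (\<Sum>k\<in>UNIV. \<Sum>l\<in>UNIV. - D l $ i $ k * ?d k i l)"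
      by simp
    also have "\<dots> = 2 * (\<Sum>k\<in>UNIV. \<Sum>l\<in>UNIV. (D k $ i $ l - D l $ i $ k) / 2 * ?d k i l)"
      by (simp add: sum_distrib_left flip: sum.distrib) (simp add: algebra_simps)
    finally show "(\<Sum>k\<in>UNIV. \<Sum>l\<in>UNIV. D k $ i $ l * ?d k i l) =
        (\<Sum>k\<in>UNIV. \<Sum>l\<in>UNIV. (D k $ i $ l - D l $ i $ k) / 2 * ?d k i l)" by simp
  qed
  finally show ?thesis .
qed

lemma has_partial_replace_row:
  assumes "\<And>i k. has_partial (\<lambda>x. F x $ i $ k) j (D $ i $ k) x"
  shows "has_partial (\<lambda>x. replace_row (F x) m r $ i $ k) j (replace_row D m 0 $ i $ k) x"
  using assms by (cases "i = m") (auto simp: replace_row_nth)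

lemma bounded_borel_replace_row:
  fixes F :: "real^'n \<Rightarrow> real^'n^'n"
  assumes "\<And>i k. bounded_borel (\<lambda>x. F x $ i $ k)" "\<And>k. bounded_borel (\<lambda>x. r x $ k)"
  shows "bounded_borel (\<lambda>x. replace_row (F x) m (r x) $ i $ k)"
  using assms by (cases "i = m") (auto simp: replace_row_nth)

lemma tendsto_det:
  fixes A :: "'a \<Rightarrow> real^'n^'n"
  assumes "\<And>i k. ((\<lambda>x. A x $ i $ k) \<longlongrightarrow> L $ i $ k) G"
  shows "((\<lambda>x. det (A x)) \<longlongrightarrow> det L) G"
  unfolding det_def by (intro tendsto_intros assms)

lemma abs_det_le_fact:
  fixes A :: "real^'n^'n"
  assumes "\<And>i k. \<bar>A $ i $ k\<bar> \<le> 1"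
  shows "\<bar>det A\<bar> \<le> real (fact CARD('n))"
proof -
  have "\<bar>of_int (sign p) * (\<Prod>i\<in>UNIV. A $ i $ p i)\<bar> \<le> 1" for p :: "'n \<Rightarrow> 'n"
  proof -
    have "(\<Prod>i\<in>UNIV. \<bar>A $ i $ p i\<bar>) \<le> 1"
      using assms by (intro prod_le_1) auto
    then show ?thesis by (simp add: abs_mult sign_def abs_prod)
  qed
  then have "\<bar>det A\<bar> \<le> (\<Sum>p | p permutes (UNIV :: 'n set). 1)"
    unfolding det_def by (intro order_trans[OF sum_abs] sum_mono) auto
  also have "\<dots> = real (fact CARD('n))"
    by (simp add: card_permutations)
  finally show ?thesis .
qed

text \<open>The divergence of row \<open>m\<close> of a rotation field \<open>A\<close> with Curl \<open>g\<close>: row \<open>m\<close> is the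
  corresponding row of cofactors, whose divergence only involves the Curl of the other rows.\<close>
definition divergence_of_curl :: "real^'n^'n \<Rightarrow> real^'n^'n^'n \<Rightarrow> 'n \<Rightarrow> real" where
  "divergence_of_curl A g m = (\<Sum>i\<in>UNIV - {m}. \<Sum>k\<in>UNIV. \<Sum>l\<in>UNIV. g $ i $ k $ l / 2 *
     det (replace_row (replace_row A m (axis k 1)) i (axis l 1)))"

text \<open>The partial derivatives of a rotation field \<open>A\<close> with Curl \<open>g\<close>; \<open>curl_frame\<close> expresses the
  Curl in the orthonormal frame formed by the rows of \<open>A\<close>.\<close>
definition curl_frame :: "real^'n^'n \<Rightarrow> real^'n^'n^'n \<Rightarrow> 'n \<Rightarrow> 'n \<Rightarrow> 'n \<Rightarrow> real" where
  "curl_frame A g m l p = (\<Sum>j\<in>UNIV. \<Sum>k\<in>UNIV. g $ m $ j $ k * A $ l $ k * A $ p $ j)"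

definition grad_of_curl :: "real^'n^'n \<Rightarrow> real^'n^'n^'n \<Rightarrow> 'n \<Rightarrow> 'n \<Rightarrow> 'n \<Rightarrow> real" where
  "grad_of_curl A g j m k = (\<Sum>l\<in>UNIV. \<Sum>p\<in>UNIV.
     (curl_frame A g m l p - curl_frame A g p m l + curl_frame A g l p m) / 2 * A $ l $ k * A $ p $ j)"

text \<open>The derivative of entry \<open>(m, l)\<close> of \<open>A A^T\<close> in the direction
  of row \<open>p\<close> of \<open>A\<close>, written with \<open>D\<close> in place of the
  derivatives of \<open>A\<close>.\<close>

definition sym_frame :: "real^'n^'n \<Rightarrow> ('n \<Rightarrow> real^'n^'n) \<Rightarrow> 'n \<Rightarrow> 'n \<Rightarrow> 'n \<Rightarrow> real" where
  "sym_frame A D m l p = (\<Sum>j\<in>UNIV. A $ p $ j * (\<Sum>k\<in>UNIV. D j $ m $ k * A $ l $ k + D j $ l $ k * A $ m $ k))"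

text \<open>Koszul's formula; \<open>sym_frame\<close> vanishes for genuine derivatives of rotation fields.\<close>
lemma koszul:
  fixes A :: "real^'n^'n"
  assumes A: "A \<in> SO" and g: "\<And>m j k. g $ m $ j $ k = D j $ m $ k - D k $ m $ j"
  shows "D j $ m $ k = grad_of_curl A g j m k + (\<Sum>l\<in>UNIV. \<Sum>p\<in>UNIV.
     (sym_frame A D m p l - sym_frame A D p l m + sym_frame A D l m p) / 2 * A $ l $ k * A $ p $ j)"
proof -
  \<comment> \<open>The connection coefficients of the row frame: the derivative of row
    \<open>m\<close> along row \<open>p\<close>, paired with row \<open>l\<close>. The Curl
    determines their antisymmetric part in the last two indices, \<open>sym_frame\<close> the
    symmetric part in the first two.\<close>
  define T where "T m l p = (\<Sum>j\<in>UNIV. \<Sum>k\<in>UNIV. D j $ m $ k * A $ l $ k * A $ p $ j)" for m l p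
  have c: "curl_frame A g m l p = T m l p - T m p l" for m l p
  proof -
    have "(\<Sum>j\<in>UNIV. \<Sum>k\<in>UNIV. D k $ m $ j * A $ l $ k * A $ p $ j) = T m p l"
      unfolding T_def by (subst sum.swap) (simp add: mult_ac)
    then show ?thesis
      by (simp add: curl_frame_def T_def g left_diff_distrib sum_subtractf)
  qed
  have s: "sym_frame A D m l p = T m l p + T l m p" for m l p
    by (simp add: sym_frame_def T_def sum_distrib_left sum.distrib algebra_simps)
  \<comment> \<open>In the alternating sums all terms cancel in pairs except two copies of
    \<open>T m l p\<close>.\<close>
  have T: "T m l p = (curl_frame A g m l p - curl_frame A g p m l + curl_frame A g l p m) / 2 +
      (sym_frame A D m p l - sym_frame A D p l m + sym_frame A D l m p) / 2" for l p
    unfolding c s by (simp add: field_simps)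
  \<comment> \<open>Since the rows form an orthonormal basis, expanding in the frame and contracting
    with \<open>SO_gram\<close> recovers the coordinate derivative from \<open>T\<close>.\<close>
  have "(\<Sum>l\<in>UNIV. \<Sum>p\<in>UNIV. T m l p * A $ l $ k * A $ p $ j) =
      (\<Sum>l\<in>UNIV. \<Sum>p\<in>UNIV. \<Sum>j'\<in>UNIV. \<Sum>k'\<in>UNIV. D j' $ m $ k' * (A $ l $ k' * A $ l $ k) * (A $ p $ j' * A $ p $ j))"
    unfolding T_def sum_distrib_right by (simp add: mult_ac)
  also have "\<dots> = (\<Sum>j'\<in>UNIV. \<Sum>k'\<in>UNIV. \<Sum>l\<in>UNIV. \<Sum>p\<in>UNIV. D j' $ m $ k' * (A $ l $ k' * A $ l $ k) * (A $ p $ j' * A $ p $ j))"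
  proof -
    have "(\<Sum>l\<in>UNIV. \<Sum>p\<in>UNIV. \<Sum>j'\<in>UNIV. \<Sum>k'\<in>UNIV. G l p j' k') = (\<Sum>j'\<in>UNIV. \<Sum>k'\<in>UNIV. \<Sum>l\<in>UNIV. \<Sum>p\<in>UNIV. G l p j' k')"
      for G :: "'n \<Rightarrow> 'n \<Rightarrow> 'n \<Rightarrow> 'n \<Rightarrow> real"
    proof -
      have "(\<Sum>l\<in>UNIV. \<Sum>p\<in>UNIV. \<Sum>j'\<in>UNIV. \<Sum>k'\<in>UNIV. G l p j' k') = (\<Sum>l\<in>UNIV. \<Sum>j'\<in>UNIV. \<Sum>p\<in>UNIV. \<Sum>k'\<in>UNIV. G l p j' k')"
        by (rule sum.cong[OF refl]) (rule sum.swap)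
      also have "\<dots> = (\<Sum>j'\<in>UNIV. \<Sum>l\<in>UNIV. \<Sum>k'\<in>UNIV. \<Sum>p\<in>UNIV. G l p j' k')"
        by (subst sum.swap) (intro sum.cong refl sum.swap)
      also have "\<dots> = (\<Sum>j'\<in>UNIV. \<Sum>k'\<in>UNIV. \<Sum>l\<in>UNIV. \<Sum>p\<in>UNIV. G l p j' k')"
        by (rule sum.cong[OF refl]) (rule sum.swap)
      finally show ?thesis .
    qed
    then show ?thesis .
  qed
  also have "\<dots> = (\<Sum>j'\<in>UNIV. \<Sum>k'\<in>UNIV. D j' $ m $ k' * ((\<Sum>l\<in>UNIV. A $ l $ k' * A $ l $ k) * (\<Sum>p\<in>UNIV. A $ p $ j' * A $ p $ j)))"
    unfolding sum_product by (simp only: sum_distrib_left mult.assoc)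
  also have "\<dots> = (\<Sum>j'\<in>UNIV. \<Sum>k'\<in>UNIV. if k' = k then if j' = j then D j $ m $ k else 0 else 0)"
    by (intro sum.cong refl) (simp add: SO_gram(1)[OF A])
  also have "\<dots> = D j $ m $ k" by simp
  finally show ?thesis
    unfolding T grad_of_curl_def by (simp add: distrib_right sum.distrib)
qed

text \<open>Here \<open>a j k\<close> stands for the j-th derivative of the component
  \<open>v k\<close> of one row, \<open>p\<close> for the cutoff and \<open>q\<close> for its
  gradient. The first sum on the right will have integral zero, so the inequality bounds the energy
  by the Curl bound \<open>B\<close>, the divergence bound \<open>G\<close> and the cutoff bound
  \<open>P\<close>. The factor 2 pays for absorbing half of the energy.\<close>

lemma energy_pointwise:
  fixes a :: "'n::finite \<Rightarrow> 'n \<Rightarrow> real" and v q :: "'n \<Rightarrow> real"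
  assumes v: "\<And>k. \<bar>v k\<bar> \<le> 1" and p: "\<bar>p\<bar> \<le> P" and q: "\<And>j. \<bar>q j\<bar> \<le> P"
    and c: "\<And>j k. \<bar>a j k - a k j\<bar> \<le> B" and d: "\<bar>\<Sum>k\<in>UNIV. a k k\<bar> \<le> G"
  shows "p\<^sup>2 * (\<Sum>j\<in>UNIV. \<Sum>k\<in>UNIV. (a j k)\<^sup>2) \<le>
    2 * (\<Sum>j\<in>UNIV. \<Sum>k\<in>UNIV. p\<^sup>2 * (a j k * a k j - a k k * a j j) +
      2 * p * q j * (v k * a k j) - 2 * p * q k * (v k * a j j)) +
    2 * (\<Sum>j::'n\<in>UNIV. \<Sum>k::'n\<in>UNIV. P\<^sup>2 * B\<^sup>2 / 2 + 2 * P\<^sup>2 + P\<^sup>2 * G\<^sup>2 + 2 * P\<^sup>2 * G)"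
proof -
  define S where "S f = (\<Sum>j::'n\<in>UNIV. \<Sum>k::'n\<in>UNIV. (f j k :: real))" for f
  have S_add: "S (\<lambda>j k. f j k + g j k) = S f + S g" for f g
    by (simp add: S_def sum.distrib)
  have S_diff: "S (\<lambda>j k. f j k - g j k) = S f - S g" for f g
    by (simp add: S_def sum_subtractf)
  have S_mult: "S (\<lambda>j k. x * f j k) = x * S f" for f x
    by (simp add: S_def sum_distrib_left)
  have S_mono: "S f \<le> S g" if "\<And>j k. f j k \<le> g j k" for f g
    unfolding S_def by (intro sum_mono that)
  have S_swap: "S (\<lambda>j k. f k j) = S f" for f
    unfolding S_def by (rule sum.swap)
  have S_const: "S (\<lambda>j k. x) = real CARD('n) * (real CARD('n) * x)" for x
    by (simp add: S_def)
  define d' where "d' = (\<Sum>k\<in>UNIV. a k k)"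
  have P0: "0 \<le> P" using p by linarith
  have G0: "0 \<le> G" using d by linarith
  have p2: "p\<^sup>2 \<le> P\<^sup>2" using p by (metis abs_ge_zero power2_abs power_mono)
  have n1: "1 \<le> real CARD('n)" by (simp add: Suc_le_eq)
  have le_S_const: "x \<le> S (\<lambda>j k. x)" if "0 \<le> x" for x
  proof -
    have "1 * (1 * x) \<le> real CARD('n) * (real CARD('n) * x)"
      using that n1 by (intro mult_mono mult_right_mono) auto
    then show ?thesis by (simp only: S_const mult_1)
  qed
  define E where "E = S (\<lambda>j k. p\<^sup>2 * (a j k)\<^sup>2)"
  define X where "X = S (\<lambda>j k. p\<^sup>2 * (a j k * a k j))"
  define Y where "Y = S (\<lambda>j k. p\<^sup>2 * (a k k * a j j))"
  define Z where "Z = S (\<lambda>j k. 2 * p * q j * (v k * a k j))"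
  define W where "W = S (\<lambda>j k. 2 * p * q k * (v k * a j j))"
  have "2 * E \<le> 2 * X + S (\<lambda>j k. P\<^sup>2 * B\<^sup>2)"
  proof -
    have "S (\<lambda>j k. p\<^sup>2 * (a j k)\<^sup>2 + p\<^sup>2 * (a k j)\<^sup>2) \<le> S (\<lambda>j k. 2 * (p\<^sup>2 * (a j k * a k j)) + P\<^sup>2 * B\<^sup>2)"
    proof (rule S_mono)
      fix j k
      have "(a j k - a k j)\<^sup>2 \<le> B\<^sup>2"
        using c[of j k] by (metis abs_ge_zero power2_abs power_mono)
      then have "p\<^sup>2 * (a j k - a k j)\<^sup>2 \<le> P\<^sup>2 * B\<^sup>2"
        using p2 by (intro mult_mono) auto
      then show "p\<^sup>2 * (a j k)\<^sup>2 + p\<^sup>2 * (a k j)\<^sup>2 \<le> 2 * (p\<^sup>2 * (a j k * a k j)) + P\<^sup>2 * B\<^sup>2"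
        by (simp add: power2_diff algebra_simps)
    qed
    moreover have "S (\<lambda>j k. p\<^sup>2 * (a k j)\<^sup>2) = E"
      unfolding E_def by (rule S_swap)
    ultimately show ?thesis
      by (simp add: S_add S_mult[of 2] E_def[symmetric] X_def[symmetric])
  qed
  \<comment> \<open>Young's inequality: the cutoff term \<open>Z\<close> contains full derivatives,
    so one of the two copies of \<open>E\<close> from the preceding estimate is spent on it.\<close>
  moreover have "- (E + S (\<lambda>j k. 4 * P\<^sup>2)) \<le> 2 * Z"
  proof -
    have le: "S (\<lambda>j k. - 1 * (p\<^sup>2 * (a k j)\<^sup>2 + 4 * P\<^sup>2)) \<le> S (\<lambda>j k. 2 * (2 * p * q j * (v k * a k j)))"
    proof (rule S_mono)
      fix j k
      have "0 \<le> (p * a k j + 2 * (q j * v k))\<^sup>2" by simp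
      then have 1: "- (p\<^sup>2 * (a k j)\<^sup>2 + 4 * ((q j)\<^sup>2 * (v k)\<^sup>2)) \<le> 2 * (2 * p * q j * (v k * a k j))"
        by (simp add: power2_sum power_mult_distrib algebra_simps)
      have 2: "(q j)\<^sup>2 * (v k)\<^sup>2 \<le> P\<^sup>2 * 1"
      proof (rule mult_mono)
        show "(q j)\<^sup>2 \<le> P\<^sup>2" using q[of j] by (metis abs_ge_zero power2_abs power_mono)
        show "(v k)\<^sup>2 \<le> 1" using v[of k] by (simp add: abs_square_le_1)
      qed auto
      show "- 1 * (p\<^sup>2 * (a k j)\<^sup>2 + 4 * P\<^sup>2) \<le> 2 * (2 * p * q j * (v k * a k j))"
        by (rule order_trans[OF _ 1]) (use 2 in simp)
    qed
    have E: "S (\<lambda>j k. p\<^sup>2 * (a k j)\<^sup>2) = E"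
      unfolding E_def by (rule S_swap)
    show ?thesis
      using le[unfolded S_mult[of "- 1"] S_add S_mult[of 2] E, folded Z_def] by simp
  qed
  \<comment> \<open>Summed over both indices, \<open>a k k * a j j\<close> is the square of the
    divergence.\<close>
  moreover have "Y \<le> S (\<lambda>j k. P\<^sup>2 * G\<^sup>2)"
  proof -
    have "d'\<^sup>2 \<le> G\<^sup>2" using d unfolding d'_def by (metis abs_ge_zero power2_abs power_mono)
    then have "p\<^sup>2 * d'\<^sup>2 \<le> P\<^sup>2 * G\<^sup>2"
      using p2 by (intro mult_mono) auto
    also have "\<dots> \<le> S (\<lambda>j k. P\<^sup>2 * G\<^sup>2)" by (rule le_S_const) simp
    also have "p\<^sup>2 * d'\<^sup>2 = Y"
      unfolding Y_def S_mult unfolding S_def d'_def by (simp add: power2_eq_square sum_product mult.commute)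
    finally show ?thesis .
  qed
  \<comment> \<open>Summing over \<open>j\<close> first leaves only the divergence, so this cutoff
    term needs no absorption.\<close>
  moreover have "W \<le> S (\<lambda>j k. 2 * P\<^sup>2 * G)"
  proof -
    have 1: "2 * p * q k * v k * d' \<le> 2 * P\<^sup>2 * G" for k
    proof -
      have "\<bar>p\<bar> * \<bar>q k\<bar> * \<bar>v k\<bar> * \<bar>d'\<bar> \<le> P * P * 1 * G"
        using p q[of k] v[of k] d P0 unfolding d'_def by (intro mult_mono mult_nonneg_nonneg) auto
      then have "\<bar>p * q k * v k * d'\<bar> \<le> P\<^sup>2 * G"
        by (simp add: abs_mult power2_eq_square)
      then show ?thesis by (simp add: abs_le_iff mult.assoc)
    qed
    have "W = (\<Sum>k\<in>UNIV. 2 * p * q k * v k * d')"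
      unfolding W_def S_def d'_def by (subst sum.swap) (simp add: sum_distrib_left mult.assoc)
    also have "\<dots> \<le> (\<Sum>k::'n\<in>UNIV. 2 * P\<^sup>2 * G)"
      by (intro sum_mono 1)
    also have "\<dots> = 1 * (real CARD('n) * (2 * P\<^sup>2 * G))" by simp
    also have "\<dots> \<le> real CARD('n) * (real CARD('n) * (2 * P\<^sup>2 * G))"
      using G0 by (intro mult_right_mono n1 mult_nonneg_nonneg) auto
    also have "\<dots> = S (\<lambda>j k. 2 * P\<^sup>2 * G)" by (simp only: S_const)
    finally show ?thesis .
  qed
  moreover have "S (\<lambda>j k. p\<^sup>2 * (a j k * a k j - a k k * a j j) +
      2 * p * q j * (v k * a k j) - 2 * p * q k * (v k * a j j)) = X - Y + Z - W"
    by (simp only: X_def Y_def Z_def W_def S_add S_diff right_diff_distrib)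
  moreover have "p\<^sup>2 * S (\<lambda>j k. (a j k)\<^sup>2) = E"
    by (simp only: E_def S_mult)
  moreover have "2 * S (\<lambda>j k. P\<^sup>2 * B\<^sup>2 / 2 + 2 * P\<^sup>2 + P\<^sup>2 * G\<^sup>2 + 2 * P\<^sup>2 * G) =
      S (\<lambda>j k. P\<^sup>2 * B\<^sup>2) + S (\<lambda>j k. 4 * P\<^sup>2) + 2 * S (\<lambda>j k. P\<^sup>2 * G\<^sup>2) + 2 * S (\<lambda>j k. 2 * P\<^sup>2 * G)"
    unfolding S_const by (simp add: field_simps)
  ultimately have "p\<^sup>2 * S (\<lambda>j k. (a j k)\<^sup>2) \<le>
    2 * S (\<lambda>j k. p\<^sup>2 * (a j k * a k j - a k k * a j j) +
      2 * p * q j * (v k * a k j) - 2 * p * q k * (v k * a j j)) +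
    2 * S (\<lambda>j k. P\<^sup>2 * B\<^sup>2 / 2 + 2 * P\<^sup>2 + P\<^sup>2 * G\<^sup>2 + 2 * P\<^sup>2 * G)"
    by linarith
  then show ?thesis unfolding S_def .
qed

section \<open>Passage to the limit in approximations of a rotation field\<close>

lemma bounded_borel_divergence_of_curl [intro!]:
  fixes A :: "real^'n \<Rightarrow> real^'n^'n" and g :: "real^'n \<Rightarrow> real^'n^'n^'n"
  assumes "\<And>m k. bounded_borel (\<lambda>x. A x $ m $ k)" "\<And>m j k. bounded_borel (\<lambda>x. g x $ m $ j $ k)"
  shows "bounded_borel (\<lambda>x. divergence_of_curl (A x) (g x) m)"
  unfolding divergence_of_curl_def divide_inverse
  by (intro bounded_borel_sum bounded_borel_mult bounded_borel_det bounded_borel_replace_row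
      bounded_borel_const assms)

lemma tendsto_divergence_of_curl:
  assumes A: "\<And>m k. ((\<lambda>i. A i $ m $ k) \<longlongrightarrow> A' $ m $ k) G"
    and g: "\<And>m j k. ((\<lambda>i. g i $ m $ j $ k) \<longlongrightarrow> g' $ m $ j $ k) G"
  shows "((\<lambda>i. divergence_of_curl (A i) (g i) m) \<longlongrightarrow> divergence_of_curl A' g' m) G"
proof -
  have *: "((\<lambda>i. replace_row (replace_row (A i) m r) p s $ j $ k) \<longlongrightarrow> replace_row (replace_row A' m r) p s $ j $ k) G"
    for r s p j k
    using A by (auto simp: replace_row_nth)
  show ?thesis
    unfolding divergence_of_curl_def
  proof (intro tendsto_sum tendsto_mult)
    fix i k l
    show "((\<lambda>x. g x $ i $ k $ l / 2) \<longlongrightarrow> g' $ i $ k $ l / 2) G"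
      by (rule tendsto_divide[OF g tendsto_const]) simp
    show "((\<lambda>x. det (replace_row (replace_row (A x) m (axis k 1)) i (axis l 1))) \<longlongrightarrow>
        det (replace_row (replace_row A' m (axis k 1)) i (axis l 1))) G"
      by (rule tendsto_det) (rule *)
  qed
qed

lemma abs_divergence_of_curl_le:
  fixes A :: "real^'n^'n"
  assumes A: "\<And>m k. \<bar>A $ m $ k\<bar> \<le> 1" and g: "\<And>m j k. \<bar>g $ m $ j $ k\<bar> \<le> B"
  shows "\<bar>divergence_of_curl A g m\<bar> \<le>
    (\<Sum>i\<in>UNIV - {m}. \<Sum>k::'n\<in>UNIV. \<Sum>l::'n\<in>UNIV. B / 2 * real (fact CARD('n)))"
  unfolding divergence_of_curl_def
proof (intro order_trans[OF sum_abs] sum_mono)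
  fix i k l :: 'n
  have "\<bar>det (replace_row (replace_row A m (axis k 1)) i (axis l 1))\<bar> \<le> real (fact CARD('n))"
    using A by (intro abs_det_le_fact) (auto simp: replace_row_nth axis_def)
  then have "\<bar>g $ i $ k $ l\<bar> / 2 * \<bar>det (replace_row (replace_row A m (axis k 1)) i (axis l 1))\<bar> \<le>
      B / 2 * real (fact CARD('n))"
    using g[of i k l] by (intro mult_mono) auto
  then show "\<bar>g $ i $ k $ l / 2 * det (replace_row (replace_row A m (axis k 1)) i (axis l 1))\<bar> \<le>
      B / 2 * real (fact CARD('n))"
    by (simp add: abs_mult)
qed

lemma bounded_borel_grad_of_curl [intro!]:
  fixes A :: "real^'n \<Rightarrow> real^'n^'n" and g :: "real^'n \<Rightarrow> real^'n^'n^'n"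
  assumes "\<And>m k. bounded_borel (\<lambda>x. A x $ m $ k)" "\<And>m j k. bounded_borel (\<lambda>x. g x $ m $ j $ k)"
  shows "bounded_borel (\<lambda>x. grad_of_curl (A x) (g x) j m k)"
  unfolding grad_of_curl_def curl_frame_def divide_inverse
  by (intro bounded_borel_sum bounded_borel_mult bounded_borel_add bounded_borel_diff
      bounded_borel_const assms)

lemma tendsto_grad_of_curl:
  assumes A: "\<And>m k. ((\<lambda>i. A i $ m $ k) \<longlongrightarrow> A' $ m $ k) G"
    and g: "\<And>m j k. ((\<lambda>i. g i $ m $ j $ k) \<longlongrightarrow> g' $ m $ j $ k) G"
  shows "((\<lambda>i. grad_of_curl (A i) (g i) j m k) \<longlongrightarrow> grad_of_curl A' g' j m k) G"
  unfolding grad_of_curl_def curl_frame_def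
  by (intro tendsto_sum tendsto_mult tendsto_divide tendsto_add tendsto_diff tendsto_const A g) simp

lemma abs_half_alternating_le:
  fixes x y z C :: real
  assumes "\<bar>x\<bar> \<le> C" "\<bar>y\<bar> \<le> C" "\<bar>z\<bar> \<le> C"
  shows "\<bar>(x - y + z) / 2\<bar> \<le> 3 * C"
proof -
  have "\<bar>x - y + z\<bar> \<le> 3 * C" using assms by linarith
  then show ?thesis by simp
qed

lemma abs_grad_of_curl_le:
  fixes A :: "real^'n^'n"
  assumes A: "\<And>m k. \<bar>A $ m $ k\<bar> \<le> 1" and g: "\<And>m j k. \<bar>g $ m $ j $ k\<bar> \<le> B"
  shows "\<bar>grad_of_curl A g j m k\<bar> \<le>
    (\<Sum>l::'n\<in>UNIV. \<Sum>p::'n\<in>UNIV. 3 * (\<Sum>j::'n\<in>UNIV. \<Sum>k::'n\<in>UNIV. B))"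
proof -
  define C where "C = (\<Sum>j::'n\<in>UNIV. \<Sum>k::'n\<in>UNIV. B)"
  have B0: "0 \<le> B" using g[of undefined undefined undefined] by linarith
  have C0: "0 \<le> C" unfolding C_def using B0 by (intro sum_nonneg)
  have c: "\<bar>curl_frame A g m l p\<bar> \<le> C" for m l p
    unfolding curl_frame_def C_def
  proof (intro order_trans[OF sum_abs] sum_mono)
    fix j k
    have "\<bar>g $ m $ j $ k\<bar> * \<bar>A $ l $ k\<bar> * \<bar>A $ p $ j\<bar> \<le> B * 1 * 1"
      using A g B0 by (intro mult_mono) auto
    then show "\<bar>g $ m $ j $ k * A $ l $ k * A $ p $ j\<bar> \<le> B" by (simp add: abs_mult)
  qed
  show ?thesis
    unfolding grad_of_curl_def C_def[symmetric]
  proof (intro order_trans[OF sum_abs] sum_mono)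
    fix l p
    have "\<bar>(curl_frame A g m l p - curl_frame A g p m l + curl_frame A g l p m) / 2\<bar> \<le> 3 * C"
      by (rule abs_half_alternating_le) (rule c)+
    then have "\<bar>(curl_frame A g m l p - curl_frame A g p m l + curl_frame A g l p m) / 2\<bar> *
        \<bar>A $ l $ k\<bar> * \<bar>A $ p $ j\<bar> \<le> (3 * C) * 1 * 1"
      using A C0 by (intro mult_mono) auto
    then show "\<bar>(curl_frame A g m l p - curl_frame A g p m l + curl_frame A g l p m) / 2 *
        A $ l $ k * A $ p $ j\<bar> \<le> 3 * C"
      by (simp only: abs_mult mult_1_right)
  qed
qed

text \<open>Turns almost everywhere convergence of bounded functions into strong L2 convergence, the
  counterpart to gradients that are merely bounded in L2.\<close>

lemma L2_tendsto_0:
  fixes w :: "nat \<Rightarrow> 'a::euclidean_space \<Rightarrow> real"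
  assumes S: "S \<in> sets borel" "bounded S"
    and w: "\<And>i. bounded_borel (w i)" and v: "bounded_borel v"
    and le: "\<And>i x. \<bar>w i x\<bar> \<le> 1" "\<And>x. \<bar>v x\<bar> \<le> 1"
    and lim: "AE x in lborel. x \<in> S \<longrightarrow> (\<lambda>i. w i x) \<longlonglongrightarrow> v x"
  shows "(\<lambda>i. LBINT x. indicator S x * (v x - w i x)\<^sup>2) \<longlonglongrightarrow> 0"
proof -
  have "(\<lambda>i. LBINT x. indicator S x * (v x - w i x)\<^sup>2) \<longlonglongrightarrow> (LBINT x. indicator S x * 0)"
  proof (rule dominated_convergence_supp[OF bounded_supp_indicator[OF S]])
    show "bounded_borel (\<lambda>x. (v x - w i x)\<^sup>2)" for i
      by (intro bounded_borel_power bounded_borel_diff v w)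
    show "\<bar>(v x - w i x)\<^sup>2\<bar> \<le> 2\<^sup>2" for i x
    proof -
      have "\<bar>v x - w i x\<bar> \<le> 2" using le(1)[of i x] le(2)[of x] by linarith
      then show ?thesis by (metis abs_ge_zero abs_power2 power2_abs power_mono)
    qed
    show "AE x in lborel. indicator S x \<noteq> (0::real) \<longrightarrow> (\<lambda>i. (v x - w i x)\<^sup>2) \<longlonglongrightarrow> 0"
      using lim
    proof eventually_elim
      case (elim x)
      have "(\<lambda>i. (v x - w i x)\<^sup>2) \<longlonglongrightarrow> (v x - v x)\<^sup>2" if "x \<in> S"
        using elim that by (intro tendsto_power tendsto_diff tendsto_const) auto
      then show ?case by (auto simp: indicator_def split: if_splits)
    qed
  qed auto
  then show ?thesis by simp
qed

text \<open>\<open>F i\<close> models mollifications of \<open>R\<close>, with \<open>DF\<close> and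
  \<open>DDF\<close> their first and second derivatives and \<open>g i\<close> the mollified Curl.
  The \<open>F i\<close> have entries bounded by 1 but are not assumed to be rotations. For each
  \<open>i\<close> the derivatives are bounded, yet the only bound on derivative data that is
  uniform in \<open>i\<close> is the bound \<open>B\<close> on the Curl.\<close>

locale rotation_approximation =
  fixes \<phi> :: "real^'n \<Rightarrow> real" and d\<phi> :: "'n \<Rightarrow> real^'n \<Rightarrow> real" and S :: "(real^'n) set"
    and R :: "real^'n \<Rightarrow> real^'n^'n" and f :: "real^'n \<Rightarrow> real^'n^'n^'n"
    and F :: "nat \<Rightarrow> real^'n \<Rightarrow> real^'n^'n" and DF :: "nat \<Rightarrow> 'n \<Rightarrow> real^'n \<Rightarrow> real^'n^'n"
    and DDF :: "nat \<Rightarrow> 'n \<Rightarrow> 'n \<Rightarrow> real^'n \<Rightarrow> real^'n^'n"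
    and g :: "nat \<Rightarrow> real^'n \<Rightarrow> real^'n^'n^'n" and B :: real
  assumes S: "S \<in> sets borel" "bounded S"
    and \<phi>: "bounded_supp \<phi>" "\<And>j. bounded_supp (d\<phi> j)" "\<And>j x. has_partial \<phi> j (d\<phi> j x) x"
    and \<phi>_0: "\<And>x. x \<notin> S \<Longrightarrow> \<phi> x = 0" "\<And>j x. x \<notin> S \<Longrightarrow> d\<phi> j x = 0"
    and R: "\<And>x. R x \<in> SO" "\<And>m k. bounded_borel (\<lambda>x. R x $ m $ k)"
    and f: "\<And>m j k. bounded_borel (\<lambda>x. f x $ m $ j $ k)"
    and F: "\<And>i m k. bounded_borel (\<lambda>x. F i x $ m $ k)" "\<And>i x m k. \<bar>F i x $ m $ k\<bar> \<le> 1"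
    and DF: "\<And>i j m k. bounded_borel (\<lambda>x. DF i j x $ m $ k)"
      "\<And>i j m k x. has_partial (\<lambda>x. F i x $ m $ k) j (DF i j x $ m $ k) x"
    and DDF: "\<And>i j l m k. bounded_borel (\<lambda>x. DDF i j l x $ m $ k)"
      "\<And>i j l m k x. has_partial (\<lambda>x. DF i j x $ m $ k) l (DDF i j l x $ m $ k) x"
      "\<And>i j l x. DDF i j l x = DDF i l j x"
    and F_tendsto: "AE x in lborel. x \<in> S \<longrightarrow> (\<forall>m k. (\<lambda>i. F i x $ m $ k) \<longlonglongrightarrow> R x $ m $ k)"
    and curl: "\<And>i m j k x. x \<in> S \<Longrightarrow> DF i j x $ m $ k - DF i k x $ m $ j = g i x $ m $ j $ k"
    and g: "\<And>i m j k. bounded_borel (\<lambda>x. g i x $ m $ j $ k)" "\<And>i m j k x. \<bar>g i x $ m $ j $ k\<bar> \<le> B"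
      "\<And>m j k x. x \<in> S \<Longrightarrow> (\<lambda>i. g i x $ m $ j $ k) \<longlonglongrightarrow> f x $ m $ j $ k"
begin

text \<open>The cofactor rows of \<open>F i\<close> can be differentiated classically, and their
  divergence is a polynomial in \<open>F i\<close> and \<open>g i\<close>. Both sides therefore
  converge without any bound on \<open>DF\<close>. Only in the limit are the cofactors entries of
  the matrix itself, by \<open>SO_cofactor\<close>.\<close>

lemma divergence_eq:
  "(LBINT x. \<phi> x * divergence_of_curl (R x) (f x) m) = - (\<Sum>k\<in>UNIV. LBINT x. d\<phi> k x * R x $ m $ k)"
proof -
  define cof where "cof i k x = det (replace_row (F i x) m (axis k 1))" for i k x
  define dcof where "dcof i k x = (\<Sum>p\<in>UNIV. det (replace_row (replace_row (F i x) m (axis k 1)) p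
    (replace_row (DF i k x) m 0 $ p)))" for i k x
  have cof: "bounded_borel (cof i k)" for i k
    unfolding cof_def[abs_def]
    by (intro bounded_borel_det bounded_borel_replace_row F bounded_borel_const)
  have dcof: "bounded_borel (dcof i k)" for i k
    unfolding dcof_def[abs_def]
    by (intro bounded_borel_sum bounded_borel_det bounded_borel_replace_row F DF bounded_borel_const)
  have D: "has_partial (cof i k) k (dcof i k x) x" for i k x
    unfolding cof_def[abs_def] dcof_def replace_row_def[of "replace_row _ _ _"]
    by (rule has_partial_det) (rule has_partial_replace_row, rule DF)
  have part: "(LBINT x. \<phi> x * dcof i k x) = - (LBINT x. d\<phi> k x * cof i k x)" for i k
    by (rule integral_by_parts[OF \<phi>(1,2,3) cof dcof D])
  have sum_dcof: "(\<Sum>k\<in>UNIV. dcof i k x) = divergence_of_curl (F i x) (g i x) m" if "x \<in> S" for i x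
    unfolding dcof_def divergence_cofactor divergence_of_curl_def by (simp add: curl[OF that])
  have eq: "(LBINT x. \<phi> x * divergence_of_curl (F i x) (g i x) m) =
      - (\<Sum>k\<in>UNIV. LBINT x. d\<phi> k x * cof i k x)" for i
  proof -
    have "(LBINT x. \<phi> x * divergence_of_curl (F i x) (g i x) m) = (LBINT x. (\<Sum>k\<in>UNIV. \<phi> x * dcof i k x))"
    proof (rule Bochner_Integration.integral_cong[OF refl])
      fix x show "\<phi> x * divergence_of_curl (F i x) (g i x) m = (\<Sum>k\<in>UNIV. \<phi> x * dcof i k x)"
        using sum_dcof[of x i] \<phi>_0(1)[of x] by (cases "x \<in> S") (auto simp flip: sum_distrib_left)
    qed
    also have "\<dots> = (\<Sum>k\<in>UNIV. LBINT x. \<phi> x * dcof i k x)"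
      by (intro Bochner_Integration.integral_sum bounded_supp_integrable bounded_supp_mult(1) \<phi> dcof)
    finally show ?thesis by (simp add: part sum_negf)
  qed
  have "(\<lambda>i. LBINT x. \<phi> x * divergence_of_curl (F i x) (g i x) m) \<longlonglongrightarrow>
      (LBINT x. \<phi> x * divergence_of_curl (R x) (f x) m)"
  proof (rule dominated_convergence_supp[OF \<phi>(1)])
    show "bounded_borel (\<lambda>x. divergence_of_curl (F i x) (g i x) m)" for i
      by (intro bounded_borel_divergence_of_curl F g)
    show "bounded_borel (\<lambda>x. divergence_of_curl (R x) (f x) m)"
      by (intro bounded_borel_divergence_of_curl R f)
    show "\<bar>divergence_of_curl (F i x) (g i x) m\<bar> \<le>
      (\<Sum>i\<in>UNIV - {m}. \<Sum>k::'n\<in>UNIV. \<Sum>l::'n\<in>UNIV. B / 2 * real (fact CARD('n)))" for i x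
      by (intro abs_divergence_of_curl_le F g)
    show "AE x in lborel. \<phi> x \<noteq> 0 \<longrightarrow> (\<lambda>i. divergence_of_curl (F i x) (g i x) m) \<longlonglongrightarrow> divergence_of_curl (R x) (f x) m"
      using F_tendsto
    proof eventually_elim
      case (elim x)
      then show ?case
        using \<phi>_0(1)[of x] g(3)[of x] by (intro impI tendsto_divergence_of_curl) auto
    qed
  qed
  moreover have "(\<lambda>i. - (\<Sum>k\<in>UNIV. LBINT x. d\<phi> k x * cof i k x)) \<longlonglongrightarrow>
      - (\<Sum>k\<in>UNIV. LBINT x. d\<phi> k x * R x $ m $ k)"
  proof (intro tendsto_minus tendsto_sum)
    fix k
    show "(\<lambda>i. LBINT x. d\<phi> k x * cof i k x) \<longlonglongrightarrow> (LBINT x. d\<phi> k x * R x $ m $ k)"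
    proof (rule dominated_convergence_supp[OF \<phi>(2) cof R(2)])
      show "\<bar>cof i k x\<bar> \<le> real (fact CARD('n))" for i x
        unfolding cof_def using F(2) by (intro abs_det_le_fact) (auto simp: replace_row_nth axis_def)
      show "AE x in lborel. d\<phi> k x \<noteq> 0 \<longrightarrow> (\<lambda>i. cof i k x) \<longlonglongrightarrow> R x $ m $ k"
        using F_tendsto
      proof eventually_elim
        case (elim x)
        show ?case
        proof
          assume "d\<phi> k x \<noteq> 0"
          then have "x \<in> S" using \<phi>_0(2) by blast
          then have "(\<lambda>i. cof i k x) \<longlonglongrightarrow> det (replace_row (R x) m (axis k 1))"
            unfolding cof_def using elim by (intro tendsto_det) (auto simp: replace_row_nth)
          then show "(\<lambda>i. cof i k x) \<longlonglongrightarrow> R x $ m $ k"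
            by (simp add: SO_cofactor R(1))
        qed
      qed
    qed
  qed
  ultimately show ?thesis
    unfolding eq by (rule LIMSEQ_unique)
qed

text \<open>For each row, \<open>energy_pointwise\<close> is integrated; its null terms drop out
  after integration by parts, leaving constants times the measure of \<open>S\<close>, independent
  of \<open>i\<close>.\<close>

lemma energy_bound:
  assumes div: "\<And>i m x. x \<in> S \<Longrightarrow> \<bar>\<Sum>k\<in>UNIV. DF i k x $ m $ k\<bar> \<le> G"
  shows "\<exists>K. \<forall>i j m k. (LBINT x. (\<phi> x * DF i j x $ m $ k)\<^sup>2) \<le> K"
proof -
  have "bounded_borel \<phi>" "\<And>j. bounded_borel (d\<phi> j)"
    using \<phi> by (auto intro: bounded_supp_borel)
  then obtain P0 P1 where P0: "\<And>x. \<bar>\<phi> x\<bar> \<le> P0" and P1: "\<And>j x. \<bar>d\<phi> j x\<bar> \<le> P1 j"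
    unfolding bounded_borel_def by metis
  define P where "P = P0 + (\<Sum>j\<in>UNIV. \<bar>P1 j\<bar>)"
  have P: "\<bar>\<phi> x\<bar> \<le> P" "\<bar>d\<phi> j x\<bar> \<le> P" for x j
  proof -
    have "0 \<le> (\<Sum>j\<in>UNIV. \<bar>P1 j\<bar>)" by (intro sum_nonneg) auto
    then show "\<bar>\<phi> x\<bar> \<le> P" using P0[of x] unfolding P_def by linarith
    have "\<bar>P1 j\<bar> \<le> (\<Sum>j\<in>UNIV. \<bar>P1 j\<bar>)" by (intro member_le_sum) auto
    then show "\<bar>d\<phi> j x\<bar> \<le> P" using P1[of j x] P0[of x] unfolding P_def by linarith
  qed
  define C where "C = (\<Sum>j::'n\<in>UNIV. \<Sum>k::'n\<in>UNIV. P\<^sup>2 * B\<^sup>2 / 2 + 2 * P\<^sup>2 + P\<^sup>2 * G\<^sup>2 + 2 * P\<^sup>2 * G)"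
  have IS: "bounded_supp (indicator S :: real^'n \<Rightarrow> real)"
    using S by (rule bounded_supp_indicator)
  have main: "(LBINT x. (\<phi> x * DF i j x $ m $ k)\<^sup>2) \<le> 2 * C * (LBINT x. indicator S x)" for i j m k
  proof -
    define a where "a j k x = DF i j x $ m $ k" for j k x
    define v where "v k x = F i x $ m $ k" for k x
    define b where "b j k x = DDF i j k x $ m $ j" for j k x
    have ba: "bounded_borel (a j k)" "bounded_borel (v k)" "bounded_borel (b j k)" for j k
      using F DF DDF by (auto simp: a_def[abs_def] v_def[abs_def] b_def[abs_def])
    let ?I = "\<lambda>j k x. (\<phi> x)\<^sup>2 * (a j k x * a k j x - a k k x * a j j x) +
      2 * \<phi> x * d\<phi> j x * (v k x * a k j x) - 2 * \<phi> x * d\<phi> k x * (v k x * a j j x)"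
    have s1: "bounded_supp (\<lambda>x. \<phi> x * \<phi> x)" "bounded_supp (\<lambda>x. d\<phi> j x * \<phi> x + \<phi> x * d\<phi> j x)" for j
      by (intro bounded_supp_add bounded_supp_mult(1) \<phi> bounded_supp_borel)+
    have IBP: "(LBINT x. (\<phi> x * \<phi> x) * w' x) = - (LBINT x. (d\<phi> j x * \<phi> x + \<phi> x * d\<phi> j x) * w x)"
      if "bounded_borel w" "bounded_borel w'" "\<And>x. has_partial w j (w' x) x" for j w w'
      by (rule integral_by_parts[OF s1 has_partial_mult[OF \<phi>(3) \<phi>(3)] that])
    \<comment> \<open>\<open>?I j k\<close> is the j-th derivative of
      \<open>\<phi>^2 * v k * a k j\<close> minus the k-th derivative of
      \<open>\<phi>^2 * v k * a j j\<close>; the second derivatives cancel by their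
      symmetry.\<close>
    have I0: "(LBINT x. ?I j k x) = 0" "bounded_supp (?I j k)" for j k
    proof -
      let ?w1 = "\<lambda>x. v k x * a k j x" and ?w2 = "\<lambda>x. v k x * a j j x"
      let ?d1 = "\<lambda>x. a j k x * a k j x + v k x * (DDF i k j x $ m $ j)"
      let ?d2 = "\<lambda>x. a k k x * a j j x + v k x * (DDF i j k x $ m $ j)"
      let ?dd = "\<lambda>j x. d\<phi> j x * \<phi> x + \<phi> x * d\<phi> j x"
      have w: "bounded_borel ?w1" "bounded_borel ?w2" "bounded_borel ?d1" "bounded_borel ?d2"
        using ba DDF by auto
      have 1: "(LBINT x. (\<phi> x * \<phi> x) * ?d1 x) = - (LBINT x. ?dd j x * ?w1 x)"
        unfolding a_def v_def by (rule IBP[OF w(1,3)[unfolded a_def v_def]]) (intro has_partial_mult DF DDF)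
      have 2: "(LBINT x. (\<phi> x * \<phi> x) * ?d2 x) = - (LBINT x. ?dd k x * ?w2 x)"
        unfolding a_def v_def by (rule IBP[OF w(2,4)[unfolded a_def v_def]]) (intro has_partial_mult DF DDF)
      have eq: "?I j k = (\<lambda>x. (\<phi> x * \<phi> x) * ?d1 x - (\<phi> x * \<phi> x) * ?d2 x + ?dd j x * ?w1 x - ?dd k x * ?w2 x)"
        using DDF(3)[of i j k] by (auto simp: fun_eq_iff power2_eq_square algebra_simps)
      have s: "bounded_supp (\<lambda>x. (\<phi> x * \<phi> x) * ?d1 x)" "bounded_supp (\<lambda>x. (\<phi> x * \<phi> x) * ?d2 x)"
        "bounded_supp (\<lambda>x. ?dd j x * ?w1 x)" "bounded_supp (\<lambda>x. ?dd k x * ?w2 x)"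
        by (intro bounded_supp_mult(1)[OF s1(1)] bounded_supp_mult(1)[OF s1(2)] w)+
      show "bounded_supp (?I j k)"
        unfolding eq by (intro bounded_supp_add bounded_supp_diff s)
      note si = s[THEN bounded_supp_integrable]
      have "(LBINT x. ?I j k x) = (LBINT x. (\<phi> x * \<phi> x) * ?d1 x) - (LBINT x. (\<phi> x * \<phi> x) * ?d2 x) +
          (LBINT x. ?dd j x * ?w1 x) - (LBINT x. ?dd k x * ?w2 x)"
        unfolding eq using si
        by (simp only: Bochner_Integration.integral_diff Bochner_Integration.integral_add
            Bochner_Integration.integrable_diff Bochner_Integration.integrable_add)
      then show "(LBINT x. ?I j k x) = 0" using 1 2 by simp
    qed
    have pw: "(\<phi> x * a j k x)\<^sup>2 \<le> 2 * (\<Sum>j\<in>UNIV. \<Sum>k\<in>UNIV. ?I j k x) + 2 * C * indicator S x" for x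
    proof (cases "x \<in> S")
      case True
      have "(a j k x)\<^sup>2 \<le> (\<Sum>k\<in>UNIV. (a j k x)\<^sup>2)"
        by (rule member_le_sum) auto
      also have "\<dots> \<le> (\<Sum>j\<in>UNIV. \<Sum>k\<in>UNIV. (a j k x)\<^sup>2)"
        by (rule member_le_sum[of j UNIV "\<lambda>j. \<Sum>k\<in>UNIV. (a j k x)\<^sup>2"]) (auto intro: sum_nonneg)
      finally have "(\<phi> x * a j k x)\<^sup>2 \<le> (\<phi> x)\<^sup>2 * (\<Sum>j\<in>UNIV. \<Sum>k\<in>UNIV. (a j k x)\<^sup>2)"
        by (simp add: power_mult_distrib mult_left_mono)
      also have "\<dots> \<le> 2 * (\<Sum>j\<in>UNIV. \<Sum>k\<in>UNIV. ?I j k x) + 2 * C"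
        unfolding C_def
      proof (rule energy_pointwise[where v = "\<lambda>k. v k x" and a = "\<lambda>j k. a j k x" and q = "\<lambda>j. d\<phi> j x"])
        show "\<bar>v k x\<bar> \<le> 1" for k using F(2) by (simp add: v_def)
        show "\<bar>a j k x - a k j x\<bar> \<le> B" for j k
          using curl[OF True, of i j m k] g(2) by (simp add: a_def)
        show "\<bar>\<Sum>k\<in>UNIV. a k k x\<bar> \<le> G" using div[OF True] by (simp add: a_def)
      qed (use P in auto)
      finally show ?thesis using True by simp
    qed (simp add: \<phi>_0)
    have sI: "bounded_supp (\<lambda>x. \<Sum>j\<in>UNIV. \<Sum>k\<in>UNIV. ?I j k x)"
      by (intro bounded_supp_sum I0(2))
    have "(LBINT x. (\<phi> x * a j k x)\<^sup>2) \<le>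
        (LBINT x. 2 * (\<Sum>j\<in>UNIV. \<Sum>k\<in>UNIV. ?I j k x) + 2 * C * indicator S x)"
    proof (rule integral_mono[OF _ _ pw])
      have s: "bounded_supp (\<lambda>x. \<phi> x * a j k x)"
        by (intro bounded_supp_mult(1) \<phi> ba)
      show "integrable lborel (\<lambda>x. (\<phi> x * a j k x)\<^sup>2)"
        unfolding power2_eq_square
        by (intro bounded_supp_integrable bounded_supp_mult(1)[OF s] bounded_supp_borel[OF s])
      show "integrable lborel (\<lambda>x. 2 * (\<Sum>j\<in>UNIV. \<Sum>k\<in>UNIV. ?I j k x) + 2 * C * indicator S x)"
        by (intro bounded_supp_integrable bounded_supp_add bounded_supp_mult(2)[OF bounded_borel_const] sI IS)
    qed
    also have "\<dots> = 2 * (LBINT x. (\<Sum>j\<in>UNIV. \<Sum>k\<in>UNIV. ?I j k x)) + 2 * C * (LBINT x. indicator S x)"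
      using bounded_supp_integrable[OF sI] bounded_supp_integrable[OF IS]
      by (subst Bochner_Integration.integral_add) auto
    also have "(LBINT x. (\<Sum>j\<in>UNIV. \<Sum>k\<in>UNIV. ?I j k x)) = (\<Sum>j\<in>UNIV. \<Sum>k\<in>UNIV. LBINT x. ?I j k x)"
      by (subst Bochner_Integration.integral_sum)
        (intro bounded_supp_integrable bounded_supp_sum I0(2) sum.cong refl Bochner_Integration.integral_sum)+
    also have "(\<Sum>j\<in>UNIV. \<Sum>k\<in>UNIV. LBINT x. ?I j k x) = 0"
      by (simp only: I0(1) sum.neutral_const)
    finally show ?thesis
      unfolding a_def mult_zero_right add_0 .
  qed
  then show ?thesis by blast
qed

text \<open>With the gradient bounded in L2 against \<open>\<phi>\<close>, a coefficient
  \<open>w\<close> only has to be small in L2 on \<open>S\<close> for the pairing to be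
  small.\<close>

lemma weak_cauchy_schwarz:
  assumes K: "(LBINT x. (\<phi> x * DF i j x $ m $ k)\<^sup>2) \<le> K" and w: "bounded_borel w"
  shows "\<bar>\<integral>x. \<phi> x * (w x * DF i j x $ m $ k) \<partial>lborel\<bar> \<le> sqrt K * sqrt (LBINT x. indicator S x * (w x)\<^sup>2)"
proof -
  have s: "bounded_supp (\<lambda>x. \<phi> x * DF i j x $ m $ k)" "bounded_supp (\<lambda>x. indicator S x * w x)"
    by (intro bounded_supp_mult(1) \<phi> DF bounded_supp_indicator S w)+
  have "(LBINT x. \<phi> x * (w x * DF i j x $ m $ k)) = (LBINT x. (\<phi> x * DF i j x $ m $ k) * (indicator S x * w x))"
    using \<phi>_0(1) by (intro Bochner_Integration.integral_cong) (auto simp: indicator_def)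
  also have "\<bar>\<dots>\<bar> \<le> sqrt (LBINT x. (\<phi> x * DF i j x $ m $ k)\<^sup>2) * sqrt (LBINT x. (indicator S x * w x)\<^sup>2)"
    by (rule cauchy_schwarz_supp[OF s])
  also have "(\<lambda>x. (indicator S x * w x)\<^sup>2) = (\<lambda>x. indicator S x * (w x)\<^sup>2)"
    by (auto simp: fun_eq_iff indicator_def)
  also have "sqrt (LBINT x. (\<phi> x * DF i j x $ m $ k)\<^sup>2) * sqrt (LBINT x. indicator S x * (w x)\<^sup>2) \<le>
      sqrt K * sqrt (LBINT x. indicator S x * (w x)\<^sup>2)"
    using K by (intro mult_right_mono real_sqrt_le_mono real_sqrt_ge_zero Bochner_Integration.integral_nonneg) auto
  finally show ?thesis .
qed

text \<open>The error terms in \<open>koszul\<close> carry three matrix entries as weights: one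
  inside \<open>sym_frame\<close> and two from the frame expansion. As a function of the matrix the
  weight can be evaluated at \<open>R\<close> and at \<open>F h\<close> alike.\<close>

definition triple :: "('n \<times> 'n) \<Rightarrow> ('n \<times> 'n) \<Rightarrow> ('n \<times> 'n) \<Rightarrow> real^'n^'n \<Rightarrow> real" where
  "triple a b c A = A $ fst a $ snd a * A $ fst b $ snd b * A $ fst c $ snd c"

lemma abs_triple_le: "(\<And>m k. \<bar>A $ m $ k\<bar> \<le> 1) \<Longrightarrow> \<bar>triple a b c A\<bar> \<le> 1"
  unfolding triple_def abs_mult by (intro mult_le_one mult_nonneg_nonneg) auto

text \<open>Approximating one of the two factors \<open>triple a b c R\<close> by the smooth \<open>triple a b c (F h)\<close>
  and integrating by parts, the limit \<open>i \<rightarrow> \<infinity>\<close> leaves the derivative of the constant \<open>R R\<^sup>T\<close>.\<close>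
lemma weak_antisymmetry:
  assumes K: "\<And>i j m k. (LBINT x. (\<phi> x * DF i j x $ m $ k)\<^sup>2) \<le> K"
  shows "(\<lambda>i. LBINT x. \<phi> x * (triple a b c (R x) *
    (\<Sum>k\<in>UNIV. DF i j x $ m $ k * R x $ l $ k + DF i j x $ l $ k * R x $ m $ k))) \<longlonglongrightarrow> 0"
proof -
  let ?IS = "indicator S :: real^'n \<Rightarrow> real"
  let ?t = "triple a b c"
  have IS: "bounded_supp ?IS" using S by (rule bounded_supp_indicator)
  have K0: "0 \<le> K"
    using K[of 0 undefined undefined undefined] by (rule order_trans[rotated]) simp
  have bt: "bounded_borel (\<lambda>x. ?t (R x))" "bounded_borel (\<lambda>x. ?t (F i x))" for i
    unfolding triple_def by (intro bounded_borel_mult R F)+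
  have R1: "\<bar>R x $ m $ k\<bar> \<le> 1" for x m k by (rule SO_entry_le_1[OF R(1)])
  define \<beta> where "\<beta> h = (LBINT x. ?IS x * (?t (R x) - ?t (F h x))\<^sup>2)" for h
  define \<gamma> where "\<gamma> i p k = (LBINT x. ?IS x * (R x $ p $ k - F i x $ p $ k)\<^sup>2)" for i p k
  have \<beta>: "\<beta> \<longlonglongrightarrow> 0"
    unfolding \<beta>_def[abs_def]
  proof (rule L2_tendsto_0[OF S bt(2) bt(1) abs_triple_le[OF F(2)] abs_triple_le[OF R1]])
    show "AE x in lborel. x \<in> S \<longrightarrow> (\<lambda>i. ?t (F i x)) \<longlonglongrightarrow> ?t (R x)"
      using F_tendsto
    proof eventually_elim
      case (elim x)
      then show ?case unfolding triple_def by (intro impI tendsto_mult) auto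
    qed
  qed
  have \<gamma>: "(\<lambda>i. \<gamma> i p k) \<longlonglongrightarrow> 0" for p k
    unfolding \<gamma>_def
  proof (rule L2_tendsto_0[OF S F(1) R(2) F(2) R1])
    show "AE x in lborel. x \<in> S \<longrightarrow> (\<lambda>i. F i x $ p $ k) \<longlonglongrightarrow> R x $ p $ k"
      using F_tendsto by eventually_elim simp
  qed
  define U where "U i = (LBINT x. \<phi> x * (?t (R x) *
    (\<Sum>k\<in>UNIV. DF i j x $ m $ k * R x $ l $ k + DF i j x $ l $ k * R x $ m $ k)))" for i
  \<comment> \<open>The weight is frozen at level \<open>h\<close> while \<open>i\<close> varies.
    For fixed \<open>h\<close> the derivative of the weight is a fixed bounded function, so after
    integration by parts only the entries of \<open>F i (F i)^T\<close> vary, and they converge to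
    constants.\<close>
  define Z where "Z h i = (LBINT x. \<phi> x * (?t (F h x) *
    (\<Sum>k\<in>UNIV. DF i j x $ m $ k * F i x $ l $ k + DF i j x $ l $ k * F i x $ m $ k)))" for h i
  define \<epsilon> where "\<epsilon> h i = (\<Sum>k\<in>UNIV. sqrt K * sqrt (2 * \<beta> h + 2 * \<gamma> i l k) + sqrt K * sqrt (2 * \<beta> h + 2 * \<gamma> i m k))" for h i
  have Z: "(\<lambda>i. Z h i) \<longlonglongrightarrow> 0" for h
  proof -
    let ?\<psi> = "\<lambda>x. \<phi> x * ?t (F h x)"
    let ?D = "\<lambda>a x. DF h j x $ fst a $ snd a" and ?V = "\<lambda>a x. F h x $ fst a $ snd a"
    define \<psi>' where "\<psi>' x = d\<phi> j x * ?t (F h x) + \<phi> x *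
      ((?D a x * ?V b x + ?V a x * ?D b x) * ?V c x + ?V a x * ?V b x * ?D c x)" for x
    have s: "bounded_supp ?\<psi>" "bounded_supp \<psi>'"
      unfolding \<psi>'_def[abs_def]
      by (intro bounded_supp_add bounded_supp_mult(1) \<phi> bt bounded_borel_add bounded_borel_mult F DF)+
    have D\<psi>: "has_partial ?\<psi> j (\<psi>' x) x" for x
      unfolding \<psi>'_def triple_def by (intro has_partial_mult \<phi> DF)
    let ?w = "\<lambda>i x. \<Sum>k\<in>UNIV. F i x $ m $ k * F i x $ l $ k"
    let ?w' = "\<lambda>i x. \<Sum>k\<in>UNIV. DF i j x $ m $ k * F i x $ l $ k + F i x $ m $ k * DF i j x $ l $ k"
    have w: "bounded_borel (?w i)" "bounded_borel (?w' i)" for i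
      by (intro bounded_borel_sum bounded_borel_add bounded_borel_mult F DF)+
    have Dw: "has_partial (?w i) j (?w' i x) x" for i x
      by (intro has_partial_sum has_partial_mult DF)
    have "Z h i = (LBINT x. ?\<psi> x * ?w' i x)" for i
      unfolding Z_def by (intro Bochner_Integration.integral_cong refl) (simp add: mult.assoc mult.commute[of "F i _ $ m $ _"])
    then have eq: "Z h i = - (LBINT x. \<psi>' x * ?w i x)" for i
      using integral_by_parts[OF s D\<psi> w Dw, of i] by simp
    have \<psi>'_0: "\<psi>' x = 0" if "x \<notin> S" for x
      using \<phi>_0 that by (simp add: \<psi>'_def)
    have "(\<lambda>i. LBINT x. \<psi>' x * ?w i x) \<longlonglongrightarrow> (LBINT x. \<psi>' x * (if m = l then 1 else 0))"
    proof (rule dominated_convergence_supp[OF s(2) w(1)])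
      show "\<bar>?w i x\<bar> \<le> (\<Sum>k::'n\<in>UNIV. 1)" for i x
      proof (intro order_trans[OF sum_abs] sum_mono)
        show "\<bar>F i x $ m $ k * F i x $ l $ k\<bar> \<le> 1" for k
          unfolding abs_mult by (intro mult_le_one F) auto
      qed
      show "AE x in lborel. \<psi>' x \<noteq> 0 \<longrightarrow> (\<lambda>i. ?w i x) \<longlonglongrightarrow> (if m = l then 1 else 0)"
        using F_tendsto
      proof eventually_elim
        case (elim x)
        have "(\<lambda>i. ?w i x) \<longlonglongrightarrow> (\<Sum>k\<in>UNIV. R x $ m $ k * R x $ l $ k)" if "x \<in> S"
          using elim that by (intro tendsto_sum tendsto_mult) auto
        then show ?case
          using \<psi>'_0[of x] by (cases "x \<in> S") (simp_all add: SO_gram(2)[OF R(1)])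
      qed
    qed auto
    moreover have "(LBINT x. \<psi>' x * (if m = l then 1 else 0)) = 0"
      using integral_partial_eq_0[OF s D\<psi>] by simp
    ultimately show ?thesis
      unfolding eq using tendsto_minus by fastforce
  qed
  have close: "\<bar>U i - Z h i\<bar> \<le> \<epsilon> h i" for h i
  proof -
    have half: "\<bar>\<integral>x. \<phi> x * ((?t (R x) * R x $ q $ k - ?t (F h x) * F i x $ q $ k) * DF i j x $ p $ k) \<partial>lborel\<bar> \<le>
        sqrt K * sqrt (2 * \<beta> h + 2 * \<gamma> i q k)" for p q k
    proof -
      let ?w = "\<lambda>x. ?t (R x) * R x $ q $ k - ?t (F h x) * F i x $ q $ k"
      have w: "bounded_borel ?w"
        by (intro bounded_borel_diff bounded_borel_mult bt R F)
      let ?x = "\<lambda>x. ?IS x * (?t (R x) - ?t (F h x))\<^sup>2" and ?y = "\<lambda>x. ?IS x * (R x $ q $ k - F i x $ q $ k)\<^sup>2"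
      have i: "integrable lborel ?x" "integrable lborel ?y"
        by (intro bounded_supp_integrable bounded_supp_mult(1)[OF IS] bounded_borel_power bounded_borel_diff bt R F)+
      have "(LBINT x. ?IS x * (?w x)\<^sup>2) \<le> (LBINT x. 2 * ?x x + 2 * ?y x)"
      proof (rule integral_mono)
        show "integrable lborel (\<lambda>x. ?IS x * (?w x)\<^sup>2)"
          by (intro bounded_supp_integrable bounded_supp_mult(1)[OF IS] bounded_borel_power w)
        show "integrable lborel (\<lambda>x. 2 * ?x x + 2 * ?y x)"
          using i by (intro Bochner_Integration.integrable_add integrable_mult_right)
        show "?IS x * (?w x)\<^sup>2 \<le> 2 * ?x x + 2 * ?y x" for x
        proof -
          \<comment> \<open>The error splits into the change of the weight, governed by
            \<open>\<beta> h\<close>, and the change of the single entry, governed by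
            \<open>\<gamma> i q k\<close>.\<close>
          define s where "s = (?t (R x) - ?t (F h x)) * R x $ q $ k"
          define u where "u = ?t (F h x) * (R x $ q $ k - F i x $ q $ k)"
          have "(?w x)\<^sup>2 = (s + u)\<^sup>2"
            by (simp add: s_def u_def algebra_simps)
          also have "\<dots> \<le> 2 * s\<^sup>2 + 2 * u\<^sup>2"
            using sum_squares_bound[of s u] by (simp add: power2_sum)
          also have "s\<^sup>2 \<le> (?t (R x) - ?t (F h x))\<^sup>2"
            using mult_left_mono[of "(R x $ q $ k)\<^sup>2" 1 "(?t (R x) - ?t (F h x))\<^sup>2"] R1[of x q k]
            by (simp add: s_def power_mult_distrib abs_square_le_1)
          also have "u\<^sup>2 \<le> (R x $ q $ k - F i x $ q $ k)\<^sup>2"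
            using mult_right_mono[of "(?t (F h x))\<^sup>2" 1 "(R x $ q $ k - F i x $ q $ k)\<^sup>2"]
              abs_triple_le[OF F(2), of a b c h x]
            by (simp add: u_def power_mult_distrib abs_square_le_1)
          finally show ?thesis by (simp add: indicator_def)
        qed
      qed
      also have "\<dots> = 2 * \<beta> h + 2 * \<gamma> i q k"
        using i by (subst Bochner_Integration.integral_add) (simp_all add: \<beta>_def \<gamma>_def)
      finally have "sqrt K * sqrt (LBINT x. ?IS x * (?w x)\<^sup>2) \<le> sqrt K * sqrt (2 * \<beta> h + 2 * \<gamma> i q k)"
        using K0 by (intro mult_left_mono real_sqrt_le_mono) auto
      with weak_cauchy_schwarz[OF K w, of i j p k] show ?thesis by linarith
    qed
    let ?A = "\<lambda>p q k x. \<phi> x * ((?t (R x) * R x $ q $ k - ?t (F h x) * F i x $ q $ k) * DF i j x $ p $ k)"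
    have iA: "integrable lborel (?A p q k)" for p q k
      by (intro bounded_supp_integrable bounded_supp_mult(1) \<phi> bounded_borel_diff bounded_borel_mult bt R F DF)
    have "U i - Z h i = (LBINT x. (\<Sum>k\<in>UNIV. ?A m l k x + ?A l m k x))"
    proof -
      have "integrable lborel (\<lambda>x. \<phi> x * (?t (R x) *
          (\<Sum>k\<in>UNIV. DF i j x $ m $ k * R x $ l $ k + DF i j x $ l $ k * R x $ m $ k)))"
        "integrable lborel (\<lambda>x. \<phi> x * (?t (F h x) *
          (\<Sum>k\<in>UNIV. DF i j x $ m $ k * F i x $ l $ k + DF i j x $ l $ k * F i x $ m $ k)))"
        by (intro bounded_supp_integrable bounded_supp_mult(1) \<phi> bounded_borel_mult bt bounded_borel_sum
            bounded_borel_add R F DF)+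
      then have "U i - Z h i = (LBINT x. \<phi> x * (?t (R x) *
          (\<Sum>k\<in>UNIV. DF i j x $ m $ k * R x $ l $ k + DF i j x $ l $ k * R x $ m $ k)) -
          \<phi> x * (?t (F h x) *
          (\<Sum>k\<in>UNIV. DF i j x $ m $ k * F i x $ l $ k + DF i j x $ l $ k * F i x $ m $ k)))"
        unfolding U_def Z_def by (rule Bochner_Integration.integral_diff[symmetric])
      also have "\<dots> = (LBINT x. (\<Sum>k\<in>UNIV. ?A m l k x + ?A l m k x))"
        unfolding sum_distrib_left sum_subtractf[symmetric]
        by (intro Bochner_Integration.integral_cong sum.cong refl) (simp add: algebra_simps)
      finally show ?thesis .
    qed
    also have "\<dots> = (\<Sum>k\<in>UNIV. (LBINT x. ?A m l k x) + (LBINT x. ?A l m k x))"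
      using iA by (subst Bochner_Integration.integral_sum)
        (intro Bochner_Integration.integrable_add iA sum.cong refl Bochner_Integration.integral_add)+
    also have "\<bar>\<dots>\<bar> \<le> \<epsilon> h i"
      unfolding \<epsilon>_def
      by (intro order_trans[OF sum_abs] sum_mono order_trans[OF abs_triangle_ineq] add_mono half)
    finally show ?thesis .
  qed
  have \<epsilon>i: "(\<lambda>i. \<epsilon> h i) \<longlonglongrightarrow> (\<Sum>k::'n\<in>UNIV. sqrt K * sqrt (2 * \<beta> h + 2 * 0) + sqrt K * sqrt (2 * \<beta> h + 2 * 0))" for h
    unfolding \<epsilon>_def by (intro tendsto_intros \<gamma>)
  have \<epsilon>h: "(\<lambda>h. \<Sum>k::'n\<in>UNIV. sqrt K * sqrt (2 * \<beta> h + 2 * 0) + sqrt K * sqrt (2 * \<beta> h + 2 * 0)) \<longlonglongrightarrow>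
      (\<Sum>k::'n\<in>UNIV. sqrt K * sqrt (2 * 0 + 2 * 0) + sqrt K * sqrt (2 * 0 + 2 * 0))"
    by (intro tendsto_intros \<beta>)
  \<comment> \<open>Order of choices: first \<open>h\<close>, making the limiting error small, then
    \<open>i\<close> large depending on \<open>h\<close>.\<close>
  have "U \<longlonglongrightarrow> 0"
  proof (rule LIMSEQ_I)
    fix r :: real assume r: "r > 0"
    have "eventually (\<lambda>h. (\<Sum>k::'n\<in>UNIV. sqrt K * sqrt (2 * \<beta> h + 2 * 0) + sqrt K * sqrt (2 * \<beta> h + 2 * 0)) < r / 2) sequentially"
      using order_tendstoD(2)[OF \<epsilon>h, of "r / 2"] r by simp
    then obtain h where h: "(\<Sum>k::'n\<in>UNIV. sqrt K * sqrt (2 * \<beta> h + 2 * 0) + sqrt K * sqrt (2 * \<beta> h + 2 * 0)) < r / 2"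
      by (auto simp: eventually_sequentially)
    have "eventually (\<lambda>i. \<epsilon> h i < r / 2) sequentially"
      by (rule order_tendstoD(2)[OF \<epsilon>i h])
    moreover have "eventually (\<lambda>i. \<bar>Z h i\<bar> < r / 2) sequentially"
      using order_tendstoD(2)[OF tendsto_rabs_zero[OF Z[of h]], of "r / 2"] r by simp
    ultimately have "eventually (\<lambda>i. norm (U i - 0) < r) sequentially"
    proof eventually_elim
      case (elim i)
      then show ?case using close[of i h] by (simp add: abs_if split: if_splits)
    qed
    then show "\<exists>N. \<forall>i\<ge>N. norm (U i - 0) < r"
      by (simp add: eventually_sequentially)
  qed
  then show ?thesis by (simp add: U_def[abs_def])
qed

text \<open>Koszul's formula is integrated against \<open>\<phi>\<close> for each
  \<open>DF i\<close>; its \<open>sym_frame\<close> terms vanish in the limit by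
  \<open>weak_antisymmetry\<close>, while on the left the derivative is moved to
  \<open>\<phi>\<close>.\<close>

lemma weak_gradient:
  assumes K: "\<And>i j m k. (LBINT x. (\<phi> x * DF i j x $ m $ k)\<^sup>2) \<le> K"
  shows "(LBINT x. \<phi> x * grad_of_curl (R x) (f x) j m k) = - (LBINT x. d\<phi> j x * R x $ m $ k)"
proof -
  let ?s = "\<lambda>i x. sym_frame (R x) (\<lambda>j. DF i j x)"
  define Q where "Q i l p x = (?s i x m p l - ?s i x p l m + ?s i x l m p) / 2 * R x $ l $ k * R x $ p $ j" for i l p x
  have bs: "bounded_borel (\<lambda>x. ?s i x a b c)" for i a b c
    unfolding sym_frame_def by (intro bounded_borel_sum bounded_borel_mult bounded_borel_add R DF)
  have bQ: "bounded_borel (Q i l p)" for i l p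
    unfolding Q_def[abs_def] divide_inverse
    by (intro bounded_borel_mult bounded_borel_add bounded_borel_diff bounded_borel_const bs R)
  have bg: "bounded_borel (\<lambda>x. grad_of_curl (R x) (g i x) j m k)" for i
    by (intro bounded_borel_grad_of_curl R g)
  have eq: "\<phi> x * DF i j x $ m $ k = \<phi> x * grad_of_curl (R x) (g i x) j m k + (\<Sum>l\<in>UNIV. \<Sum>p\<in>UNIV. \<phi> x * Q i l p x)" for i x
  proof (cases "x \<in> S")
    case True
    \<comment> \<open>The formula is used with the exact rotation \<open>R x\<close> but the
      derivatives of \<open>F i\<close>. The mismatch is collected in \<open>Q\<close>, since
      \<open>DF i\<close> is not tangent to the rotations at \<open>R x\<close>.\<close>
    have "DF i j x $ m $ k = grad_of_curl (R x) (g i x) j m k + (\<Sum>l\<in>UNIV. \<Sum>p\<in>UNIV. Q i l p x)"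
      unfolding Q_def by (rule koszul[OF R(1)]) (simp add: curl[OF True])
    then show ?thesis by (simp add: distrib_left sum_distrib_left)
  qed (simp add: \<phi>_0)
  have s0: "(\<lambda>i. LBINT x. \<phi> x * (?s i x a b c * R x $ l $ k * R x $ p $ j)) \<longlonglongrightarrow> 0" for a b c l p
  proof -
    let ?t = "\<lambda>j'. triple (c, j') (l, k) (p, j)"
    let ?X = "\<lambda>i j' x. \<phi> x * (?t j' (R x) * (\<Sum>k\<in>UNIV. DF i j' x $ a $ k * R x $ b $ k + DF i j' x $ b $ k * R x $ a $ k))"
    have iX: "integrable lborel (?X i j')" for i j'
      unfolding triple_def
      by (intro bounded_supp_integrable bounded_supp_mult(1) \<phi> bounded_borel_mult bounded_borel_sum
            bounded_borel_add R DF)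
    have "(\<lambda>i. \<Sum>j'\<in>UNIV. LBINT x. ?X i j' x) \<longlonglongrightarrow> (\<Sum>j'::'n\<in>UNIV. 0)"
      by (intro tendsto_sum weak_antisymmetry[OF K])
    moreover have "(\<Sum>j'\<in>UNIV. LBINT x. ?X i j' x) = (LBINT x. \<phi> x * (?s i x a b c * R x $ l $ k * R x $ p $ j))" for i
    proof -
      have "(\<Sum>j'\<in>UNIV. LBINT x. ?X i j' x) = (LBINT x. (\<Sum>j'\<in>UNIV. ?X i j' x))"
        by (rule Bochner_Integration.integral_sum[symmetric]) (rule iX)
      also have "(\<lambda>x. \<Sum>j'\<in>UNIV. ?X i j' x) = (\<lambda>x. \<phi> x * (?s i x a b c * R x $ l $ k * R x $ p $ j))"
        unfolding sym_frame_def triple_def sum_distrib_right[of _ UNIV "R _ $ _ $ _"] sum_distrib_left[of "\<phi> _"]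
        by (intro ext sum.cong refl) (simp only: fst_conv snd_conv mult_ac)
      finally show ?thesis .
    qed
    ultimately show ?thesis by simp
  qed
  have Q0: "(\<lambda>i. LBINT x. \<phi> x * Q i l p x) \<longlonglongrightarrow> 0" for l p
  proof -
    let ?Y = "\<lambda>i a b c x. \<phi> x * (?s i x a b c * R x $ l $ k * R x $ p $ j)"
    have iY: "integrable lborel (?Y i a b c)" for i a b c
      by (intro bounded_supp_integrable bounded_supp_mult(1) \<phi> bounded_borel_mult bs R)
    have eq: "(LBINT x. \<phi> x * Q i l p x) = ((LBINT x. ?Y i m p l x) - (LBINT x. ?Y i p l m x) + (LBINT x. ?Y i l m p x)) / 2" for i
    proof -
      have "(LBINT x. \<phi> x * Q i l p x) = (LBINT x. (?Y i m p l x - ?Y i p l m x + ?Y i l m p x) / 2)"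
        unfolding Q_def by (intro Bochner_Integration.integral_cong refl) (simp add: field_simps)
      also have "\<dots> = (LBINT x. ?Y i m p l x - ?Y i p l m x + ?Y i l m p x) / 2"
        by (rule integral_divide_zero)
      also have "(LBINT x. ?Y i m p l x - ?Y i p l m x + ?Y i l m p x) =
          (LBINT x. ?Y i m p l x) - (LBINT x. ?Y i p l m x) + (LBINT x. ?Y i l m p x)"
        using iY by (simp only: Bochner_Integration.integral_diff Bochner_Integration.integral_add
            Bochner_Integration.integrable_diff)
      finally show ?thesis .
    qed
    have "(\<lambda>i. ((LBINT x. ?Y i m p l x) - (LBINT x. ?Y i p l m x) + (LBINT x. ?Y i l m p x)) / 2) \<longlonglongrightarrow> (0 - 0 + 0) / 2"
      by (intro tendsto_divide tendsto_add tendsto_diff s0 tendsto_const) auto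
    then show ?thesis unfolding eq by simp
  qed
  have "(\<lambda>i. (LBINT x. \<phi> x * grad_of_curl (R x) (g i x) j m k) + (\<Sum>l\<in>UNIV. \<Sum>p\<in>UNIV. LBINT x. \<phi> x * Q i l p x))
      \<longlonglongrightarrow> (LBINT x. \<phi> x * grad_of_curl (R x) (f x) j m k) + (\<Sum>l::'n\<in>UNIV. \<Sum>p::'n\<in>UNIV. 0)"
  proof (intro tendsto_add tendsto_sum Q0 dominated_convergence_supp[OF \<phi>(1) bg])
    show "bounded_borel (\<lambda>x. grad_of_curl (R x) (f x) j m k)"
      by (intro bounded_borel_grad_of_curl R f)
    show "\<bar>grad_of_curl (R x) (g i x) j m k\<bar> \<le> (\<Sum>l::'n\<in>UNIV. \<Sum>p::'n\<in>UNIV. 3 * (\<Sum>j::'n\<in>UNIV. \<Sum>k::'n\<in>UNIV. B))" for i x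
      by (intro abs_grad_of_curl_le SO_entry_le_1 R g)
    show "AE x in lborel. \<phi> x \<noteq> 0 \<longrightarrow> (\<lambda>i. grad_of_curl (R x) (g i x) j m k) \<longlonglongrightarrow> grad_of_curl (R x) (f x) j m k"
    proof (intro AE_I2 impI)
      fix x assume "\<phi> x \<noteq> 0"
      then have "x \<in> S" using \<phi>_0 by blast
      then show "(\<lambda>i. grad_of_curl (R x) (g i x) j m k) \<longlonglongrightarrow> grad_of_curl (R x) (f x) j m k"
        by (intro tendsto_grad_of_curl g tendsto_const)
    qed
  qed
  moreover have "(LBINT x. \<phi> x * grad_of_curl (R x) (g i x) j m k) + (\<Sum>l\<in>UNIV. \<Sum>p\<in>UNIV. LBINT x. \<phi> x * Q i l p x) =
      - (LBINT x. d\<phi> j x * F i x $ m $ k)" for i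
  proof -
    have i: "bounded_supp (\<lambda>x. \<phi> x * grad_of_curl (R x) (g i x) j m k)" "bounded_supp (\<lambda>x. \<phi> x * Q i l p x)" for l p
      by (intro bounded_supp_mult(1) \<phi> bg bQ)+
    have "(LBINT x. \<phi> x * DF i j x $ m $ k) = (LBINT x. \<phi> x * grad_of_curl (R x) (g i x) j m k) +
        (LBINT x. (\<Sum>l\<in>UNIV. \<Sum>p\<in>UNIV. \<phi> x * Q i l p x))"
      unfolding eq by (intro Bochner_Integration.integral_add bounded_supp_integrable bounded_supp_sum i)
    also have "(LBINT x. (\<Sum>l\<in>UNIV. \<Sum>p\<in>UNIV. \<phi> x * Q i l p x)) = (\<Sum>l\<in>UNIV. \<Sum>p\<in>UNIV. LBINT x. \<phi> x * Q i l p x)"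
      by (subst Bochner_Integration.integral_sum)
        (intro bounded_supp_integrable bounded_supp_sum i(2) sum.cong refl Bochner_Integration.integral_sum)+
    finally show ?thesis
      using integral_by_parts[OF \<phi>(1,2,3) F(1) DF] by simp
  qed
  ultimately have 1: "(\<lambda>i. - (LBINT x. d\<phi> j x * F i x $ m $ k)) \<longlonglongrightarrow> (LBINT x. \<phi> x * grad_of_curl (R x) (f x) j m k)"
    by simp
  have 2: "(\<lambda>i. - (LBINT x. d\<phi> j x * F i x $ m $ k)) \<longlonglongrightarrow> - (LBINT x. d\<phi> j x * R x $ m $ k)"
  proof (intro tendsto_minus dominated_convergence_supp[OF \<phi>(2) F(1) R(2) F(2)])
    show "AE x in lborel. d\<phi> j x \<noteq> 0 \<longrightarrow> (\<lambda>i. F i x $ m $ k) \<longlonglongrightarrow> R x $ m $ k"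
      using F_tendsto
    proof eventually_elim
      case (elim x)
      then show ?case using \<phi>_0(2)[of x j] by blast
    qed
  qed
  show ?thesis by (rule LIMSEQ_unique[OF 1 2])
qed

end

section \<open>Regularity of rotation fields with prescribed Curl\<close>

abbreviation unit_index :: "'n \<Rightarrow> 'n \<Rightarrow> nat" where
  "unit_index j \<equiv> raise (\<lambda>_. 0) j"

lemma abs_mollify_le:
  fixes u :: "real^'n \<Rightarrow> real"
  assumes "e > 0" "bounded_borel u" "\<And>y. \<bar>u y\<bar> \<le> B"
  shows "\<bar>mollify e (\<lambda>_. 0) u x\<bar> \<le> B"
  using mollify_near[OF assms(1,2), of x 0 B] assms(3) by simp

lemma cubes_subset_open:
  fixes x :: "real^'n"
  assumes "open Q" "cube x d \<subseteq> Q"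
  shows "\<exists>e0>0. \<forall>y\<in>cube x d. \<forall>e<e0. cube y e \<subseteq> Q"
proof -
  obtain r where r: "r > 0" "(\<Union>y\<in>cube x d. ball y r) \<subseteq> Q"
    using compact_subset_open_imp_ball_epsilon_subset[OF compact_cube assms(1,2)] by blast
  have "cube y e \<subseteq> Q" if "y \<in> cube x d" "e < r / real CARD('n)" for y e
  proof -
    have "real CARD('n) * e < r" using that(2) by (simp add: field_simps)
    then have "cube y e \<subseteq> ball y r"
      using cube_subset_cball[of y e] by (force simp: subset_iff)
    then show ?thesis using r(2) that(1) by blast
  qed
  then show ?thesis
    using r(1) by (intro exI[of _ "r / real CARD('n)"]) auto
qed

text \<open>The distributional equation enters as \<open>curl\<close>, tested with the kernel of
  width \<open>d\<close> at \<open>x\<close> whenever its support lies in \<open>Q\<close>.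
  \<open>R\<close> is a rotation and \<open>f\<close> is bounded on the whole space, so that
  mollification is globally defined; the equation and the continuity of \<open>f\<close> are
  confined to \<open>Q\<close>.\<close>

locale curl_equation =
  fixes Q :: "(real^'n) set" and R :: "real^'n \<Rightarrow> real^'n^'n" and f :: "real^'n \<Rightarrow> real^'n^'n^'n" and B :: real
  assumes Q: "open Q"
    and R: "\<And>x. R x \<in> SO" "\<And>m k. bounded_borel (\<lambda>x. R x $ m $ k)"
    and f: "\<And>m j k. bounded_borel (\<lambda>x. f x $ m $ j $ k)" "\<And>x m j k. \<bar>f x $ m $ j $ k\<bar> \<le> B"
      "\<And>x m j k. x \<in> Q \<Longrightarrow> isCont (\<lambda>x. f x $ m $ j $ k) x"
    and curl: "\<And>x d m j k. d > 0 \<Longrightarrow> cube x d \<subseteq> Q \<Longrightarrow>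
      mollify d (unit_index j) (\<lambda>x. R x $ m $ k) x - mollify d (unit_index k) (\<lambda>x. R x $ m $ j) x =
      mollify d (\<lambda>_. 0) (\<lambda>x. f x $ m $ j $ k) x"
begin

text \<open>Two scales are involved: the kernel of width \<open>d\<close> at \<open>x\<close> is the
  test function, and \<open>e i\<close> is the scale at which \<open>R\<close> and \<open>f\<close>
  are smoothed. The sign of the test derivative comes from reflecting the kernel.\<close>

abbreviation mollified_approximation :: "real^'n \<Rightarrow> real \<Rightarrow> (nat \<Rightarrow> real) \<Rightarrow> bool" where
  "mollified_approximation x d e \<equiv> rotation_approximation (\<lambda>y. mollifier d (\<lambda>_. 0) (x - y)) (\<lambda>j y. - mollifier d (unit_index j) (x - y))
      (cube x d) R f (\<lambda>i y. \<chi> m k. mollify (e i) (\<lambda>_. 0) (\<lambda>x. R x $ m $ k) y)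
      (\<lambda>i j y. \<chi> m k. mollify (e i) (unit_index j) (\<lambda>x. R x $ m $ k) y)
      (\<lambda>i j l y. \<chi> m k. mollify (e i) (raise (unit_index j) l) (\<lambda>x. R x $ m $ k) y)
      (\<lambda>i y. \<chi> m j k. mollify (e i) (\<lambda>_. 0) (\<lambda>x. f x $ m $ j $ k) y) B"

text \<open>A subsequence of scales gives almost everywhere convergence on the cube. The inclusion
  of the small cubes in \<open>Q\<close> is exported because the identities are applied again at
  scale \<open>e i\<close>.\<close>

lemma mollify_approximation:
  assumes d: "d > 0" "cube x d \<subseteq> Q"
  obtains e where "\<And>i. e i > 0" "\<And>i y. y \<in> cube x d \<Longrightarrow> cube y (e i) \<subseteq> Q"
    "mollified_approximation x d e"
proof -
  obtain e0 where e0: "e0 > 0" "\<And>y e. y \<in> cube x d \<Longrightarrow> e < e0 \<Longrightarrow> cube y e \<subseteq> Q"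
    using cubes_subset_open[OF Q d(2)] by blast
  \<comment> \<open>\<open>Suc (Suc i)\<close> makes every scale, including the first, strictly
    smaller than \<open>e0\<close>.\<close>
  define e1 where "e1 i = e0 * inverse (real (Suc (Suc i)))" for i
  have e1: "e1 i > 0" "e1 i < e0" for i
  proof -
    have "inverse (real (Suc (Suc i))) < 1" by (subst inverse_less_1_iff) simp
    from mult_strict_left_mono[OF this e0(1)] show "e1 i < e0" by (simp only: e1_def mult_1_right)
    show "e1 i > 0" unfolding e1_def using e0(1) by (intro mult_pos_pos) auto
  qed
  have "(\<lambda>i. e0 * inverse (real (Suc (Suc i)))) \<longlonglongrightarrow> e0 * 0"
    by (rule tendsto_mult[OF tendsto_const LIMSEQ_Suc[OF LIMSEQ_inverse_real_of_nat]])
  then have e1_0: "e1 \<longlonglongrightarrow> 0" by (simp add: e1_def[abs_def])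
  obtain r where r: "\<And>y. y \<in> cube x d \<Longrightarrow> norm y \<le> r"
    using compact_imp_bounded[OF compact_cube[of x d]] unfolding bounded_iff by blast
  have "\<exists>s. strict_mono s \<and> (AE y in lborel. norm y \<le> r \<longrightarrow> (\<forall>mk\<in>UNIV.
      (\<lambda>i. mollify (e1 (s i)) (\<lambda>_. 0) (\<lambda>x. R x $ fst mk $ snd mk) y) \<longlonglongrightarrow> R y $ fst mk $ snd mk))"
    by (rule mollify_AE_subseq[where u = "\<lambda>mk x. R x $ fst mk $ snd mk", OF finite _ e1(1) e1_0]) (rule R(2))
  then obtain s where s: "strict_mono s" "AE y in lborel. norm y \<le> r \<longrightarrow> (\<forall>mk\<in>UNIV.
      (\<lambda>i. mollify (e1 (s i)) (\<lambda>_. 0) (\<lambda>x. R x $ fst mk $ snd mk) y) \<longlonglongrightarrow> R y $ fst mk $ snd mk)"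
    by (elim exE conjE) (rule that)
  define e where "e i = e1 (s i)" for i
  have e: "e i > 0" "e i < e0" for i using e1 by (auto simp: e_def)
  have e_0: "e \<longlonglongrightarrow> 0"
    using LIMSEQ_subseq_LIMSEQ[OF e1_0 s(1)] by (simp add: e_def[abs_def] o_def)
  have sub: "cube y (e i) \<subseteq> Q" if "y \<in> cube x d" for i y
    using e0(2)[OF that e(2)] .
  have approx: "mollified_approximation x d e"
  proof (unfold_locales, goal_cases)
    case 1 show ?case by (rule cube_borel)
  next
    case 2 show ?case by (rule compact_imp_bounded[OF compact_cube])
  next
    case 3 show ?case by (rule bounded_supp_mollifier_reflect[OF d(1)])
  next
    case 4 show ?case by (intro bounded_supp_uminus bounded_supp_mollifier_reflect[OF d(1)])
  next
    case 5 show ?case by (rule has_partial_mollifier_reflect[OF d(1)])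
  next
    case (6 y) then show ?case by (rule mollifier_eq_0[OF d(1)])
  next
    case (7 y j) then show ?case by (simp add: mollifier_eq_0[OF d(1)])
  next
    case 8 show ?case by (rule R(1))
  next
    case 9 show ?case by (rule R(2))
  next
    case 10 show ?case by (rule f(1))
  next
    case 11 show ?case using bounded_borel_mollify[OF e(1) R(2)] by simp
  next
    case 12 show ?case using abs_mollify_le[OF e(1) R(2) SO_entry_le_1[OF R(1)]] by simp
  next
    case 13 show ?case using bounded_borel_mollify[OF e(1) R(2)] by simp
  next
    case 14 show ?case using has_partial_mollify[OF e(1) R(2)] by simp
  next
    case 15 show ?case using bounded_borel_mollify[OF e(1) R(2)] by simp
  next
    case 16 show ?case using has_partial_mollify[OF e(1) R(2)] by simp
  next
    case 17 show ?case by (simp add: raise_commute)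
  next
    case 18
    from s(2) show ?case
    proof eventually_elim
      case (elim y)
      show ?case using elim r[of y] by (auto simp: e_def)
    qed
  next
    case (19 i m j k y)
    show ?case using curl[OF e(1) sub[OF 19]] by simp
  next
    case 20 show ?case using bounded_borel_mollify[OF e(1) f(1)] by simp
  next
    case 21 show ?case using abs_mollify_le[OF e(1) f(1) f(2)] by simp
  next
    case (22 m j k y)
    then have "y \<in> Q" using d(2) by blast
    then show ?case using mollify_tendsto[OF f(1) f(3) e(1) e_0] by simp
  qed
  show ?thesis by (rule that[OF e(1) sub approx])
qed

text \<open>\<open>divergence_eq\<close> tested with a kernel: the weak divergence formula, read at
  a point and a scale.\<close>

lemma mollify_divergence:
  assumes d: "d > 0" "cube x d \<subseteq> Q"
  shows "(\<Sum>k\<in>UNIV. mollify d (unit_index k) (\<lambda>x. R x $ m $ k) x) =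
    mollify d (\<lambda>_. 0) (\<lambda>x. divergence_of_curl (R x) (f x) m) x"
proof -
  obtain e where e: "\<And>i. e i > 0" "\<And>i y. y \<in> cube x d \<Longrightarrow> cube y (e i) \<subseteq> Q" and
    approx: "mollified_approximation x d e"
    by (rule mollify_approximation[OF d]) (rule that)
  from rotation_approximation.divergence_eq[OF approx, of m] show ?thesis
    by (simp add: mollify_def sum_negf)
qed

text \<open>The divergence identity is used at the finer scales \<open>e i\<close> to supply the
  divergence bound that \<open>energy_bound\<close> requires; \<open>weak_gradient\<close> is then
  tested with the kernel of width \<open>d\<close>.\<close>

lemma mollify_gradient:
  assumes d: "d > 0" "cube x d \<subseteq> Q"
  shows "mollify d (unit_index j) (\<lambda>x. R x $ m $ k) x =
    mollify d (\<lambda>_. 0) (\<lambda>x. grad_of_curl (R x) (f x) j m k) x"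
proof -
  obtain e where e: "\<And>i. e i > 0" "\<And>i y. y \<in> cube x d \<Longrightarrow> cube y (e i) \<subseteq> Q" and
    approx: "mollified_approximation x d e"
    by (rule mollify_approximation[OF d]) (rule that)
  define G where "G = (\<Sum>m::'n\<in>UNIV. \<Sum>i\<in>UNIV - {m}. \<Sum>k::'n\<in>UNIV. \<Sum>l::'n\<in>UNIV. B / 2 * real (fact CARD('n)))"
  have B0: "0 \<le> B" using f(2)[of undefined undefined undefined undefined] by linarith
  have G: "\<bar>divergence_of_curl (R y) (f y) m\<bar> \<le> G" for y m
  proof -
    have "(\<Sum>i\<in>UNIV - {m}. \<Sum>k::'n\<in>UNIV. \<Sum>l::'n\<in>UNIV. B / 2 * real (fact CARD('n))) \<le> G"
      unfolding G_def using B0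
      by (intro member_le_sum[of m UNIV "\<lambda>m::'n. \<Sum>i\<in>UNIV - {m}. \<Sum>k::'n\<in>UNIV. \<Sum>l::'n\<in>UNIV. B / 2 * real (fact CARD('n))"])
         (auto intro!: sum_nonneg)
    with abs_divergence_of_curl_le[OF SO_entry_le_1[OF R(1)] f(2), of y y m] show ?thesis by linarith
  qed
  \<comment> \<open>The divergence of the mollified row is itself a mollification of
    \<open>divergence_of_curl (R x) (f x) m\<close>, and averaging preserves the bound
    \<open>G\<close>.\<close>
  have div: "\<bar>\<Sum>k\<in>UNIV. (\<chi> m l. mollify (e i) (unit_index k) (\<lambda>x. R x $ m $ l) y) $ m $ k\<bar> \<le> G"
    if "y \<in> cube x d" for i m y
  proof -
    have "bounded_borel (\<lambda>x. divergence_of_curl (R x) (f x) m)"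
      by (intro bounded_borel_divergence_of_curl R f)
    from abs_mollify_le[OF e(1) this G] show ?thesis
      using mollify_divergence[OF e(1) e(2)[OF that], of i m] by simp
  qed
  obtain K where K: "\<And>i j m k. (LBINT y. (mollifier d (\<lambda>_. 0) (x - y) *
      (\<chi> m k. mollify (e i) (unit_index j) (\<lambda>x. R x $ m $ k) y) $ m $ k)\<^sup>2) \<le> K"
    using rotation_approximation.energy_bound[OF approx div] by blast
  from rotation_approximation.weak_gradient[OF approx K, of j m k] show ?thesis
    by (simp add: mollify_def)
qed

end

section \<open>The continuous representative near a point and its derivatives\<close>

lemma AE_lborel_dense:
  fixes U :: "'a::euclidean_space set"
  assumes U: "open U" and ae: "AE x in lborel. x \<in> U \<longrightarrow> P x"
  shows "U \<subseteq> closure {x \<in> U. P x}"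
proof (rule ccontr)
  assume "\<not> U \<subseteq> closure {x \<in> U. P x}"
  then obtain x where x: "x \<in> U - closure {x \<in> U. P x}" by blast
  have "open (U - closure {x \<in> U. P x})"
    using U by (intro open_Diff closed_closure)
  moreover have "negligible (U - closure {x \<in> U. P x})"
  proof -
    from ae obtain N where N: "N \<in> null_sets lborel" "{x \<in> space lborel. \<not> (x \<in> U \<longrightarrow> P x)} \<subseteq> N"
      by (auto simp: eventually_ae_filter)
    have "N \<in> null_sets lebesgue" using N(1) by (rule null_sets_completionI)
    then have "negligible N" by (simp add: negligible_iff_null_sets)
    moreover have "U - closure {x \<in> U. P x} \<subseteq> N"
      using N(2) closure_subset[of "{x \<in> U. P x}"] by auto
    ultimately show ?thesis by (rule negligible_subset)
  qed
  ultimately show False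
    using x open_not_negligible by blast
qed

lemma continuous_on_indicator_mult_isCont:
  fixes h :: "'a::euclidean_space \<Rightarrow> real"
  assumes "open U" "continuous_on U h" "x \<in> U"
  shows "isCont (\<lambda>x. indicator U x * h x) x"
proof -
  have "continuous_on U (\<lambda>x. indicator U x * h x)"
    using assms(2) by (rule continuous_on_cong[THEN iffD1, rotated 2]) auto
  then show ?thesis
    using assms(1,3) continuous_on_eq_continuous_at by blast
qed

lemma bounded_borel_indicator_mult:
  fixes h :: "'a::euclidean_space \<Rightarrow> real"
  assumes "open U" "continuous_on U h" "\<And>x. x \<in> U \<Longrightarrow> \<bar>h x\<bar> \<le> B" "0 \<le> B"
  shows "bounded_borel (\<lambda>x. indicator U x * h x)"
proof (rule bounded_borelI)
  show "(\<lambda>x. indicator U x * h x) \<in> borel_measurable borel"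
    using borel_measurable_continuous_on_indicator[OF _ assms(2)] assms(1) by simp
  show "\<bar>indicator U x * h x\<bar> \<le> B" for x
    using assms(3,4) by (cases "x \<in> U") auto
qed

text \<open>\<open>mollify_gradient\<close> bounds the mollified gradients uniformly, so on the
  convex half ball the mollifications share a Lipschitz constant. It passes to \<open>R\<close> on a
  set of full measure, which is dense, and the Lipschitz extension to the closure covers the half
  ball.\<close>

lemma (in curl_equation) continuous_representative:
  assumes "ball x0 r \<subseteq> Q" "r > 0"
  shows "\<exists>H. (\<forall>m k. continuous_on (ball x0 (r/2)) (\<lambda>x. H x $ m $ k)) \<and>
    (\<forall>x m k. \<bar>H x $ m $ k\<bar> \<le> 1) \<and> (AE x in lborel. x \<in> ball x0 (r/2) \<longrightarrow> H x = R x)"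
proof -
  let ?U = "ball x0 (r/2)"
  define \<Lambda> where "\<Lambda> = (\<Sum>l::'n\<in>UNIV. \<Sum>p::'n\<in>UNIV. 3 * (\<Sum>j::'n\<in>UNIV. \<Sum>k::'n\<in>UNIV. B))"
  have \<Lambda>: "\<bar>grad_of_curl (R x) (f x) j m k\<bar> \<le> \<Lambda>" for x j m k
    unfolding \<Lambda>_def by (intro abs_grad_of_curl_le SO_entry_le_1 R f)
  have \<Lambda>0: "0 \<le> \<Lambda>" using \<Lambda>[of undefined undefined undefined undefined] by linarith
  have n1: "0 < real CARD('n)" by simp
  \<comment> \<open>Chosen so that \<open>CARD('n) * e i\<close> is at most \<open>r / 4\<close>:
    kernels centred in the half ball are then supported in the full ball.\<close>
  define e where "e i = r / (2 * real CARD('n)) * inverse (real (Suc i)) / 2" for i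
  have e: "e i > 0" "real CARD('n) * e i < r / 2" for i
  proof -
    show "e i > 0" unfolding e_def using assms(2) by simp
    have "inverse (real (Suc i)) \<le> 1" by (subst inverse_le_1_iff) simp
    then have "real CARD('n) * e i \<le> r / 4"
      using assms(2) mult_left_mono[of "inverse (real (Suc i))" 1 "r / 4"] by (simp add: e_def)
    then show "real CARD('n) * e i < r / 2" using assms(2) by simp
  qed
  have "(\<lambda>i. r / (2 * real CARD('n)) * inverse (real (Suc i)) / 2) \<longlonglongrightarrow> r / (2 * real CARD('n)) * 0 / 2"
    by (rule tendsto_divide[OF tendsto_mult[OF tendsto_const LIMSEQ_inverse_real_of_nat] tendsto_const]) simp
  then have e_0: "e \<longlonglongrightarrow> 0" unfolding e_def[abs_def] by simp
  have sub: "cube x (e i) \<subseteq> Q" if x: "x \<in> ?U" for x i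
  proof
    fix y assume "y \<in> cube x (e i)"
    then have "dist x y \<le> real CARD('n) * e i" using cube_subset_cball[of x "e i"] by auto
    then have "dist x0 y < r" using x e(2)[of i] dist_triangle[of x0 y x] by (simp add: dist_commute)
    then show "y \<in> Q" using assms(1) by auto
  qed
  have grad: "\<bar>mollify (e i) (unit_index j) (\<lambda>x. R x $ m $ k) x\<bar> \<le> \<Lambda>" if x: "x \<in> ?U" for i j m k x
    unfolding mollify_gradient[OF e(1) sub[OF x]]
    by (intro abs_mollify_le e(1) \<Lambda> bounded_borel_grad_of_curl R f)
  have lip: "\<bar>mollify (e i) (\<lambda>_. 0) (\<lambda>x. R x $ m $ k) y - mollify (e i) (\<lambda>_. 0) (\<lambda>x. R x $ m $ k) x\<bar> \<le>
      real CARD('n) * \<Lambda> * norm (y - x)" if "x \<in> ?U" "y \<in> ?U" for i m k x y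
  proof (rule mollify_lipschitz[OF e(1) R(2)])
    fix z j assume "z \<in> closed_segment x y"
    then have "z \<in> ?U" using that closed_segment_subset[OF _ _ convex_ball] by blast
    then show "\<bar>mollify (e i) (unit_index j) (\<lambda>x. R x $ m $ k) z\<bar> \<le> \<Lambda>" by (rule grad)
  qed
  have "\<exists>s. strict_mono s \<and> (AE y in lborel. norm y \<le> norm x0 + r \<longrightarrow> (\<forall>mk\<in>UNIV.
      (\<lambda>i. mollify (e (s i)) (\<lambda>_. 0) (\<lambda>x. R x $ fst mk $ snd mk) y) \<longlonglongrightarrow> R y $ fst mk $ snd mk))"
    by (rule mollify_AE_subseq[where u = "\<lambda>mk x. R x $ fst mk $ snd mk", OF finite _ e(1) e_0]) (rule R(2))
  then obtain s where s: "AE y in lborel. norm y \<le> norm x0 + r \<longrightarrow> (\<forall>mk\<in>UNIV.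
      (\<lambda>i. mollify (e (s i)) (\<lambda>_. 0) (\<lambda>x. R x $ fst mk $ snd mk) y) \<longlonglongrightarrow> R y $ fst mk $ snd mk)"
    by (elim exE conjE) (rule that)
  define P where "P y \<longleftrightarrow> (\<forall>m k. (\<lambda>i. mollify (e (s i)) (\<lambda>_. 0) (\<lambda>x. R x $ m $ k) y) \<longlonglongrightarrow> R y $ m $ k)" for y
  have ae: "AE y in lborel. y \<in> ?U \<longrightarrow> P y"
    using s
  proof eventually_elim
    case (elim y)
    have "norm y \<le> norm x0 + r" if "y \<in> ?U"
      using that norm_triangle_ineq[of x0 "y - x0"] assms(2) by (simp add: dist_norm norm_minus_commute)
    then show ?case using elim by (auto simp: P_def)
  qed
  let ?X = "{x \<in> ?U. P x}"
  have "(real CARD('n) * \<Lambda>)-lipschitz_on ?X (\<lambda>x. R x $ m $ k)" for m k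
  proof (rule lipschitz_onI)
    fix x y assume "x \<in> ?X" "y \<in> ?X"
    then have "(\<lambda>i. \<bar>mollify (e (s i)) (\<lambda>_. 0) (\<lambda>x. R x $ m $ k) y - mollify (e (s i)) (\<lambda>_. 0) (\<lambda>x. R x $ m $ k) x\<bar>)
        \<longlonglongrightarrow> \<bar>R y $ m $ k - R x $ m $ k\<bar>"
      unfolding P_def by (intro tendsto_rabs tendsto_diff) auto
    then have "\<bar>R y $ m $ k - R x $ m $ k\<bar> \<le> real CARD('n) * \<Lambda> * norm (y - x)"
      using \<open>x \<in> ?X\<close> \<open>y \<in> ?X\<close> by (intro LIMSEQ_le_const2) (auto intro!: lip)
    then show "dist (R x $ m $ k) (R y $ m $ k) \<le> real CARD('n) * \<Lambda> * dist x y"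
      by (simp add: dist_norm norm_minus_commute abs_minus_commute)
  qed (use \<Lambda>0 in simp)
  note ext = lipschitz_extend_closure[OF this]
  define h where "h m k = (SOME h. (real CARD('n) * \<Lambda>)-lipschitz_on (closure ?X) h \<and> (\<forall>x\<in>?X. h x = R x $ m $ k))" for m k
  have h: "(real CARD('n) * \<Lambda>)-lipschitz_on (closure ?X) (h m k)" "\<forall>x\<in>?X. h m k x = R x $ m $ k" for m k
    using someI_ex[OF ext[of m k]] unfolding h_def by simp_all
  \<comment> \<open>Clamping secures the bound 1 also outside the closure, where \<open>h\<close> is
    arbitrary. On \<open>?X\<close> it changes nothing, since entries of rotations lie in
    [-1, 1].\<close>
  define H :: "real^'n \<Rightarrow> real^'n^'n" where "H x = (\<chi> m k. max (- 1) (min 1 (h m k x)))" for x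
  have "continuous_on ?U (h m k)" for m k
    using lipschitz_on_continuous_on[OF h(1)] AE_lborel_dense[OF open_ball ae] by (rule continuous_on_subset)
  then have "continuous_on ?U (\<lambda>x. H x $ m $ k)" for m k
    unfolding H_def by (simp add: continuous_intros)
  moreover have "\<bar>H x $ m $ k\<bar> \<le> 1" for x m k
    unfolding H_def by simp
  moreover have "AE x in lborel. x \<in> ?U \<longrightarrow> H x = R x"
    using ae
  proof (rule AE_mp, intro AE_I2 impI)
    fix x assume "x \<in> ?U \<longrightarrow> P x" "x \<in> ?U"
    then have "h m k x = R x $ m $ k" for m k using h(2)[of m k] by simp
    moreover have "max (- 1) (min 1 (R x $ m $ k)) = R x $ m $ k" for m k
      using SO_entry_le_1[OF R(1), of x m k] by linarith
    ultimately show "H x = R x"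
      by (simp add: H_def vec_eq_iff)
  qed
  ultimately show ?thesis by (intro exI[of _ H] conjI allI)
qed

text \<open>\<open>H\<close> is identified as the limit of one fixed sequence of mollifications,
  which does not depend on the ball; this is what later makes the local representatives
  agree.\<close>

lemma (in curl_equation) local_regularity:
  assumes "ball x0 r \<subseteq> Q" "r > 0"
  shows "\<exists>H. (\<forall>m k. continuous_on (ball x0 (r/2)) (\<lambda>x. H x $ m $ k)) \<and>
    (AE x in lborel. x \<in> ball x0 (r/2) \<longrightarrow> H x = R x) \<and>
    (\<forall>x\<in>ball x0 (r/2). \<forall>m k. (\<lambda>i. mollify (inverse (real (Suc i))) (\<lambda>_. 0) (\<lambda>x. R x $ m $ k) x) \<longlonglongrightarrow> H x $ m $ k) \<and>
    (\<forall>x\<in>ball x0 (r/2). \<forall>j m k. has_partial (\<lambda>x. H x $ m $ k) j (grad_of_curl (H x) (f x) j m k) x)"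
proof -
  let ?U = "ball x0 (r/2)"
  let ?e = "\<lambda>i. inverse (real (Suc i))"
  obtain H where Hc': "\<forall>m k. continuous_on ?U (\<lambda>x. H x $ m $ k)" and H1': "\<forall>x m k. \<bar>H x $ m $ k\<bar> \<le> 1"
    and HR: "AE x in lborel. x \<in> ?U \<longrightarrow> H x = R x"
    using continuous_representative[OF assms] by (elim exE conjE) (rule that)
  have Hc: "continuous_on ?U (\<lambda>x. H x $ m $ k)" for m k using Hc' by simp
  have H1: "\<bar>H x $ m $ k\<bar> \<le> 1" for x m k using H1' by simp
  have e0: "?e i > 0" for i by simp
  have UQ: "?U \<subseteq> Q" using assms by auto
  \<comment> \<open>Extension of \<open>H\<close> by zero: bounded, Borel and continuous at the
    points of \<open>?U\<close>, hence admissible for the mollification lemmas.\<close>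
  define u where "u m k x = indicator ?U x * H x $ m $ k" for m k x
  have u: "bounded_borel (u m k)" for m k
    unfolding u_def[abs_def] using H1 by (intro bounded_borel_indicator_mult Hc) auto
  have uc: "isCont (u m k) x" if "x \<in> ?U" for m k x
    unfolding u_def[abs_def] using that by (intro continuous_on_indicator_mult_isCont Hc) auto
  have mol_u: "mollify e (\<lambda>_. 0) (\<lambda>x. R x $ m $ k) x = mollify e (\<lambda>_. 0) (u m k) x"
    if "e > 0" "cube x e \<subseteq> ?U" for e x m k
  proof (rule mollify_cong_AE[OF that(1) R(2) u])
    show "AE y in lborel. y \<in> cube x e \<longrightarrow> R y $ m $ k = u m k y"
      using HR
    proof eventually_elim
      case (elim y)
      then show ?case using that(2) by (auto simp: u_def)
    qed
  qed
  have ev_small: "eventually (\<lambda>i. real CARD('n) * ?e i < d) sequentially" if "d > 0" for d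
  proof -
    have "(\<lambda>i. real CARD('n) * ?e i) \<longlonglongrightarrow> real CARD('n) * 0"
      by (rule tendsto_mult[OF tendsto_const LIMSEQ_inverse_real_of_nat])
    from order_tendstoD(2)[OF this, of d] that show ?thesis by simp
  qed
  have cube_ball: "cube y e \<subseteq> ball x (d + d')" if "dist x y < d" "real CARD('n) * e < d'" for x y :: "real^'n" and e d d'
  proof
    fix z assume "z \<in> cube y e"
    then have "dist y z \<le> real CARD('n) * e" using cube_subset_cball[of y e] by auto
    then show "z \<in> ball x (d + d')" using that dist_triangle[of x z y] by simp
  qed
  have lim: "(\<lambda>i. mollify (?e i) (\<lambda>_. 0) (\<lambda>x. R x $ m $ k) x) \<longlonglongrightarrow> H x $ m $ k" if x: "x \<in> ?U" for x m k
  proof -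
    obtain d where d: "d > 0" "ball x d \<subseteq> ?U" using x open_ball openE by blast
    have "(\<lambda>i. mollify (?e i) (\<lambda>_. 0) (u m k) x) \<longlonglongrightarrow> u m k x"
      by (rule mollify_tendsto[OF u uc[OF x] e0 LIMSEQ_inverse_real_of_nat])
    moreover have "eventually (\<lambda>i. mollify (?e i) (\<lambda>_. 0) (u m k) x = mollify (?e i) (\<lambda>_. 0) (\<lambda>x. R x $ m $ k) x) sequentially"
    proof (rule eventually_mono[OF ev_small[of "d / 2"]])
      fix i assume "real CARD('n) * ?e i < d / 2"
      then have "cube x (?e i) \<subseteq> ball x (d/2 + d/2)" using d(1) by (intro cube_ball) auto
      then show "mollify (?e i) (\<lambda>_. 0) (u m k) x = mollify (?e i) (\<lambda>_. 0) (\<lambda>x. R x $ m $ k) x"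
        using d(2) by (intro mol_u[symmetric] e0) auto
    qed (use d(1) in simp)
    ultimately have "(\<lambda>i. mollify (?e i) (\<lambda>_. 0) (\<lambda>x. R x $ m $ k) x) \<longlonglongrightarrow> u m k x"
      by (rule Lim_transform_eventually)
    then show ?thesis using x by (simp add: u_def)
  qed
  have "has_partial (\<lambda>x. H x $ m $ k) j (grad_of_curl (H x) (f x) j m k) x" if x: "x \<in> ?U" for x j m k
  proof -
    let ?a = "axis j 1 :: real^'n"
    let ?F = "\<lambda>e. mollify e (\<lambda>_. 0) (\<lambda>x. R x $ m $ k)"
    define G where "G y = grad_of_curl (H y) (f y) j m k" for y
    \<comment> \<open>The gradient formula with the extension by zero in place of \<open>H\<close>;
      it is globally bounded and Borel and agrees with \<open>G\<close> on
      \<open>?U\<close>.\<close>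
    define G0 where "G0 y = grad_of_curl (\<chi> m k. u m k y) (f y) j m k" for y
    have G0: "bounded_borel G0"
      unfolding G0_def[abs_def] using u f(1) by (intro bounded_borel_grad_of_curl) auto
    have GG0: "G0 y = G y" if "y \<in> ?U" for y
    proof -
      have "(\<chi> m k. u m k y) = H y" using that by (simp add: u_def vec_eq_iff)
      then show ?thesis by (simp add: G0_def G_def)
    qed
    have "isCont G0 x"
      unfolding isCont_def G0_def
      using uc[OF x] f(3) x UQ by (intro tendsto_grad_of_curl) (auto simp: isCont_def)
    have "((\<lambda>t. (H (x + t *\<^sub>R ?a) $ m $ k - H x $ m $ k) / t) \<longlongrightarrow> G x) (at 0)"
    proof (rule LIM_I)
      fix \<epsilon> :: real assume \<epsilon>: "\<epsilon> > 0"
      obtain d1 where d1: "d1 > 0" "ball x d1 \<subseteq> ?U" using x open_ball openE by blast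
      obtain d2 where d2: "d2 > 0" "\<And>y. dist y x < d2 \<Longrightarrow> \<bar>G0 y - G0 x\<bar> < \<epsilon> / 2"
        using \<open>isCont G0 x\<close> \<epsilon> unfolding continuous_at_eps_delta by (metis dist_real_def half_gt_zero)
      \<comment> \<open>Half of the smaller radius: one share for the displacement along the axis,
        the other for the extent of the kernel.\<close>
      define d where "d = min d1 d2 / 2"
      have d: "d > 0" "d + d \<le> d1" "d + d \<le> d2" using d1(1) d2(1) by (auto simp: d_def)
      \<comment> \<open>Differentiability of \<open>H\<close> is proved on the level of
        mollifications, by the mean value inequality for
        \<open>?F e (x + s *\<^sub>R ?a) - s * G x\<close>. The estimate is uniform in
        \<open>e\<close> and survives the limit.\<close>
      have bound: "\<bar>?F e (x + t *\<^sub>R ?a) - ?F e x - t * G x\<bar> \<le> \<epsilon> / 2 * \<bar>t\<bar>"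
        if t: "\<bar>t\<bar> < d" and e: "e > 0" "real CARD('n) * e < d" for t e
      proof -
        have D: "\<bar>mollify e (unit_index j) (\<lambda>x. R x $ m $ k) z - G x\<bar> \<le> \<epsilon> / 2" if z: "dist x z < d" for z
        proof -
          have c: "cube z e \<subseteq> ball x (d + d)" by (rule cube_ball[OF z e(2)])
          then have cU: "cube z e \<subseteq> ?U" using d(2) d1(2) by (meson order_trans subset_ball)
          have "mollify e (unit_index j) (\<lambda>x. R x $ m $ k) z = mollify e (\<lambda>_. 0) (\<lambda>x. grad_of_curl (R x) (f x) j m k) z"
            using cU UQ by (intro mollify_gradient e) auto
          also have "\<dots> = mollify e (\<lambda>_. 0) G0 z"
          proof (rule mollify_cong_AE[OF e(1) _ G0])
            show "bounded_borel (\<lambda>x. grad_of_curl (R x) (f x) j m k)"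
              by (intro bounded_borel_grad_of_curl R f)
            show "AE y in lborel. y \<in> cube z e \<longrightarrow> grad_of_curl (R y) (f y) j m k = G0 y"
              using HR
            proof eventually_elim
              case (elim y)
              show ?case
              proof
                assume "y \<in> cube z e"
                then have "y \<in> ?U" using cU by blast
                then show "grad_of_curl (R y) (f y) j m k = G0 y" using elim GG0 by (simp add: G_def)
              qed
            qed
          qed
          finally have eq: "mollify e (unit_index j) (\<lambda>x. R x $ m $ k) z = mollify e (\<lambda>_. 0) G0 z" .
          show ?thesis
            unfolding eq
          proof (rule mollify_near[OF e(1) G0])
            fix y assume "y \<in> cube z e"
            then have "dist y x < d2" using c d(3) by (force simp: dist_commute)
            then show "\<bar>G0 y - G x\<bar> \<le> \<epsilon> / 2" using d2(2)[of y] GG0[OF x] by simp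
          qed
        qed
        let ?g = "\<lambda>s. ?F e (x + s *\<^sub>R ?a) - s * G x"
        have "norm (?g t - ?g 0) \<le> \<epsilon> / 2 * norm (t - 0)"
        proof (rule field_differentiable_bound[where S = "{- \<bar>t\<bar>..\<bar>t\<bar>}"
              and f' = "\<lambda>s. mollify e (unit_index j) (\<lambda>x. R x $ m $ k) (x + s *\<^sub>R ?a) - G x"])
          fix s assume s: "s \<in> {- \<bar>t\<bar>..\<bar>t\<bar>}"
          have 1: "((\<lambda>s. ?F e (x + s *\<^sub>R ?a)) has_real_derivative mollify e (unit_index j) (\<lambda>x. R x $ m $ k) (x + s *\<^sub>R ?a)) (at s)"
            using has_partial_mollify[OF e(1) R(2)] by (simp flip: has_partial_shift)
          have 2: "((\<lambda>s. s * G x) has_real_derivative 1 * G x) (at s)"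
            by (rule DERIV_cmult_right[OF DERIV_ident])
          show "(?g has_field_derivative mollify e (unit_index j) (\<lambda>x. R x $ m $ k) (x + s *\<^sub>R ?a) - G x)
              (at s within {- \<bar>t\<bar>..\<bar>t\<bar>})"
            using has_field_derivative_at_within[OF DERIV_diff[OF 1 2]] by simp
          have "\<bar>s\<bar> < d" using s t by (simp add: abs_le_iff) linarith
          then have "dist x (x + s *\<^sub>R ?a) < d" by (simp add: dist_norm)
          then show "norm (mollify e (unit_index j) (\<lambda>x. R x $ m $ k) (x + s *\<^sub>R ?a) - G x) \<le> \<epsilon> / 2"
            using D by simp
        qed auto
        then show ?thesis by (simp add: algebra_simps)
      qed
      have "norm ((H (x + t *\<^sub>R ?a) $ m $ k - H x $ m $ k) / t - G x) < \<epsilon>" if t: "t \<noteq> 0" "norm (t - 0) < d" for t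
      proof -
        have "dist x (x + t *\<^sub>R ?a) < d1" using t d by (simp add: dist_norm)
        then have xt: "x + t *\<^sub>R ?a \<in> ?U" using d1(2) by auto
        have "(\<lambda>i. \<bar>?F (?e i) (x + t *\<^sub>R ?a) - ?F (?e i) x - t * G x\<bar>) \<longlonglongrightarrow> \<bar>H (x + t *\<^sub>R ?a) $ m $ k - H x $ m $ k - t * G x\<bar>"
          by (intro tendsto_rabs tendsto_diff lim x xt tendsto_const)
        moreover have "eventually (\<lambda>i. \<bar>?F (?e i) (x + t *\<^sub>R ?a) - ?F (?e i) x - t * G x\<bar> \<le> \<epsilon> / 2 * \<bar>t\<bar>) sequentially"
          by (rule eventually_mono[OF ev_small[OF d(1)]], rule bound[OF _ e0]) (use t in auto)
        ultimately have "\<bar>H (x + t *\<^sub>R ?a) $ m $ k - H x $ m $ k - t * G x\<bar> \<le> \<epsilon> / 2 * \<bar>t\<bar>"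
          by (rule tendsto_upperbound) simp
        moreover have "(H (x + t *\<^sub>R ?a) $ m $ k - H x $ m $ k) / t - G x = (H (x + t *\<^sub>R ?a) $ m $ k - H x $ m $ k - t * G x) / t"
          using t by (simp add: field_simps)
        ultimately have "norm ((H (x + t *\<^sub>R ?a) $ m $ k - H x $ m $ k) / t - G x) \<le> \<epsilon> / 2"
          using t by (simp add: abs_divide divide_le_eq)
        then show ?thesis using \<epsilon> by linarith
      qed
      then show "\<exists>s>0. \<forall>t. t \<noteq> 0 \<and> norm (t - 0) < s \<longrightarrow> norm ((H (x + t *\<^sub>R ?a) $ m $ k - H x $ m $ k) / t - G x) < \<epsilon>"
        using d(1) by blast
    qed
    then show ?thesis
      by (simp add: has_partial_def has_field_derivative_iff G_def)
  qed
  then show ?thesis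
    using Hc HR lim by (intro exI[of _ H]) simp
qed

section \<open>From local to global, and higher regularity\<close>

lemma has_partial_cong:
  assumes "open U" "x \<in> U" "\<And>y. y \<in> U \<Longrightarrow> u y = v y" "has_partial u j d x"
  shows "has_partial v j d x"
proof -
  let ?g = "\<lambda>t::real. x + t *\<^sub>R axis j 1"
  have "open (?g -` U)"
    by (intro continuous_open_vimage assms(1) continuous_intros)
  moreover have "0 \<in> ?g -` U" using assms(2) by simp
  ultimately show ?thesis
    using assms(3,4) unfolding has_partial_def
    by (auto intro: has_field_derivative_transform_within_open)
qed

section \<open>Closure of \<open>Ck_on\<close> under sums and products, and the bootstrap\<close>

lemma Ck_on_Suc_imp: "Ck_on (Suc k) u U \<Longrightarrow> Ck_on k u U"
proof (induction k arbitrary: u)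
  case (Suc k)
  then show ?case by (metis Ck_on.simps(2))
qed simp

lemma Ck_on_const: "Ck_on k (\<lambda>x. c) U"
proof (induction k arbitrary: c)
  case (Suc k)
  have "\<exists>dg. (\<forall>x\<in>U. has_partial (\<lambda>x. c) j (dg x) x) \<and> Ck_on k dg U" for j
    by (rule exI[of _ "\<lambda>x. 0"]) (simp add: Suc.IH)
  then show ?case by simp
qed simp

lemma Ck_on_add: "Ck_on k u U \<Longrightarrow> Ck_on k v U \<Longrightarrow> Ck_on k (\<lambda>x. u x + v x) U"
proof (induction k arbitrary: u v)
  case (Suc k)
  have "\<exists>dg. (\<forall>x\<in>U. has_partial (\<lambda>x. u x + v x) j (dg x) x) \<and> Ck_on k dg U" for j
  proof -
    obtain du where du: "\<forall>x\<in>U. has_partial u j (du x) x" "Ck_on k du U"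
      using Suc.prems(1) unfolding Ck_on.simps by (elim conjE allE[where x = j] exE) (rule that)
    obtain dv where dv: "\<forall>x\<in>U. has_partial v j (dv x) x" "Ck_on k dv U"
      using Suc.prems(2) unfolding Ck_on.simps by (elim conjE allE[where x = j] exE) (rule that)
    show ?thesis
    proof (rule exI[of _ "\<lambda>x. du x + dv x"], rule conjI, rule ballI)
      fix x assume "x \<in> U"
      then show "has_partial (\<lambda>x. u x + v x) j (du x + dv x) x"
        using du(1) dv(1) by (simp add: has_partial_add)
    qed (rule Suc.IH[OF du(2) dv(2)])
  qed
  then show ?case using Suc.prems by (simp add: continuous_on_add)
qed (simp add: continuous_on_add)

lemma Ck_on_mult: "Ck_on k u U \<Longrightarrow> Ck_on k v U \<Longrightarrow> Ck_on k (\<lambda>x. u x * v x) U"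
proof (induction k arbitrary: u v)
  case (Suc k)
  have "\<exists>dg. (\<forall>x\<in>U. has_partial (\<lambda>x. u x * v x) j (dg x) x) \<and> Ck_on k dg U" for j
  proof -
    obtain du where du: "\<forall>x\<in>U. has_partial u j (du x) x" "Ck_on k du U"
      using Suc.prems(1) unfolding Ck_on.simps by (elim conjE allE[where x = j] exE) (rule that)
    obtain dv where dv: "\<forall>x\<in>U. has_partial v j (dv x) x" "Ck_on k dv U"
      using Suc.prems(2) unfolding Ck_on.simps by (elim conjE allE[where x = j] exE) (rule that)
    show ?thesis
    proof (rule exI[of _ "\<lambda>x. du x * v x + u x * dv x"], rule conjI, rule ballI)
      fix x assume "x \<in> U"
      then show "has_partial (\<lambda>x. u x * v x) j (du x * v x + u x * dv x) x"
        using du(1) dv(1) by (simp add: has_partial_mult)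
    qed (rule Ck_on_add[OF Suc.IH[OF du(2) Ck_on_Suc_imp[OF Suc.prems(2)]]
          Suc.IH[OF Ck_on_Suc_imp[OF Suc.prems(1)] dv(2)]])
  qed
  then show ?case using Suc.prems by (simp add: continuous_on_mult)
qed (simp add: continuous_on_mult)

lemma Ck_on_sum: "(\<And>i. i \<in> I \<Longrightarrow> Ck_on k (u i) U) \<Longrightarrow> Ck_on k (\<lambda>x. \<Sum>i\<in>I. u i x) U"
  by (induction I rule: infinite_finite_induct) (simp_all add: Ck_on_const Ck_on_add)

lemma Ck_on_diff:
  assumes "Ck_on k u U" "Ck_on k v U"
  shows "Ck_on k (\<lambda>x. u x - v x) U"
proof -
  have "Ck_on k (\<lambda>x. u x + (- 1) * v x) U"
    by (intro Ck_on_add Ck_on_mult Ck_on_const assms)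
  then show ?thesis by simp
qed

lemma Ck_on_grad_of_curl:
  fixes A :: "real^'n \<Rightarrow> real^'n^'n" and g :: "real^'n \<Rightarrow> real^'n^'n^'n"
  assumes "\<And>m k. Ck_on i (\<lambda>x. A x $ m $ k) U" "\<And>m j k. Ck_on i (\<lambda>x. g x $ m $ j $ k) U"
  shows "Ck_on i (\<lambda>x. grad_of_curl (A x) (g x) j m k) U"
  unfolding grad_of_curl_def curl_frame_def divide_inverse
  by (intro Ck_on_sum Ck_on_mult Ck_on_add Ck_on_diff Ck_on_const assms)

text \<open>The gradient is a polynomial in the rotation field and its Curl.\<close>
lemma Ck_on_Suc_rotation:
  fixes A :: "real^'n \<Rightarrow> real^'n^'n" and g :: "real^'n \<Rightarrow> real^'n^'n^'n"
  assumes A: "\<And>m k. continuous_on U (\<lambda>x. A x $ m $ k)"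
    and D: "\<And>x j m k. x \<in> U \<Longrightarrow> has_partial (\<lambda>x. A x $ m $ k) j (grad_of_curl (A x) (g x) j m k) x"
    and g: "\<And>m j k. Ck_on i (\<lambda>x. g x $ m $ j $ k) U"
  shows "Ck_on (Suc i) (\<lambda>x. A x $ m $ k) U"
proof -
  have step: "Ck_on (Suc i) (\<lambda>x. A x $ m $ k) U"
    if "\<And>j. Ck_on i (\<lambda>x. grad_of_curl (A x) (g x) j m k) U" for i m k
    unfolding Ck_on.simps(2)
  proof (intro conjI allI A)
    fix j show "\<exists>dg. (\<forall>x\<in>U. has_partial (\<lambda>x. A x $ m $ k) j (dg x) x) \<and> Ck_on i dg U"
      by (rule exI[of _ "\<lambda>x. grad_of_curl (A x) (g x) j m k"], intro conjI ballI D that)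
  qed
  show ?thesis
    using g
  proof (induction i arbitrary: m k)
    case 0
    show ?case by (intro step Ck_on_grad_of_curl 0) (simp add: A)
  next
    case (Suc i)
    show ?case
      by (intro step Ck_on_grad_of_curl Suc.prems Suc.IH Ck_on_Suc_imp[OF Suc.prems])
  qed
qed

section \<open>Borel representatives and passage from \<open>lebesgue_on\<close> to
  \<open>lborel\<close>\<close>

lemma mat_1_SO: "(mat 1 :: real^'n^'n) \<in> SO"
  by (simp add: SO_def orthogonal_matrix_id)

lemma SO_iff:
  fixes A :: "real^'n^'n"
  shows "A \<in> SO \<longleftrightarrow> (\<forall>k j. (\<Sum>l\<in>UNIV. A $ l $ k * A $ l $ j) = (if k = j then 1 else 0)) \<and> det A = 1"
  by (auto simp: SO_def orthogonal_matrix vec_eq_iff matrix_matrix_mult_def transpose_def mat_def)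

text \<open>Each entry is changed on a null set to a Borel function; wherever the resulting matrix
  is not a rotation it is replaced by the identity, which gives a rotation at every point, also
  outside \<open>\<Omega>\<close>.\<close>

lemma borel_rotation_representative:
  fixes R :: "real^'n \<Rightarrow> real^'n^'n"
  assumes \<Omega>: "open \<Omega>" and SO: "\<And>x. x \<in> \<Omega> \<Longrightarrow> R x \<in> SO"
    and R: "R \<in> borel_measurable (lebesgue_on \<Omega>)"
  obtains R0 where "\<And>x. R0 x \<in> SO" "\<And>m k. bounded_borel (\<lambda>x. R0 x $ m $ k)"
    "AE x in lborel. x \<in> \<Omega> \<longrightarrow> R0 x = R x"
proof -
  have "\<exists>g. g \<in> borel_measurable lborel \<and> (AE x in lborel. (if x \<in> \<Omega> then R x $ m $ k else 0) = g x)" for m k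
  proof -
    have "(\<lambda>x. R x $ m $ k) \<in> borel_measurable (lebesgue_on \<Omega>)"
      by (intro measurable_compose[OF R] borel_measurable_continuous_onI continuous_intros)
    then have "(\<lambda>x. if x \<in> \<Omega> then R x $ m $ k else 0) \<in> borel_measurable lebesgue"
      using \<Omega> by (intro borel_measurable_if_I) auto
    from completion_ex_borel_measurable_real[OF this] show ?thesis by blast
  qed
  then have "\<forall>m. \<exists>G. \<forall>k. G k \<in> borel_measurable lborel \<and> (AE x in lborel. (if x \<in> \<Omega> then R x $ m $ k else 0) = G k x)"
    by (intro allI choice)  blast
  from choice[OF this] obtain G where
    G': "\<forall>m k. G m k \<in> borel_measurable lborel \<and> (AE x in lborel. (if x \<in> \<Omega> then R x $ m $ k else 0) = G m k x)"
    by (elim exE) (rule that)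
  then have [measurable]: "G m k \<in> borel_measurable borel" for m k by simp
  define A :: "real^'n \<Rightarrow> real^'n^'n" where "A x = (\<chi> m k. G m k x)" for x
  define R0 where "R0 x = (if A x \<in> SO then A x else mat 1)" for x
  have [measurable]: "(\<lambda>x. A x $ m $ k) \<in> borel_measurable borel" for m k
    by (simp add: A_def)
  have [measurable]: "(\<lambda>x. det (A x)) \<in> borel_measurable borel"
    unfolding det_def by measurable
  have [measurable]: "Measurable.pred borel (\<lambda>x. A x \<in> SO)"
    unfolding SO_iff by measurable
  have SO0: "R0 x \<in> SO" for x
    by (simp add: R0_def mat_1_SO)
  have "(\<lambda>x. R0 x $ m $ k) \<in> borel_measurable borel" for m k
    unfolding R0_def if_distrib[of "\<lambda>B. B $ m $ k"] by measurable
  then have bb: "bounded_borel (\<lambda>x. R0 x $ m $ k)" for m k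
    using SO_entry_le_1[OF SO0] by (intro bounded_borelI) auto
  have "AE x in lborel. \<forall>m k. (if x \<in> \<Omega> then R x $ m $ k else 0) = G m k x"
    using G' by (intro eventually_all_finite) auto
  then have "AE x in lborel. x \<in> \<Omega> \<longrightarrow> R0 x = R x"
  proof eventually_elim
    case (elim x)
    show ?case
    proof
      assume x: "x \<in> \<Omega>"
      then have "A x = R x" using elim by (simp add: A_def vec_eq_iff)
      then show "R0 x = R x" using SO[OF x] by (simp add: R0_def)
    qed
  qed
  with SO0 bb show ?thesis by (rule that)
qed

text \<open>Carries the weak equation, stated for Lebesgue measure on \<open>\<Omega>\<close>, over
  to integrals on the whole space; the kernels make the integrands vanish off
  \<open>\<Omega>\<close>.\<close>

lemma integral_lebesgue_on_eq_lborel: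
  fixes u w :: "'a::euclidean_space \<Rightarrow> real"
  assumes "open \<Omega>" "w \<in> borel_measurable (lebesgue_on \<Omega>)" "u \<in> borel_measurable borel"
    and "AE x in lborel. x \<in> \<Omega> \<longrightarrow> w x = u x" "\<And>x. x \<notin> \<Omega> \<Longrightarrow> u x = 0"
  shows "(\<integral>x. w x \<partial>lebesgue_on \<Omega>) = (LBINT x. u x)"
proof -
  have \<Omega>: "\<Omega> \<in> sets lebesgue" using assms(1) by auto
  have u: "u \<in> borel_measurable lebesgue" using assms(3) by (intro measurable_completion) simp
  have "(\<integral>x. w x \<partial>lebesgue_on \<Omega>) = (\<integral>x. u x \<partial>lebesgue_on \<Omega>)"
  proof (rule integral_cong_AE[OF assms(2)])
    show "u \<in> borel_measurable (lebesgue_on \<Omega>)" using u by (rule measurable_restrict_space1)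
    have "AE x in lebesgue. x \<in> \<Omega> \<longrightarrow> w x = u x" using assms(4) by (rule AE_completion)
    then show "AE x in lebesgue_on \<Omega>. w x = u x"
      using \<Omega> by (subst AE_restrict_space_iff) auto
  qed
  also have "\<dots> = (\<integral>x. indicator \<Omega> x *\<^sub>R u x \<partial>lebesgue)"
    using \<Omega> by (intro integral_restrict_space) simp
  also have "(\<lambda>x. indicator \<Omega> x *\<^sub>R u x) = u"
    using assms(5) by (auto simp: fun_eq_iff indicator_def)
  also have "(\<integral>x. u x \<partial>lebesgue) = (LBINT x. u x)"
    using assms(3) by (intro integral_completion) simp
  finally show ?thesis .
qed

lemma pderiv_mollifier:
  assumes "e > 0"
  shows "Defs.pderiv (\<lambda>y. mollifier e a (x - y)) j y = - mollifier e (raise a j) (x - y)"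
  using has_partial_mollifier_reflect[OF assms, of a x j y]
  unfolding has_partial_def Defs.pderiv_def by (rule DERIV_imp_deriv)

theorem theorem5p5:
  fixes \<Omega> :: "(real^'n) set" and R :: "real^'n \<Rightarrow> real^'n^'n"
    and f :: "real^'n \<Rightarrow> real^'n^'n^'n" and k :: nat
  assumes "open \<Omega>"
    and "\<forall>x\<in>\<Omega>. R x \<in> SO"
    and "R \<in> borel_measurable (lebesgue_on \<Omega>)"
    and "\<forall>m j l. Ck_on k (\<lambda>x. f x $ m $ j $ l) \<Omega>"
    and "\<forall>\<phi> m j l. test_fun \<Omega> \<phi> \<longrightarrow>
           (\<integral>x. (R x $ m $ l * pderiv \<phi> j x - R x $ m $ j * pderiv \<phi> l x) \<partial>lebesgue_on \<Omega>)
             = - (\<integral>x. \<phi> x * f x $ m $ j $ l \<partial>lebesgue_on \<Omega>)"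
  shows "\<exists>R'. (\<forall>m l. Ck_on (Suc k) (\<lambda>x. R' x $ m $ l) \<Omega>) \<and>
              (AE x in lebesgue_on \<Omega>. R' x = R x)"
proof -
  obtain R0 where SO0: "\<And>x. R0 x \<in> SO" and R0: "\<And>m k. bounded_borel (\<lambda>x. R0 x $ m $ k)"
    and R0R: "AE x in lborel. x \<in> \<Omega> \<longrightarrow> R0 x = R x"
    by (rule borel_rotation_representative[OF assms(1) _ assms(3)]) (use assms(2) in blast, rule that)
  have f_cont: "continuous_on \<Omega> (\<lambda>x. f x $ m $ j $ l)" for m j l
    using assms(4) by (cases k) auto
  \<comment> \<open>A single global definition through fixed scales: near each point it coincides
    with the local representative \<open>H\<close>, so no patching is required.\<close>
  define R' :: "real^'n \<Rightarrow> real^'n^'n" where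
    "R' x = (\<chi> m l. lim (\<lambda>i. mollify (inverse (real (Suc i))) (\<lambda>_. 0) (\<lambda>x. R0 x $ m $ l) x))" for x
  have main: "\<exists>U. open U \<and> x0 \<in> U \<and> (\<forall>m l. continuous_on U (\<lambda>x. R' x $ m $ l)) \<and>
      (AE x in lborel. x \<in> U \<longrightarrow> R' x = R0 x) \<and>
      (\<forall>x\<in>U. \<forall>j m l. has_partial (\<lambda>x. R' x $ m $ l) j (grad_of_curl (R' x) (f x) j m l) x)"
    if x0: "x0 \<in> \<Omega>" for x0
  proof -
    obtain r where r: "r > 0" "cball x0 r \<subseteq> \<Omega>"
      using assms(1) x0 open_contains_cball by blast
    let ?Q = "ball x0 r"
    have Q\<Omega>: "?Q \<subseteq> \<Omega>" using r(2) ball_subset_cball by blast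
    have "\<exists>C. \<forall>x\<in>cball x0 r. \<bar>f x $ m $ j $ l\<bar> \<le> C" for m j l
    proof -
      have "compact ((\<lambda>x. f x $ m $ j $ l) ` cball x0 r)"
        by (intro compact_continuous_image continuous_on_subset[OF f_cont r(2)] compact_cball)
      then show ?thesis
        by (auto dest!: compact_imp_bounded simp: bounded_iff)
    qed
    then have "\<exists>C. \<forall>m j l. \<forall>x\<in>cball x0 r. \<bar>f x $ m $ j $ l\<bar> \<le> C m j l" by metis
    then obtain C where C: "\<forall>m j l. \<forall>x\<in>cball x0 r. \<bar>f x $ m $ j $ l\<bar> \<le> C m j l" by (elim exE) (rule that)
    define B where "B = (\<Sum>(m, j, l)\<in>UNIV. \<bar>C m j l\<bar>)"
    have B0: "0 \<le> B" unfolding B_def by (intro sum_nonneg) auto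
    have B: "\<bar>f x $ m $ j $ l\<bar> \<le> B" if "x \<in> ?Q" for x m j l
    proof -
      have "\<bar>C m j l\<bar> \<le> B"
        unfolding B_def using member_le_sum[of "(m, j, l)" UNIV "\<lambda>(m, j, l). \<bar>C m j l\<bar>"] by auto
      moreover have "\<bar>f x $ m $ j $ l\<bar> \<le> C m j l" using C that by simp
      ultimately show ?thesis by linarith
    qed
    \<comment> \<open>\<open>f\<close> may be unbounded on \<open>\<Omega>\<close>; it is cut off to
      a ball whose closure is a compact subset of \<open>\<Omega>\<close>.\<close>
    define f0 :: "real^'n \<Rightarrow> real^'n^'n^'n" where "f0 x = (\<chi> m j l. indicator ?Q x * f x $ m $ j $ l)" for x
    have f0: "bounded_borel (\<lambda>x. f0 x $ m $ j $ l)" "\<bar>f0 x $ m $ j $ l\<bar> \<le> B"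
      "x \<in> ?Q \<Longrightarrow> isCont (\<lambda>x. f0 x $ m $ j $ l) x" for x m j l
    proof -
      have c: "continuous_on ?Q (\<lambda>x. f x $ m $ j $ l)"
        by (rule continuous_on_subset[OF f_cont Q\<Omega>])
      show "bounded_borel (\<lambda>x. f0 x $ m $ j $ l)"
        using bounded_borel_indicator_mult[OF open_ball c B B0] by (simp add: f0_def)
      show "\<bar>f0 x $ m $ j $ l\<bar> \<le> B"
        using B B0 by (simp add: f0_def indicator_def)
      show "x \<in> ?Q \<Longrightarrow> isCont (\<lambda>x. f0 x $ m $ j $ l) x"
        using continuous_on_indicator_mult_isCont[OF open_ball c] by (simp add: f0_def)
    qed
    have "curl_equation ?Q R0 f0 B"
    proof (unfold_locales, goal_cases)
      case 1 show ?case by (rule open_ball)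
    next
      case 2 show ?case by (rule SO0)
    next
      case 3 show ?case by (rule R0)
    next
      case 4 show ?case by (rule f0(1))
    next
      case 5 show ?case by (rule f0(2))
    next
      case 6 then show ?case by (rule f0(3))
    next
      \<comment> \<open>The weak equation tested with the kernel at \<open>x\<close>:
        differentiating in \<open>y\<close> a function of \<open>x - y\<close> gives minus signs,
        which cancel the minus sign of the weak formulation.\<close>
      case (7 x d m j l)
      let ?\<phi> = "\<lambda>a y. mollifier d a (x - y)"
      have \<phi>_0: "?\<phi> a y = 0" if "y \<notin> ?Q" for a y
        using mollifier_eq_0[OF 7(1)] 7(2) that by blast
      have \<phi>s: "bounded_supp (?\<phi> a)" for a by (rule bounded_supp_mollifier_reflect[OF 7(1)])
      have t: "test_fun \<Omega> (?\<phi> (\<lambda>_. 0))"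
        using 7 Q\<Omega> by (intro test_fun_mollifier) auto
      have "(\<integral>y. (R y $ m $ l * - ?\<phi> (unit_index j) y - R y $ m $ j * - ?\<phi> (unit_index l) y) \<partial>lebesgue_on \<Omega>) =
          (LBINT y. (R0 y $ m $ l * - ?\<phi> (unit_index j) y - R0 y $ m $ j * - ?\<phi> (unit_index l) y))"
      proof (rule integral_lebesgue_on_eq_lborel[OF assms(1)])
        have "(\<lambda>y. R y $ m $ l) \<in> borel_measurable (lebesgue_on \<Omega>)" for m l
          by (intro measurable_compose[OF assms(3)] borel_measurable_continuous_onI continuous_intros)
        moreover have "?\<phi> a \<in> borel_measurable (lebesgue_on \<Omega>)" for a
          using bounded_supp_borel[OF \<phi>s]
          by (intro measurable_restrict_space1 measurable_completion) (simp add: bounded_borel_def)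
        ultimately show "(\<lambda>y. R y $ m $ l * - ?\<phi> (unit_index j) y - R y $ m $ j * - ?\<phi> (unit_index l) y)
            \<in> borel_measurable (lebesgue_on \<Omega>)"
          by (intro borel_measurable_diff borel_measurable_times borel_measurable_uminus)
        have "bounded_borel (\<lambda>y. R0 y $ m $ l * - ?\<phi> (unit_index j) y - R0 y $ m $ j * - ?\<phi> (unit_index l) y)"
          by (intro bounded_borel_diff bounded_borel_mult bounded_borel_uminus R0 bounded_supp_borel[OF \<phi>s])
        then show "(\<lambda>y. R0 y $ m $ l * - ?\<phi> (unit_index j) y - R0 y $ m $ j * - ?\<phi> (unit_index l) y)
            \<in> borel_measurable borel"
          by (rule bounded_borel_measurable)
        show "AE y in lborel. y \<in> \<Omega> \<longrightarrow>
            R y $ m $ l * - ?\<phi> (unit_index j) y - R y $ m $ j * - ?\<phi> (unit_index l) y =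
            R0 y $ m $ l * - ?\<phi> (unit_index j) y - R0 y $ m $ j * - ?\<phi> (unit_index l) y"
          using R0R by eventually_elim simp
        show "R0 y $ m $ l * - ?\<phi> (unit_index j) y - R0 y $ m $ j * - ?\<phi> (unit_index l) y = 0"
          if "y \<notin> \<Omega>" for y
        proof -
          have "y \<notin> ?Q" using that Q\<Omega> by blast
          from \<phi>_0[OF this] show ?thesis by simp
        qed
      qed
      also have "\<dots> = - mollify d (unit_index j) (\<lambda>x. R0 x $ m $ l) x + mollify d (unit_index l) (\<lambda>x. R0 x $ m $ j) x"
      proof -
        have i: "integrable lborel (\<lambda>y. ?\<phi> a y * R0 y $ m $ l)" for a l
          by (rule mollify_integrable[OF 7(1) R0])
        have "(LBINT y. (R0 y $ m $ l * - ?\<phi> (unit_index j) y - R0 y $ m $ j * - ?\<phi> (unit_index l) y)) =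
            (LBINT y. (?\<phi> (unit_index l) y * R0 y $ m $ j - ?\<phi> (unit_index j) y * R0 y $ m $ l))"
          by (intro Bochner_Integration.integral_cong refl) (simp add: mult.commute)
        also have "\<dots> = (LBINT y. ?\<phi> (unit_index l) y * R0 y $ m $ j) - (LBINT y. ?\<phi> (unit_index j) y * R0 y $ m $ l)"
          by (rule Bochner_Integration.integral_diff[OF i i])
        finally show ?thesis by (simp add: mollify_def)
      qed
      finally have lhs: "(\<integral>y. (R y $ m $ l * pderiv (?\<phi> (\<lambda>_. 0)) j y - R y $ m $ j * pderiv (?\<phi> (\<lambda>_. 0)) l y) \<partial>lebesgue_on \<Omega>) =
          - mollify d (unit_index j) (\<lambda>x. R0 x $ m $ l) x + mollify d (unit_index l) (\<lambda>x. R0 x $ m $ j) x"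
        unfolding pderiv_mollifier[OF 7(1)] .
      have fm: "(\<lambda>y. ?\<phi> (\<lambda>_. 0) y * f0 y $ m $ j $ l) \<in> borel_measurable borel"
        by (intro bounded_borel_measurable bounded_borel_mult bounded_supp_borel[OF \<phi>s] f0)
      have eq: "?\<phi> (\<lambda>_. 0) y * f y $ m $ j $ l = ?\<phi> (\<lambda>_. 0) y * f0 y $ m $ j $ l" for y
        using \<phi>_0[of y] by (cases "y \<in> ?Q") (auto simp: f0_def)
      have "(\<integral>y. ?\<phi> (\<lambda>_. 0) y * f y $ m $ j $ l \<partial>lebesgue_on \<Omega>) = (LBINT y. ?\<phi> (\<lambda>_. 0) y * f0 y $ m $ j $ l)"
        unfolding eq
      proof (rule integral_lebesgue_on_eq_lborel[OF assms(1) _ fm])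
        show "(\<lambda>y. ?\<phi> (\<lambda>_. 0) y * f0 y $ m $ j $ l) \<in> borel_measurable (lebesgue_on \<Omega>)"
          using fm by (intro measurable_restrict_space1 measurable_completion) simp
        show "?\<phi> (\<lambda>_. 0) y * f0 y $ m $ j $ l = 0" if "y \<notin> \<Omega>" for y
        proof -
          have "y \<notin> ?Q" using that Q\<Omega> by blast
          from \<phi>_0[OF this, of "\<lambda>_. 0"] show ?thesis by simp
        qed
      qed simp
      also have "\<dots> = mollify d (\<lambda>_. 0) (\<lambda>x. f0 x $ m $ j $ l) x"
        by (simp add: mollify_def)
      finally have rhs: "(\<integral>y. ?\<phi> (\<lambda>_. 0) y * f y $ m $ j $ l \<partial>lebesgue_on \<Omega>) = mollify d (\<lambda>_. 0) (\<lambda>x. f0 x $ m $ j $ l) x" .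
      have "(\<integral>y. (R y $ m $ l * pderiv (?\<phi> (\<lambda>_. 0)) j y - R y $ m $ j * pderiv (?\<phi> (\<lambda>_. 0)) l y) \<partial>lebesgue_on \<Omega>) =
          - (\<integral>y. ?\<phi> (\<lambda>_. 0) y * f y $ m $ j $ l \<partial>lebesgue_on \<Omega>)"
        using assms(5) t by blast
      then show ?case
        unfolding lhs rhs by simp
    qed
    from curl_equation.local_regularity[OF this order_refl r(1)]
    obtain H where Hc: "\<forall>m k. continuous_on (ball x0 (r/2)) (\<lambda>x. H x $ m $ k)"
      and HR: "AE x in lborel. x \<in> ball x0 (r/2) \<longrightarrow> H x = R0 x"
      and lim: "\<forall>x\<in>ball x0 (r/2). \<forall>m k. (\<lambda>i. mollify (inverse (real (Suc i))) (\<lambda>_. 0) (\<lambda>x. R0 x $ m $ k) x) \<longlonglongrightarrow> H x $ m $ k"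
      and HD: "\<forall>x\<in>ball x0 (r/2). \<forall>j m k. has_partial (\<lambda>x. H x $ m $ k) j (grad_of_curl (H x) (f0 x) j m k) x"
      by (elim exE conjE) (rule that)
    let ?U = "ball x0 (r/2)"
    have HR': "R' x = H x" if "x \<in> ?U" for x
      using lim that by (auto simp: R'_def vec_eq_iff intro!: limI)
    have ff0: "f0 x = f x" if "x \<in> ?U" for x
      using that r(1) by (simp add: f0_def vec_eq_iff)
    have "continuous_on ?U (\<lambda>x. R' x $ m $ l)" for m l
    proof -
      have "continuous_on ?U (\<lambda>x. R' x $ m $ l) = continuous_on ?U (\<lambda>x. H x $ m $ l)"
        by (intro continuous_on_cong refl) (simp only: HR')
      then show ?thesis using Hc by simp
    qed
    moreover have "AE x in lborel. x \<in> ?U \<longrightarrow> R' x = R0 x"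
      using HR by eventually_elim (simp add: HR')
    moreover have "has_partial (\<lambda>x. R' x $ m $ l) j (grad_of_curl (R' x) (f x) j m l) x" if x: "x \<in> ?U" for x j m l
    proof (rule has_partial_cong[OF open_ball x])
      show "H y $ m $ l = R' y $ m $ l" if "y \<in> ?U" for y using HR'[OF that] by simp
      show "has_partial (\<lambda>x. H x $ m $ l) j (grad_of_curl (R' x) (f x) j m l) x"
        using HD x by (simp add: HR' flip: ff0)
    qed
    ultimately show ?thesis
      using r(1) by (intro exI[of _ ?U] conjI allI ballI) auto
  qed
  have cont: "continuous_on \<Omega> (\<lambda>x. R' x $ m $ l)" for m l
  proof (intro continuous_at_imp_continuous_on ballI)
    fix x assume "x \<in> \<Omega>"
    then obtain U where "open U" "x \<in> U" "\<forall>m l. continuous_on U (\<lambda>x. R' x $ m $ l)"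
      using main by metis
    then show "isCont (\<lambda>x. R' x $ m $ l) x"
      using continuous_on_eq_continuous_at by blast
  qed
  have D: "has_partial (\<lambda>x. R' x $ m $ l) j (grad_of_curl (R' x) (f x) j m l) x" if "x \<in> \<Omega>" for x j m l
    using main[OF that] by blast
  have "Ck_on (Suc k) (\<lambda>x. R' x $ m $ l) \<Omega>" for m l
    using assms(4) by (intro Ck_on_Suc_rotation[OF cont D]) auto
  moreover have "AE x in lebesgue_on \<Omega>. R' x = R x"
  proof -
    \<comment> \<open>\<open>main\<close> gives agreement almost everywhere only near each point; a
      locally negligible set is negligible.\<close>
    let ?N = "{x \<in> \<Omega>. R' x \<noteq> R0 x}"
    have "negligible ?N"
      unfolding locally_negligible_alt[of ?N]
    proof
      fix x assume "x \<in> ?N"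
      then obtain U where U: "open U" "x \<in> U" and ae: "AE x in lborel. x \<in> U \<longrightarrow> R' x = R0 x"
        using main[of x] by blast
      have "AE x in lebesgue. x \<in> U \<longrightarrow> R' x = R0 x" using ae by (rule AE_completion)
      then obtain N where N: "N \<in> null_sets lebesgue" "{x \<in> space lebesgue. \<not> (x \<in> U \<longrightarrow> R' x = R0 x)} \<subseteq> N"
        by (auto simp: eventually_ae_filter)
      have "negligible (?N \<inter> U)"
        by (rule negligible_subset[of N]) (use N in \<open>auto simp: negligible_iff_null_sets\<close>)
      moreover have "openin (top_of_set ?N) (?N \<inter> U)" using U(1) by (rule openin_open_Int)
      ultimately show "\<exists>V. openin (top_of_set ?N) V \<and> x \<in> V \<and> negligible V"
        using U(2) \<open>x \<in> ?N\<close> by blast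
    qed
    then have "AE x in lebesgue. x \<notin> ?N"
      by (intro AE_not_in) (simp add: negligible_iff_null_sets)
    moreover have "AE x in lebesgue. x \<in> \<Omega> \<longrightarrow> R0 x = R x" using R0R by (rule AE_completion)
    ultimately have "AE x in lebesgue. x \<in> \<Omega> \<longrightarrow> R' x = R x"
      by eventually_elim auto
    then show ?thesis
      using assms(1) by (subst AE_restrict_space_iff) auto
  qed
  ultimately show ?thesis by blast
qed

end
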